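(* Let $\alpha\in(1/2,1)$ and $C$ be constants and let $G$ be a typical hyperbolic random graph from $\mathcal G(n,\alpha,C)$, with maximum degree $\Delta$ and chromatic number $\chi$. 1. For any constant $\varepsilon>0$, the algorithm RCT executed on $G$ with a colour space of $\varepsilon\cdot\Delta$ colours terminates after exactly 2 rounds a.a.s. 2. There exists a constant $\delta>0$ such that RCT executed on $G$ with a colour space of $n^{\delta}\cdot\chi$ colours never terminates w.e.h.p.
   Context: Hyperbolic random graph $\mathcal G(n,\alpha,C)$: for constants $\alpha\in(1/2,1)$ and $C$, set $R=2\log n+C$ (natural logarithm). Let $\mathcal D_R$ be the disk of radius $R$ around the origin in the hyperbolic plane of curvature $-1$, with points in polar coordinates $(r,\varphi)$. The hyperbolic distance satisfies $\cosh d(x,y)=\cosh r(x)\cosh r(y)-\sinh r(x)\sinh r(y)\cos(\varphi(x)-\varphi(y))$. The vertex set $V$ is a Poisson point process on $\mathcal D_R$ with intensity $n\rho(r)$ with respect to $dr\,d\varphi$, where $\rho(r)=\frac{\alpha\sinh(\alpha r)}{2\pi(\cosh(\alpha R)-1)}$. Two vertices are adjacent iff their hyperbolic distance is at most $R$. Asymptotics are as $n\to\infty$. An event holds a.a.s. if it has probability $1-o(1)$, and w.e.h.p. if it has probability $1-n^{-\omega(1)}$. A typical hyperbolic random graph is a graph having every property that holds a.a.s. for $G\sim\mathcal G(n,\alpha,C)$. Probabilistic statements about an algorithm run on a typical hyperbolic random graph refer to the algorithm's randomness, conditioned on the input being typical. Random colour trial (RCT) with colour space $\Psi$: initially all vertices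 are uncoloured. In each round, every uncoloured vertex $u$ picks a candidate colour uniformly at random, independently, from its palette. The palette is $\Psi$ minus the colours permanently assigned to neighbours of $u$ in earlier rounds. A vertex permanently adopts its candidate colour iff no neighbour picks the same candidate colour in that round. The algorithm terminates after round $t$ if all vertices are coloured after $t$ rounds. It never terminates if some vertex remains uncoloured forever. *)

theory Defs
  imports "HOL-Probability.Probability"
begin

section \<open>Finite simple graphs\<close>

text \<open>A graph is a pair of its vertex set and its set of edges, each edge being an unordered pair
  of distinct vertices.\<close>

type_synonym 'v ugraph = "'v set \<times> 'v set set"

definition verts :: "'v ugraph \<Rightarrow> 'v set" where
  "verts G = fst G"

definition edges :: "'v ugraph \<Rightarrow> 'v set set" where
  "edges G = snd G"

definition neighbours :: "'v ugraph \<Rightarrow> 'v \<Rightarrow> 'v set" where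
  "neighbours G u = {v \<in> verts G. {u, v} \<in> edges G}"

text \<open>The graph without vertices gets maximum degree 0.\<close>

definition max_degree :: "'v ugraph \<Rightarrow> nat" where
  "max_degree G = Max (insert 0 ((\<lambda>v. card (neighbours G v)) ` verts G))"

definition proper_colouring :: "'v ugraph \<Rightarrow> ('v \<Rightarrow> 'c) \<Rightarrow> bool" where
  "proper_colouring G c \<longleftrightarrow> (\<forall>u\<in>verts G. \<forall>v\<in>verts G. {u, v} \<in> edges G \<longrightarrow> c u \<noteq> c v)"

definition chromatic_number :: "'v ugraph \<Rightarrow> nat" where
  "chromatic_number G = (LEAST k. \<exists>c :: 'v \<Rightarrow> nat. c ` verts G \<subseteq> {..<k} \<and> proper_colouring G c)"


section \<open>Poisson point processes\<close>

text \<open>A Poisson point process whose intensity measure \<open>\<mu>\<close> is finite and non-zero, presented with an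
  enumeration of its points: an outcome \<open>(N, X)\<close> stands for the point configuration
  \<open>X 0, \<dots>, X (N - 1)\<close>, where the number of points \<open>N\<close> is Poisson distributed with
  mean \<open>\<mu>(space \<mu>)\<close> and the points are independent with distribution \<open>\<mu> / \<mu>(space \<mu>)\<close>.
  The theorem \<open>poisson_process_counts\<close> below proves the defining property of a Poisson point
  process: the numbers of points in disjoint measurable sets are independent and Poisson
  distributed, with means given by \<open>\<mu>\<close>.\<close>

definition poisson_process :: "'a measure \<Rightarrow> (nat \<times> (nat \<Rightarrow> 'a)) measure" where
  "poisson_process \<mu> =
     measure_pmf (poisson_pmf (measure \<mu> (space \<mu>)))
       \<Otimes>\<^sub>M (\<Pi>\<^sub>M i\<in>UNIV. uniform_measure \<mu> (space \<mu>))"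

definition points_in :: "'a set \<Rightarrow> nat \<times> (nat \<Rightarrow> 'a) \<Rightarrow> nat" where
  "points_in B = (\<lambda>(N, X). card {i. i < N \<and> X i \<in> B})"

lemma card_less_Suc_case_nat:
  "card {j. j < Suc m \<and> case_nat x X j \<in> B} = (if x \<in> B then 1 else 0) + card {j. j < m \<and> X j \<in> B}"
proof -
  have "{j. j < Suc m \<and> case_nat x X j \<in> B} = (if x \<in> B then {0} else {}) \<union> Suc ` {j. j < m \<and> X j \<in> B}"
    by (auto simp: image_iff split: nat.splits) (metis Suc_less_eq gr0_conv_Suc old.nat.simps(5) not0_implies_Suc)+
  moreover have "card (Suc ` {j. j < m \<and> X j \<in> B}) = card {j. j < m \<and> X j \<in> B}"
    by (intro card_image) auto
  ultimately show ?thesis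
    by (auto simp: card_Un_disjoint)
qed

lemma multinomial_step:
  fixes p :: "'i \<Rightarrow> real" and c :: "'i \<Rightarrow> nat"
  assumes "finite I"
  defines "F \<equiv> (\<lambda>c. \<Prod>i\<in>I. p i ^ c i / fact (c i))"
  defines "W \<equiv> (\<lambda>(m::nat) c. if (\<Sum>i\<in>I. c i) = m then fact m * F c else 0)"
  shows "(\<Sum>i\<in>I. (if c i = 0 then 0 else W m (c(i := c i - 1))) * p i) = W (Suc m) c"
proof -
  have F: "F (c(i := c i - 1)) * p i = F c * c i" if "i \<in> I" "c i \<noteq> 0" for i
  proof -
    have *: "(\<Prod>j\<in>I-{i}. p j ^ (c(i := c i - 1)) j / fact ((c(i := c i - 1)) j)) = (\<Prod>j\<in>I-{i}. p j ^ c j / fact (c j))"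
      by (intro prod.cong) auto
    obtain k where "c i = Suc k" using \<open>c i \<noteq> 0\<close> not0_implies_Suc by blast
    moreover have "fact k + fact k * real k \<noteq> 0"
      by (metis add_nonneg_eq_0_iff fact_ge_zero fact_nonzero mult_nonneg_nonneg of_nat_0_le_iff)
    ultimately show ?thesis
      unfolding F_def using that assms(1) *
      by (simp add: prod.remove[of I i] field_simps)
  qed
  have S: "(\<Sum>j\<in>I. (c(i := c i - 1)) j) = (\<Sum>j\<in>I. c j) - 1" if "i \<in> I" "c i \<noteq> 0" for i
  proof -
    have *: "(\<Sum>j\<in>I-{i}. (c(i := c i - 1)) j) = (\<Sum>j\<in>I-{i}. c j)"
      by (intro sum.cong) auto
    show ?thesis
      using that assms(1) * by (simp add: sum.remove[of I i])
  qed
  have pos: "(\<Sum>j\<in>I. c j) \<noteq> 0" if "i \<in> I" "c i \<noteq> 0" for i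
    using that assms(1) by auto
  show ?thesis
  proof (cases "(\<Sum>j\<in>I. c j) = Suc m")
    case True
    have "(if c i = 0 then 0 else W m (c(i := c i - 1))) * p i = fact m * F c * c i" if "i \<in> I" for i
      using that True S F by (auto simp: W_def)
    then have "(\<Sum>i\<in>I. (if c i = 0 then 0 else W m (c(i := c i - 1))) * p i) = (\<Sum>i\<in>I. fact m * F c * c i)"
      by (intro sum.cong) auto
    also have "\<dots> = fact m * F c * real (\<Sum>i\<in>I. c i)"
      by (simp add: sum_distrib_left)
    finally show ?thesis using True by (simp add: W_def)
  next
    case False
    have "(if c i = 0 then 0 else W m (c(i := c i - 1))) * p i = 0" if "i \<in> I" for i
      using that False S pos[of i] by (auto simp: W_def)
    then have "(\<Sum>i\<in>I. (if c i = 0 then 0 else W m (c(i := c i - 1))) * p i) = 0"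
      by (intro sum.neutral) auto
    then show ?thesis using False by (simp add: W_def)
  qed
qed

lemma borel_measurable_card_PiM:
  fixes B :: "'a set"
  assumes [measurable]: "B \<in> sets M"
  shows "(\<lambda>X. card {j. j < (m::nat) \<and> X j \<in> B}) \<in> measurable (\<Pi>\<^sub>M i\<in>UNIV. M) (count_space UNIV)"
proof -
  have "card {j. j < (m::nat) \<and> X j \<in> B} = (\<Sum>j<m. if X j \<in> B then 1 else 0)" for X
  proof -
    have "{j. j < m \<and> X j \<in> B} = {..<m} \<inter> {j. X j \<in> B}" by auto
    then show ?thesis by (simp add: sum.If_cases)
  qed
  then show ?thesis by simp
qed

context sequence_space begin

lemma multinomial_counts:
  assumes fin: "finite I" and B[measurable]: "\<And>i. i \<in> I \<Longrightarrow> B i \<in> sets M"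
    and disj: "disjoint_family_on B I" and cover: "(\<Union>i\<in>I. B i) = space M"
  shows "measure S {X\<in>space S. \<forall>i\<in>I. card {j. j < m \<and> X j \<in> B i} = c i} =
    (if (\<Sum>i\<in>I. c i) = m then fact m * (\<Prod>i\<in>I. measure M (B i) ^ c i / fact (c i)) else 0)"
proof (induction m arbitrary: c)
  case 0
  have "{X\<in>space S. \<forall>i\<in>I. card {j. j < (0::nat) \<and> X j \<in> B i} = c i} = (if \<forall>i\<in>I. c i = 0 then space S else {})"
    by auto
  then show ?case using fin by (auto simp: P.prob_space)
next
  case (Suc m)
  note borel_measurable_card_PiM[measurable]
  let ?A = "\<lambda>m c. {X\<in>space S. \<forall>i\<in>I. card {j. j < m \<and> X j \<in> B i} = c i}"
  let ?W = "\<lambda>(m::nat) c. (if (\<Sum>i\<in>I. c i) = m then fact m * (\<Prod>i\<in>I. measure M (B i) ^ c i / fact (c i)) else 0)"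
  have sets: "?A m c \<in> sets S" for m c
    by (intro sets.sets_Collect_finite_All fin) (use B in measurable)
  have W: "measure S (?A m c) = ?W m c" for c by (rule Suc.IH)
  have Wnn: "0 \<le> ?W m c" for c by (auto intro!: mult_nonneg_nonneg prod_nonneg)
  have gnn: "0 \<le> (if c i = 0 then 0 else ?W m (c(i := c i - 1)))" for i
  proof (cases "c i = 0")
    case False
    show ?thesis unfolding if_not_P[OF False] by (rule Wnn)
  qed simp
  have "emeasure S (?A (Suc m) c) = emeasure (distr (M \<Otimes>\<^sub>M S) S (\<lambda>(s, \<omega>). case_nat s \<omega>)) (?A (Suc m) c)"
    by (simp only: PiM_iter)
  also have "\<dots> = emeasure (M \<Otimes>\<^sub>M S) ((\<lambda>(s, \<omega>). case_nat s \<omega>) -` ?A (Suc m) c \<inter> space (M \<Otimes>\<^sub>M S))"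
    by (rule emeasure_distr[OF _ sets]) measurable
  also have "\<dots> = (\<integral>\<^sup>+x. emeasure S (Pair x -` ((\<lambda>(s, \<omega>). case_nat s \<omega>) -` ?A (Suc m) c \<inter> space (M \<Otimes>\<^sub>M S))) \<partial>M)"
    by (rule P.emeasure_pair_measure_alt) (rule measurable_sets[OF _ sets], measurable)
  also have "\<dots> = (\<integral>\<^sup>+x. (\<Sum>i\<in>I. ennreal (if c i = 0 then 0 else ?W m (c(i := c i - 1))) * indicator (B i) x) \<partial>M)"
  proof (rule nn_integral_cong)
    fix x assume x: "x \<in> space M"
    then obtain i where i: "i \<in> I" "x \<in> B i" using cover by auto
    have uniq: "x \<notin> B k" if "k \<in> I" "k \<noteq> i" for k
      using disj i that by (auto simp: disjoint_family_on_def)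
    have ind: "indicator (B k) x = (if k = i then 1 else 0::ennreal)" if "k \<in> I" for k
      using uniq i that by (auto simp: indicator_def)
    have eq: "Pair x -` ((\<lambda>(s, \<omega>). case_nat s \<omega>) -` ?A (Suc m) c \<inter> space (M \<Otimes>\<^sub>M S))
        = (if c i = 0 then {} else ?A m (c(i := c i - 1)))" (is "?L = ?R")
    proof -
      have "X \<in> ?L \<longleftrightarrow> X \<in> ?R" for X
      proof -
        have sp: "case_nat x X \<in> space S \<longleftrightarrow> X \<in> space S"
          using x by (auto simp: space_PiM PiE_iff split: nat.splits)
        have "X \<in> ?L \<longleftrightarrow> X \<in> space S \<and> (\<forall>k\<in>I. card {j. j < Suc m \<and> case_nat x X j \<in> B k} = c k)"
          using x sp by (auto simp: space_pair_measure)
        also have "\<dots> \<longleftrightarrow> X \<in> space S \<and> (\<forall>k\<in>I. (if k = i then 1 else 0) + card {j. j < m \<and> X j \<in> B k} = c k)"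
          using uniq i by (intro conj_cong ball_cong refl) (auto simp: card_less_Suc_case_nat)
        also have "\<dots> \<longleftrightarrow> X \<in> ?R"
          using i(1) by auto
        finally show ?thesis .
      qed
      then show ?thesis by blast
    qed
    have "(\<Sum>k\<in>I. ennreal (if c k = 0 then 0 else ?W m (c(k := c k - 1))) * indicator (B k) x) =
       (\<Sum>k\<in>I. if k = i then ennreal (if c k = 0 then 0 else ?W m (c(k := c k - 1))) else 0)"
      by (intro sum.cong refl, subst ind) auto
    also have "\<dots> = ennreal (if c i = 0 then 0 else ?W m (c(i := c i - 1)))"
      using fin i by simp
    also have "\<dots> = emeasure S (if c i = 0 then {} else ?A m (c(i := c i - 1)))"
      by (simp only: W[symmetric] P.emeasure_eq_measure split: if_split) simp
    finally show "emeasure S (Pair x -` ((\<lambda>(s, \<omega>). case_nat s \<omega>) -` ?A (Suc m) c \<inter> space (M \<Otimes>\<^sub>M S))) = (\<Sum>k\<in>I. ennreal (if c k = 0 then 0 else ?W m (c(k := c k - 1))) * indicator (B k) x)"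
      unfolding eq by (rule sym)
  qed
  also have "\<dots> = (\<Sum>i\<in>I. ennreal (if c i = 0 then 0 else ?W m (c(i := c i - 1))) * emeasure M (B i))"
    by (subst nn_integral_sum) (auto intro!: sum.cong nn_integral_cmult_indicator)
  also have "\<dots> = (\<Sum>i\<in>I. ennreal ((if c i = 0 then 0 else ?W m (c(i := c i - 1))) * measure M (B i)))"
    by (intro sum.cong refl, subst M.emeasure_eq_measure, subst ennreal_mult) (simp_all only: gnn measure_nonneg)
  also have "\<dots> = ennreal (\<Sum>i\<in>I. (if c i = 0 then 0 else ?W m (c(i := c i - 1))) * measure M (B i))"
    by (intro sum_ennreal mult_nonneg_nonneg gnn measure_nonneg)
  also have "\<dots> = ennreal (?W (Suc m) c)"
    by (subst multinomial_step[OF fin]) simp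
  finally have "ennreal (measure S (?A (Suc m) c)) = ennreal (?W (Suc m) c)"
    by (simp add: P.emeasure_eq_measure)
  moreover have "0 \<le> ?W (Suc m) c" by (auto intro!: mult_nonneg_nonneg prod_nonneg)
  ultimately show ?case by (subst (asm) ennreal_inj) (auto simp del: fact_Suc)
qed

end

lemma measurable_points_in [measurable]:
  assumes [measurable]: "B \<in> sets \<mu>"
  shows "points_in B \<in> measurable (poisson_process \<mu>) (count_space UNIV)"
proof -
  let ?U = "uniform_measure \<mu> (space \<mu>)"
  have "(\<lambda>(N, X). card {j. j < N \<and> X j \<in> B}) \<in>
    measurable (count_space (UNIV :: nat set) \<Otimes>\<^sub>M (\<Pi>\<^sub>M i\<in>(UNIV :: nat set). ?U)) (count_space UNIV)"
    by (rule measurable_pair_measure_countable1) (simp_all add: borel_measurable_card_PiM)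
  also have "?this \<longleftrightarrow> ?thesis"
    unfolding points_in_def poisson_process_def
    by (intro arg_cong2[where f = "(\<in>)"] measurable_cong_sets sets_pair_measure_cong refl) auto
  finally show ?thesis .
qed

context
  fixes \<mu> :: "'a measure"
  assumes fin_mu: "finite_measure \<mu>" and pos_mu: "measure \<mu> (space \<mu>) > 0"
begin

interpretation U: prob_space "uniform_measure \<mu> (space \<mu>)"
  using fin_mu pos_mu
  by (intro prob_space_uniform_measure) (auto simp: finite_measure.emeasure_eq_measure)

interpretation U: sequence_space "uniform_measure \<mu> (space \<mu>)"
  by unfold_locales

interpretation SN: pair_prob_space "measure_pmf (poisson_pmf (measure \<mu> (space \<mu>)))" "U.S"
  by unfold_locales

lemma prob_space_poisson_process: "prob_space (poisson_process \<mu>)"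
  unfolding poisson_process_def by unfold_locales

lemma poisson_process_counts_partition:
  assumes fin: "finite I" and B: "\<And>i. i \<in> I \<Longrightarrow> B i \<in> sets \<mu>"
    and disj: "disjoint_family_on B I" and cover: "(\<Union>i\<in>I. B i) = space \<mu>"
  shows "measure (poisson_process \<mu>) {\<omega>\<in>space (poisson_process \<mu>). \<forall>i\<in>I. points_in (B i) \<omega> = c i} =
    (\<Prod>i\<in>I. measure \<mu> (B i) ^ c i / fact (c i) * exp (- measure \<mu> (B i)))"
proof -
  interpret mu: finite_measure \<mu> by (rule fin_mu)
  let ?l = "measure \<mu> (space \<mu>)"
  let ?S = "U.S" and ?N = "measure_pmf (poisson_pmf ?l)"
  let ?A = "{\<omega>\<in>space (poisson_process \<mu>). \<forall>i\<in>I. points_in (B i) \<omega> = c i}"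
  let ?m = "\<Sum>i\<in>I. c i"
  let ?w = "fact ?m * (\<Prod>i\<in>I. (measure \<mu> (B i) / ?l) ^ c i / fact (c i))"
  have wnn: "0 \<le> ?w" using pos_mu by (intro mult_nonneg_nonneg prod_nonneg) auto
  have sets: "?A \<in> sets (?N \<Otimes>\<^sub>M ?S)"
    unfolding poisson_process_def[symmetric]
    by (intro sets.sets_Collect_finite_All fin) (use B in measurable)
  have "emeasure (poisson_process \<mu>) ?A = emeasure (?N \<Otimes>\<^sub>M ?S) ?A"
    by (simp add: poisson_process_def)
  also have "\<dots> = (\<integral>\<^sup>+n. emeasure ?S (Pair n -` ?A) \<partial>?N)"
    by (rule U.P.emeasure_pair_measure_alt[OF sets])
  also have "\<dots> = (\<integral>\<^sup>+n. ennreal ?w * indicator {?m} n \<partial>?N)"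
  proof (rule nn_integral_cong)
    fix n
    have eq: "Pair n -` ?A = {X\<in>space ?S. \<forall>i\<in>I. card {j. j < n \<and> X j \<in> B i} = c i}"
      by (auto simp: poisson_process_def space_pair_measure points_in_def)
    have "measure ?S (Pair n -` ?A) = (if ?m = n then fact n * (\<Prod>i\<in>I. measure (uniform_measure \<mu> (space \<mu>)) (B i) ^ c i / fact (c i)) else 0)"
      unfolding eq by (rule U.multinomial_counts) (use fin B disj cover in auto)
    also have "(\<Prod>i\<in>I. measure (uniform_measure \<mu> (space \<mu>)) (B i) ^ c i / fact (c i)) = (\<Prod>i\<in>I. (measure \<mu> (B i) / ?l) ^ c i / fact (c i))"
      using B pos_mu mu.emeasure_finite sets.sets_into_space[OF B]
      by (intro prod.cong refl, subst measure_uniform_measure) (auto simp: mu.emeasure_eq_measure Int_absorb1)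
    finally show "emeasure ?S (Pair n -` ?A) = ennreal ?w * indicator {?m} n"
      by (auto simp: U.P.emeasure_eq_measure)
  qed
  also have "\<dots> = ennreal ?w * ennreal (pmf (poisson_pmf ?l) ?m)"
    by (simp add: nn_integral_cmult_indicator emeasure_pmf_single)
  also have "\<dots> = ennreal (?w * pmf (poisson_pmf ?l) ?m)"
    using wnn by (simp add: ennreal_mult)
  finally have "measure (poisson_process \<mu>) ?A = ?w * pmf (poisson_pmf ?l) ?m"
    using wnn by (simp add: measure_def pos_mu del: pmf_poisson)
  also have "\<dots> = (\<Prod>i\<in>I. measure \<mu> (B i) ^ c i / fact (c i)) * exp (- ?l)"
  proof -
    have "(\<Prod>i\<in>I. (measure \<mu> (B i) / ?l) ^ c i / fact (c i)) = (\<Prod>i\<in>I. measure \<mu> (B i) ^ c i / fact (c i)) / ?l ^ ?m"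
      by (simp add: power_divide prod_dividef prod.distrib power_sum field_simps)
    then show ?thesis using pos_mu by (simp add: field_simps)
  qed
  also have "?l = (\<Sum>i\<in>I. measure \<mu> (B i))"
    unfolding cover[symmetric] using fin B disj by (intro mu.finite_measure_finite_Union) auto
  also have "exp (- (\<Sum>i\<in>I. measure \<mu> (B i))) = (\<Prod>i\<in>I. exp (- measure \<mu> (B i)))"
    using fin by (simp add: exp_sum sum_negf[symmetric])
  finally show ?thesis by (simp only: prod.distrib)
qed

theorem poisson_process_counts:
  assumes fin: "finite I" and B: "\<And>i. i \<in> I \<Longrightarrow> B i \<in> sets \<mu>"
    and disj: "disjoint_family_on B I"
  shows "measure (poisson_process \<mu>) {\<omega>\<in>space (poisson_process \<mu>). \<forall>i\<in>I. points_in (B i) \<omega> = c i} =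
    (\<Prod>i\<in>I. measure \<mu> (B i) ^ c i / fact (c i) * exp (- measure \<mu> (B i)))"
proof -
  interpret PP: prob_space "poisson_process \<mu>" by (rule prob_space_poisson_process)
  define D where "D = space \<mu> - (\<Union>i\<in>I. B i)"
  define B' where "B' = case_option D B"
  let ?J = "insert None (Some ` I)"
  let ?r = "measure \<mu> D"
  let ?Q = "\<Prod>i\<in>I. measure \<mu> (B i) ^ c i / fact (c i) * exp (- measure \<mu> (B i))"
  let ?A = "\<lambda>k. {\<omega>\<in>space (poisson_process \<mu>). \<forall>j\<in>?J. points_in (B' j) \<omega> = case_option k c j}"
  have Bs: "x \<in> space \<mu>" if "i \<in> I" "x \<in> B i" for i x
    using sets.sets_into_space[OF B] that by auto
  have D: "D \<in> sets \<mu>" unfolding D_def using fin B by auto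
  have B': "\<And>j. j \<in> ?J \<Longrightarrow> B' j \<in> sets \<mu>" using D B by (auto simp: B'_def)
  have "measure (poisson_process \<mu>) (?A k) =
     (\<Prod>j\<in>?J. measure \<mu> (B' j) ^ (case_option k c j) / fact (case_option k c j) * exp (- measure \<mu> (B' j)))" for k
    by (rule poisson_process_counts_partition)
       (use fin B' disj Bs in \<open>auto simp: B'_def D_def disjoint_family_on_def\<close>)
  also have "\<dots> k = (?r ^ k / fact k * exp (- ?r)) * ?Q" for k
    using fin by (simp add: B'_def prod.reindex)
  finally have 1: "measure (poisson_process \<mu>) (?A k) = (?r ^ k / fact k * exp (- ?r)) * ?Q" for k .
  have "(\<lambda>k. ?r ^ k / fact k) sums exp ?r"
    using exp_converges[of ?r] by (simp add: field_simps)
  from sums_mult2[OF sums_mult2[OF this, of "exp (- ?r)"], of ?Q]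
  have 2: "(\<lambda>k. measure (poisson_process \<mu>) (?A k)) sums ?Q"
    unfolding 1 by (simp add: exp_minus)
  have 3: "(\<lambda>k. measure (poisson_process \<mu>) (?A k)) sums measure (poisson_process \<mu>) (\<Union>k. ?A k)"
  proof (rule PP.finite_measure_UNION)
    have "?A k \<in> sets (poisson_process \<mu>)" for k
      by (rule sets.sets_Collect_finite_All) (use B' in measurable, use fin in simp)
    then show "range ?A \<subseteq> sets (poisson_process \<mu>)" by blast
    show "disjoint_family ?A"
      by (auto simp: disjoint_family_on_def)
  qed
  have "(\<Union>k. ?A k) = {\<omega>\<in>space (poisson_process \<mu>). \<forall>i\<in>I. points_in (B i) \<omega> = c i}"
    by (auto simp: B'_def)
  then show ?thesis using sums_unique2[OF 3 2] by (simp only:)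
qed

end


section \<open>Hyperbolic random graphs\<close>

text \<open>Points of the hyperbolic plane are given by polar coordinates \<open>(r, \<phi>)\<close>.\<close>

definition hyp_dist :: "real \<times> real \<Rightarrow> real \<times> real \<Rightarrow> real" where
  "hyp_dist = (\<lambda>(r, \<phi>) (r', \<phi>').
     arcosh (cosh r * cosh r' - sinh r * sinh r' * cos (\<phi> - \<phi>')))"

definition hrg_radius :: "real \<Rightarrow> nat \<Rightarrow> real" where
  "hrg_radius C n = 2 * ln (real n) + C"

definition hrg_density :: "real \<Rightarrow> real \<Rightarrow> real \<Rightarrow> real" where
  "hrg_density \<alpha> R r = \<alpha> * sinh (\<alpha> * r) / (2 * pi * (cosh (\<alpha> * R) - 1))"

text \<open>The intensity measure on the disk of radius \<open>R\<close>, in polar coordinates. It is a sensible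
  object only for \<open>R > 0\<close>, that is, for all sufficiently large \<open>n\<close>.\<close>

definition hrg_intensity :: "real \<Rightarrow> real \<Rightarrow> nat \<Rightarrow> (real \<times> real) measure" where
  "hrg_intensity \<alpha> C n = density lborel (\<lambda>(r, \<phi>).
     ennreal (real n * hrg_density \<alpha> (hrg_radius C n) r)
       * indicator ({0..hrg_radius C n} \<times> {0..<2 * pi}) (r, \<phi>))"

text \<open>The vertices are the points of a Poisson point process. They are represented by their
  indices \<open>0, \<dots>, N - 1\<close> in the enumeration of the points, which are almost surely distinct.\<close>

definition geometric_graph :: "real \<Rightarrow> nat \<times> (nat \<Rightarrow> real \<times> real) \<Rightarrow> nat ugraph" where
  "geometric_graph R = (\<lambda>(N, X).
     ({..<N}, {{i, j} | i j. i < N \<and> j < N \<and> i \<noteq> j \<and> hyp_dist (X i) (X j) \<le> R}))"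

text \<open>The probability that \<open>G \<sim> \<G>(n, \<alpha>, C)\<close> has the property \<open>Q\<close>.\<close>

definition hrg_prob :: "real \<Rightarrow> real \<Rightarrow> nat \<Rightarrow> (nat ugraph \<Rightarrow> bool) \<Rightarrow> real" where
  "hrg_prob \<alpha> C n Q =
     measure (poisson_process (hrg_intensity \<alpha> C n))
       {\<omega> \<in> space (poisson_process (hrg_intensity \<alpha> C n)).
          Q (geometric_graph (hrg_radius C n) \<omega>)}"

text \<open>A typical hyperbolic random graph is one that has every property holding a.a.s.; so
  "a typical \<open>G\<close> satisfies \<open>Q\<close>" asserts that \<open>Q\<close> holds a.a.s. for \<open>G \<sim> \<G>(n, \<alpha>, C)\<close>.\<close>

definition typical_hrg :: "real \<Rightarrow> real \<Rightarrow> (nat \<Rightarrow> nat ugraph \<Rightarrow> bool) \<Rightarrow> bool" where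
  "typical_hrg \<alpha> C Q \<longleftrightarrow> (\<lambda>n. hrg_prob \<alpha> C n (Q n)) \<longlonglongrightarrow> 1"

lemma cosh_hyp_dist:
  assumes "0 \<le> r" "0 \<le> r'"
  shows "cosh (hyp_dist (r, \<phi>) (r', \<phi>')) = cosh r * cosh r' - sinh r * sinh r' * cos (\<phi> - \<phi>')"
    and "0 \<le> hyp_dist (r, \<phi>) (r', \<phi>')"
proof -
  have "sinh r * sinh r' * cos (\<phi> - \<phi>') \<le> sinh r * sinh r' * 1"
    using assms by (intro mult_left_mono) auto
  moreover have "cosh r * cosh r' - sinh r * sinh r' = cosh (r - r')"
    by (simp add: cosh_diff)
  moreover have "cosh (r - r') \<ge> 1" by (rule cosh_real_ge_1)
  ultimately have ge: "cosh r * cosh r' - sinh r * sinh r' * cos (\<phi> - \<phi>') \<ge> 1"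
    by simp
  then show "cosh (hyp_dist (r, \<phi>) (r', \<phi>')) = cosh r * cosh r' - sinh r * sinh r' * cos (\<phi> - \<phi>')"
    and "0 \<le> hyp_dist (r, \<phi>) (r', \<phi>')"
    by (simp_all add: hyp_dist_def)
qed

lemma measurable_hyp_dist [measurable (raw)]:
  assumes [measurable]: "f \<in> borel_measurable M" "g \<in> borel_measurable M"
  shows "(\<lambda>x. hyp_dist (f x) (g x)) \<in> borel_measurable M"
proof -
  have [measurable]: "(arcosh :: real \<Rightarrow> real) \<in> borel_measurable borel"
    unfolding arcosh_def by measurable
  have [measurable]: "(cosh :: real \<Rightarrow> real) \<in> borel_measurable borel" "(sinh :: real \<Rightarrow> real) \<in> borel_measurable borel"
    by (intro borel_measurable_continuous_onI continuous_intros)+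
  have [measurable]: "(\<lambda>x. fst (f x)) \<in> borel_measurable M" "(\<lambda>x. fst (g x)) \<in> borel_measurable M"
      "(\<lambda>x. snd (f x)) \<in> borel_measurable M" "(\<lambda>x. snd (g x)) \<in> borel_measurable M"
    by (intro measurable_compose[OF assms(1)] measurable_compose[OF assms(2)] borel_measurable_continuous_onI continuous_intros)+
  show ?thesis
    unfolding hyp_dist_def case_prod_beta by measurable
qed

lemma emeasure_hrg_intensity:
  assumes "\<alpha> > 0" "hrg_radius C n > 0"
  shows "emeasure (hrg_intensity \<alpha> C n) (space (hrg_intensity \<alpha> C n)) = real n"
proof -
  let ?R = "hrg_radius C n"
  let ?D = "cosh (\<alpha> * ?R) - 1"
  have D: "?D > 0"
    using assms cosh_real_strict_mono[of 0 "\<alpha> * ?R"] by simp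
  have [measurable]: "(sinh :: real \<Rightarrow> real) \<in> borel_measurable borel"
    by (intro borel_measurable_continuous_onI continuous_intros)
  have nn: "0 \<le> real n * hrg_density \<alpha> ?R r" if "0 \<le> r" for r
    unfolding hrg_density_def using assms D that by (intro mult_nonneg_nonneg divide_nonneg_nonneg) auto
  let ?f = "\<lambda>r. real n * hrg_density \<alpha> ?R r"
  have [measurable]: "?f \<in> borel_measurable borel"
    unfolding hrg_density_def by measurable
  have "emeasure (hrg_intensity \<alpha> C n) (space (hrg_intensity \<alpha> C n)) =
    (\<integral>\<^sup>+(r, \<phi>). ennreal (?f r) * indicator ({0..?R} \<times> {0..<2 * pi}) (r, \<phi>) \<partial>(lborel \<Otimes>\<^sub>M lborel))"
    unfolding hrg_intensity_def lborel_prod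
    by (subst emeasure_density) (simp_all add: lborel_prod[symmetric] case_prod_beta, (rule nn_integral_cong, simp add: case_prod_beta)?)
  also have "\<dots> = (\<integral>\<^sup>+r. \<integral>\<^sup>+\<phi>. (ennreal (?f r) * indicator {0..?R} r) * indicator {0..<2 * pi} \<phi> \<partial>lborel \<partial>lborel)"
    by (subst lborel.nn_integral_fst[symmetric])
       (auto intro!: nn_integral_cong simp: case_prod_beta split: split_indicator)
  also have "\<dots> = (\<integral>\<^sup>+r. ennreal (2 * pi) * (ennreal (?f r) * indicator {0..?R} r) \<partial>lborel)"
    by (intro nn_integral_cong, subst nn_integral_cmult_indicator) (auto simp: mult.commute)
  also have "\<dots> = ennreal (2 * pi) * (\<integral>\<^sup>+r. ennreal (?f r) * indicator {0..?R} r \<partial>lborel)"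
    by (rule nn_integral_cmult) measurable
  also have "(\<integral>\<^sup>+r. ennreal (?f r) * indicator {0..?R} r \<partial>lborel) =
      ennreal (real n * cosh (\<alpha> * ?R) / (2 * pi * ?D) - real n * cosh (\<alpha> * 0) / (2 * pi * ?D))"
  proof (rule nn_integral_FTC_Icc[where F = "\<lambda>r. real n * cosh (\<alpha> * r) / (2 * pi * ?D)"])
    fix r assume "r \<in> {0..?R}"
    show "((\<lambda>r. real n * cosh (\<alpha> * r) / (2 * pi * ?D)) has_real_derivative ?f r) (at r)"
    proof -
      define K where "K = real n / (2 * pi * ?D)"
      have "((\<lambda>r. K * cosh (\<alpha> * r)) has_real_derivative K * (\<alpha> * sinh (\<alpha> * r))) (at r)"
        by (auto intro!: derivative_eq_intros)
      then show ?thesis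
        by (simp add: K_def hrg_density_def mult_ac)
    qed
  qed (use assms nn in auto)
  also have "real n * cosh (\<alpha> * ?R) / (2 * pi * ?D) - real n * cosh (\<alpha> * 0) / (2 * pi * ?D) = real n / (2 * pi)"
  proof -
    have "real n * cosh (\<alpha> * ?R) / (2 * pi * ?D) - real n * cosh (\<alpha> * 0) / (2 * pi * ?D) = (real n * ?D) / (2 * pi * ?D)"
      by (simp only: diff_divide_distrib[symmetric] right_diff_distrib mult_zero_right cosh_0)
    then show ?thesis using D assms by simp
  qed
  also have "ennreal (2 * pi) * ennreal (real n / (2 * pi)) = real n"
    by (simp add: ennreal_mult[symmetric])
  finally show ?thesis .
qed

lemma sets_poisson_process_geometric_graph:
  assumes "sets \<mu> = sets borel"
  shows "{\<omega> \<in> space (poisson_process \<mu>). Q (geometric_graph R \<omega>)} \<in> sets (poisson_process \<mu>)"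
proof -
  let ?S = "\<Pi>\<^sub>M i\<in>(UNIV :: nat set). uniform_measure \<mu> (space \<mu>)"
  have comp: "(\<lambda>X. X i) \<in> borel_measurable ?S" for i
    using measurable_component_singleton[of i UNIV "\<lambda>_. uniform_measure \<mu> (space \<mu>)"] assms
    by (subst measurable_cong_sets[OF refl, of borel "uniform_measure \<mu> (space \<mu>)"]) auto
  have dist: "{X \<in> space ?S. hyp_dist (X i) (X j) \<le> R} \<in> sets ?S" for i j
    using measurable_hyp_dist[OF comp[of i] comp[of j]] by measurable
  let ?g = "\<lambda>N X. {p \<in> {..<N} \<times> {..<N}. hyp_dist (X (fst p)) (X (snd p)) \<le> R}"
  let ?G = "\<lambda>N P. ({..<N}, {{i, j} | i j. i < N \<and> j < N \<and> i \<noteq> j \<and> (i, j) \<in> P}) :: nat ugraph"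
  have G: "geometric_graph R (N, X) = ?G N (?g N X)" for N X
    by (auto simp: geometric_graph_def)
  have "{X \<in> space ?S. Q (geometric_graph R (N, X))} \<in> sets ?S" for N
  proof -
    have "{X \<in> space ?S. Q (geometric_graph R (N, X))} =
       (\<Union>P\<in>{P \<in> Pow ({..<N} \<times> {..<N}). Q (?G N P)}.
         {X \<in> space ?S. \<forall>p\<in>{..<N} \<times> {..<N}. (hyp_dist (X (fst p)) (X (snd p)) \<le> R) \<longleftrightarrow> p \<in> P})" (is "?L = ?R")
    proof (intro set_eqI iffI)
      fix X assume "X \<in> ?L"
      then show "X \<in> ?R" unfolding G by (intro UN_I[of "?g N X"]) auto
    next
      fix X assume "X \<in> ?R"
      then obtain P where P: "P \<subseteq> {..<N} \<times> {..<N}" "Q (?G N P)" "X \<in> space ?S"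
        "\<forall>p\<in>{..<N} \<times> {..<N}. (hyp_dist (X (fst p)) (X (snd p)) \<le> R) \<longleftrightarrow> p \<in> P"
        by blast
      then have "P = ?g N X" by auto
      then show "X \<in> ?L" using P unfolding G by simp
    qed
    also have "\<dots> \<in> sets ?S"
    proof (intro sets.finite_UN sets.sets_Collect_finite_All)
      fix P and p :: "nat \<times> nat"
      show "{X \<in> space ?S. (hyp_dist (X (fst p)) (X (snd p)) \<le> R) \<longleftrightarrow> p \<in> P} \<in> sets ?S"
        using dist[of "fst p" "snd p"] sets.sets_Collect_neg[OF dist[of "fst p" "snd p"]]
        by (cases "p \<in> P") simp_all
    qed simp_all
    finally show ?thesis .
  qed
  then have "(\<lambda>(N, X). Q (geometric_graph R (N, X))) \<in> measurable (count_space (UNIV :: nat set) \<Otimes>\<^sub>M ?S) (count_space UNIV)"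
    by (intro measurable_pair_measure_countable1) (simp_all add: pred_def)
  then have "{\<omega> \<in> space (count_space UNIV \<Otimes>\<^sub>M ?S). Q (geometric_graph R \<omega>)} \<in> sets (count_space UNIV \<Otimes>\<^sub>M ?S)"
    by (simp add: pred_def case_prod_beta)
  moreover have eq: "sets (poisson_process \<mu>) = sets (count_space UNIV \<Otimes>\<^sub>M ?S)"
    unfolding poisson_process_def by (intro sets_pair_measure_cong) auto
  ultimately show ?thesis
    by (simp only: eq sets_eq_imp_space_eq[OF eq])
qed


section \<open>Random colour trial\<close>

text \<open>A state of the algorithm is a partial colouring.\<close>

definition palette :: "'v ugraph \<Rightarrow> 'c set \<Rightarrow> ('v \<Rightarrow> 'c option) \<Rightarrow> 'v \<Rightarrow> 'c set" where
  "palette G \<Psi> c u = {x \<in> \<Psi>. \<forall>v\<in>neighbours G u. c v \<noteq> Some x}"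

text \<open>A coloured vertex, and an uncoloured one whose palette is empty, has no candidate colour.\<close>

definition candidate :: "'v ugraph \<Rightarrow> 'c set \<Rightarrow> ('v \<Rightarrow> 'c option) \<Rightarrow> 'v \<Rightarrow> 'c option pmf" where
  "candidate G \<Psi> c u =
     (if c u = None \<and> palette G \<Psi> c u \<noteq> {} then map_pmf Some (pmf_of_set (palette G \<Psi> c u))
      else return_pmf None)"

definition adopt ::
  "'v ugraph \<Rightarrow> ('v \<Rightarrow> 'c option) \<Rightarrow> ('v \<Rightarrow> 'c option) \<Rightarrow> 'v \<Rightarrow> 'c option" where
  "adopt G c cand u =
     (if cand u \<noteq> None \<and> (\<forall>v\<in>neighbours G u. cand v \<noteq> cand u) then cand u else c u)"

definition rct_round ::
  "'v ugraph \<Rightarrow> 'c set \<Rightarrow> ('v \<Rightarrow> 'c option) \<Rightarrow> ('v \<Rightarrow> 'c option) pmf" where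
  "rct_round G \<Psi> c = map_pmf (adopt G c) (Pi_pmf (verts G) None (candidate G \<Psi> c))"

text \<open>The distribution of the whole run, that is, of the sequence whose \<open>t\<close>-th entry is the state
  after \<open>t\<close> rounds. It is the Markov chain with transition kernel \<^const>\<open>rct_round\<close> that starts
  in the empty colouring, obtained from the Ionescu-Tulcea theorem.\<close>

definition rct_kernel ::
  "'v ugraph \<Rightarrow> 'c set \<Rightarrow> nat \<Rightarrow> (nat \<Rightarrow> 'v \<Rightarrow> 'c option) \<Rightarrow> ('v \<Rightarrow> 'c option) measure" where
  "rct_kernel G \<Psi> t \<omega> =
     measure_pmf (case t of 0 \<Rightarrow> return_pmf (\<lambda>_. None) | Suc s \<Rightarrow> rct_round G \<Psi> (\<omega> s))"

definition rct_run :: "'v ugraph \<Rightarrow> 'c set \<Rightarrow> (nat \<Rightarrow> 'v \<Rightarrow> 'c option) measure" where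
  "rct_run G \<Psi> =
     projective_family.lim UNIV
       (Ionescu_Tulcea.CI (rct_kernel G \<Psi>) (\<lambda>_. count_space UNIV)) (\<lambda>_. count_space UNIV)"

definition all_coloured :: "'v ugraph \<Rightarrow> ('v \<Rightarrow> 'c option) \<Rightarrow> bool" where
  "all_coloured G c \<longleftrightarrow> (\<forall>v\<in>verts G. c v \<noteq> None)"

definition terminates_after :: "'v ugraph \<Rightarrow> nat \<Rightarrow> (nat \<Rightarrow> 'v \<Rightarrow> 'c option) \<Rightarrow> bool" where
  "terminates_after G t \<omega> \<longleftrightarrow> all_coloured G (\<omega> t) \<and> (\<forall>s<t. \<not> all_coloured G (\<omega> s))"

definition never_terminates :: "'v ugraph \<Rightarrow> (nat \<Rightarrow> 'v \<Rightarrow> 'c option) \<Rightarrow> bool" where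
  "never_terminates G \<omega> \<longleftrightarrow> (\<forall>t. \<not> all_coloured G (\<omega> t))"

definition rct_prob :: "'v ugraph \<Rightarrow> 'c set \<Rightarrow> ((nat \<Rightarrow> 'v \<Rightarrow> 'c option) \<Rightarrow> bool) \<Rightarrow> real" where
  "rct_prob G \<Psi> E = measure (rct_run G \<Psi>) {\<omega> \<in> space (rct_run G \<Psi>). E \<omega>}"

lemma measurable_rct_kernel:
  "rct_kernel G \<Psi> t \<in> measurable (Pi\<^sub>M {0..<t} (\<lambda>_. count_space UNIV)) (subprob_algebra (count_space UNIV))"
proof (cases t)
  case 0
  then show ?thesis by (simp add: rct_kernel_def[abs_def])
next
  case (Suc s)
  have "(\<lambda>\<omega>. \<omega> s) \<in> measurable (Pi\<^sub>M {0..<t} (\<lambda>_. count_space UNIV)) (count_space UNIV)"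
    by (rule measurable_component_singleton) (simp add: Suc)
  from measurable_compose[OF this measurable_measure_pmf[of "rct_round G \<Psi>"]]
  show ?thesis by (simp add: rct_kernel_def[abs_def] Suc)
qed

interpretation rct: Ionescu_Tulcea "rct_kernel G \<Psi>" "\<lambda>_. count_space UNIV"
  for G :: "'v ugraph" and \<Psi> :: "'c set"
  by (rule Ionescu_Tulcea.intro) (rule measurable_rct_kernel, simp add: rct_kernel_def measure_pmf.prob_space_axioms)

lemma fun_upd_eq_restrict_iff:
  assumes "\<omega> \<in> extensional {0..<n}"
  shows "fun_upd \<omega> n x = restrict s {0..<Suc n} \<longleftrightarrow> \<omega> = restrict s {0..<n} \<and> x = s n"
proof
  assume eq: "fun_upd \<omega> n x = restrict s {0..<Suc n}"
  have "\<omega> i = restrict s {0..<n} i" for i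
    using fun_cong[OF eq, of i] assms by (cases "i < n") (auto simp: extensional_def)
  then show "\<omega> = restrict s {0..<n} \<and> x = s n"
    using fun_cong[OF eq, of n] by auto
next
  assume "\<omega> = restrict s {0..<n} \<and> x = s n"
  then show "fun_upd \<omega> n x = restrict s {0..<Suc n}"
    by (auto simp: fun_eq_iff less_Suc_eq)
qed

lemma sets_rct_run: "sets (rct_run G \<Psi>) = sets (\<Pi>\<^sub>M t\<in>UNIV. count_space UNIV)"
  unfolding rct_run_def by (rule rct.PF.sets_lim)

lemma space_rct_run [simp]: "space (rct_run G \<Psi>) = UNIV"
  using sets_eq_imp_space_eq[OF sets_rct_run] by (simp add: space_PiM)

lemma prob_space_rct_run: "prob_space (rct_run G \<Psi>)"
proof
  have "emeasure (rct_run G \<Psi>) (prod_emb UNIV (\<lambda>_. count_space UNIV) {} {\<lambda>_. undefined}) = 1"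
    unfolding rct_run_def
    by (subst rct.lim) (simp_all add: PiM_empty rct.CI_def rct.up_to_def emeasure_distr)
  then show "emeasure (rct_run G \<Psi>) (space (rct_run G \<Psi>)) = 1"
    by (simp add: prod_emb_def restrict_def vimage_def)
qed

lemma PiE_singleton_restrict: "(\<Pi>\<^sub>E i\<in>A. {s i}) = {restrict s A}"
  using PiE_singleton[of "restrict s A" A] by (simp cong: PiE_cong)

lemma restrict_eq_restrict_iff: "restrict f A = restrict g A \<longleftrightarrow> (\<forall>x\<in>A. f x = g x)"
  by (metis restrict_apply' restrict_ext)

lemma emeasure_C_singleton:
  fixes s :: "nat \<Rightarrow> 'v \<Rightarrow> 'c option"
  shows "emeasure (rct.C G \<Psi> 0 n (\<lambda>_. undefined)) {restrict s {0..<n}} =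
    ennreal (\<Prod>t<n. case t of 0 \<Rightarrow> indicator {\<lambda>_. None} (s 0) | Suc t' \<Rightarrow> pmf (rct_round G \<Psi> (s t')) (s t))"
proof (induction n)
  case 0
  show ?case by (simp add: PiM_empty)
next
  case (Suc n)
  let ?M = "\<lambda>n. Pi\<^sub>M {0..<n} (\<lambda>_. count_space (UNIV :: ('v \<Rightarrow> 'c option) set))"
  let ?C = "rct.C G \<Psi> 0 n (\<lambda>_. undefined)"
  let ?p = "\<lambda>t. case t of 0 \<Rightarrow> indicator {\<lambda>_. None} (s 0) | Suc t' \<Rightarrow> pmf (rct_round G \<Psi> (s t')) (s t)"
  have und: "(\<lambda>_. undefined) \<in> space (?M 0)" by (simp add: space_PiM PiE_def extensional_def)
  have spC: "space ?C = space (?M n)" using rct.space_C[OF und, where m = n] by simp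
  have sing: "{restrict s {0..<n}} \<in> sets (?M n)" for n
  proof -
    have "(\<Pi>\<^sub>E i\<in>{0..<n}. {s i}) \<in> sets (?M n)" by (intro sets_PiM_I_finite) auto
    also have "(\<Pi>\<^sub>E i\<in>{0..<n}. {s i}) = {restrict s {0..<n}}" by (rule PiE_singleton_restrict)
    finally show ?thesis .
  qed
  have mC: "rct.eP G \<Psi> n \<in> measurable ?C (subprob_algebra (?M (Suc n)))"
    using rct.measurable_eP[where n = n] rct.sets_C[OF und, where m = n] by (subst measurable_cong_sets[OF _ refl, of _ "?M n"]) auto
  have "emeasure (rct.C G \<Psi> 0 (Suc n) (\<lambda>_. undefined)) {restrict s {0..<Suc n}} =
     (\<integral>\<^sup>+\<omega>. emeasure (rct.eP G \<Psi> n \<omega>) {restrict s {0..<Suc n}} \<partial>?C)"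
    using spC rct.non_empty by (simp, intro emeasure_bind[OF _ mC sing]) (auto simp: space_PiM)
  also have "\<dots> = (\<integral>\<^sup>+\<omega>. ennreal (?p n) * indicator {restrict s {0..<n}} \<omega> \<partial>?C)"
  proof (rule nn_integral_cong)
    fix \<omega> assume "\<omega> \<in> space ?C"
    then have \<omega>: "\<omega> \<in> space (?M n)" using spC by simp
    have "emeasure (rct.eP G \<Psi> n \<omega>) {restrict s {0..<Suc n}} = emeasure (rct_kernel G \<Psi> n \<omega>) {x. fun_upd \<omega> n x = restrict s {0..<Suc n}}"
      using rct.emeasure_eP[OF \<omega> sing] by (simp add: vimage_def)
    also have "{x. fun_upd \<omega> n x = restrict s {0..<Suc n}} = (if \<omega> = restrict s {0..<n} then {s n} else {})"
      using fun_upd_eq_restrict_iff[of \<omega> n _ s] \<omega> by (auto simp: space_PiM PiE_def)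
    also have "emeasure (rct_kernel G \<Psi> n \<omega>) \<dots> = ennreal (?p n) * indicator {restrict s {0..<n}} \<omega>"
      by (auto simp: rct_kernel_def emeasure_pmf_single indicator_def split: nat.split)
    finally show "emeasure (rct.eP G \<Psi> n \<omega>) {restrict s {0..<Suc n}} = ennreal (?p n) * indicator {restrict s {0..<n}} \<omega>" .
  qed
  also have "\<dots> = ennreal (?p n) * emeasure ?C {restrict s {0..<n}}"
    using sing[of n] rct.sets_C[OF und, where m = n] by (intro nn_integral_cmult_indicator) auto
  also have "\<dots> = ennreal (\<Prod>t<Suc n. ?p t)"
    unfolding Suc.IH by (subst ennreal_mult[symmetric]) (auto intro!: prod_nonneg split: nat.split simp: mult.commute)
  finally show ?case .
qed

theorem rct_run_cylinder:
  fixes s :: "nat \<Rightarrow> 'v \<Rightarrow> 'c option"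
  shows "rct_prob G \<Psi> (\<lambda>\<omega>. \<forall>t\<le>n. \<omega> t = s t) =
     (if s 0 = (\<lambda>_. None) then \<Prod>t<n. pmf (rct_round G \<Psi> (s t)) (s (Suc t)) else 0)"
proof -
  let ?M = "\<lambda>_::nat. count_space (UNIV :: ('v \<Rightarrow> 'c option) set)"
  let ?n = "Suc n"
  let ?X = "{restrict s {0..<?n}}"
  have sing: "?X \<in> sets (Pi\<^sub>M {0..<?n} ?M)"
  proof -
    have "(\<Pi>\<^sub>E i\<in>{0..<?n}. {s i}) \<in> sets (Pi\<^sub>M {0..<?n} ?M)" by (intro sets_PiM_I_finite) auto
    also have "(\<Pi>\<^sub>E i\<in>{0..<?n}. {s i}) = ?X" by (rule PiE_singleton_restrict)
    finally show ?thesis .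
  qed
  have "(\<forall>t\<le>n. \<omega> t = s t) \<longleftrightarrow> restrict \<omega> {0..<?n} = restrict s {0..<?n}" for \<omega>
    by (auto simp: restrict_eq_restrict_iff less_Suc_eq_le)
  then have "{\<omega>. \<forall>t\<le>n. \<omega> t = s t} = prod_emb UNIV ?M {0..<?n} ?X"
    unfolding prod_emb_def by (auto simp: space_PiM)
  then have "emeasure (rct_run G \<Psi>) {\<omega>. \<forall>t\<le>n. \<omega> t = s t} = emeasure (rct.CI G \<Psi> {0..<?n}) ?X"
    unfolding rct_run_def by (simp only: rct.lim[OF finite_atLeastLessThan sing])
  also have "\<dots> = emeasure (rct.C G \<Psi> 0 ?n (\<lambda>_. undefined)) (prod_emb {0..<?n} ?M {0..<?n} ?X)"
    by (rule rct.emeasure_CI[OF order_refl sing])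
  also have "prod_emb {0..<?n} ?M {0..<?n} ?X = ?X"
    by (rule prod_emb_id) (auto simp: space_PiM)
  also have "emeasure (rct.C G \<Psi> 0 ?n (\<lambda>_. undefined)) ?X = ennreal (\<Prod>t<?n. case t of 0 \<Rightarrow> indicator {\<lambda>_. None} (s 0) | Suc t' \<Rightarrow> pmf (rct_round G \<Psi> (s t')) (s t))"
    by (rule emeasure_C_singleton)
  also have "(\<Prod>t<?n. case t of 0 \<Rightarrow> indicator {\<lambda>_. None} (s 0) | Suc t' \<Rightarrow> pmf (rct_round G \<Psi> (s t')) (s t)) =
    (if s 0 = (\<lambda>_. None) then \<Prod>t<n. pmf (rct_round G \<Psi> (s t)) (s (Suc t)) else 0)"
    by (subst prod.lessThan_Suc_shift) simp
  finally have *: "emeasure (rct_run G \<Psi>) {\<omega>. \<forall>t\<le>n. \<omega> t = s t} = ennreal (if s 0 = (\<lambda>_. None) then \<Prod>t<n. pmf (rct_round G \<Psi> (s t)) (s (Suc t)) else 0)" .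
  have "0 \<le> (if s 0 = (\<lambda>_. None) then \<Prod>t<n. pmf (rct_round G \<Psi> (s t)) (s (Suc t)) else 0)"
    by (auto intro!: prod_nonneg)
  then show ?thesis
    unfolding rct_prob_def measure_def by (simp only: space_rct_run UNIV_I simp_thms * enn2real_ennreal)
qed

lemma sets_rct_run_component [measurable]: "{\<omega>. P (\<omega> t)} \<in> sets (rct_run G \<Psi>)"
proof -
  have "(\<lambda>\<omega>. \<omega> t) \<in> measurable (rct_run G \<Psi>) (count_space UNIV)"
    by (subst measurable_cong_sets[OF sets_rct_run refl]) (rule measurable_component_singleton, simp)
  from measurable_sets[OF this, of "Collect P"] show ?thesis
    by (simp add: vimage_def)
qed

lemma sets_rct_run_never_terminates: "{\<omega>. never_terminates G \<omega>} \<in> sets (rct_run G \<Psi>)"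
proof -
  have "{\<omega>. never_terminates G \<omega>} = (\<Inter>t. {\<omega>. \<not> all_coloured G (\<omega> t)})"
    by (auto simp: never_terminates_def)
  also have "\<dots> \<in> sets (rct_run G \<Psi>)"
    by (intro sets.countable_INT) (auto intro: sets_rct_run_component[of "\<lambda>c. \<not> all_coloured G c"])
  finally show ?thesis .
qed

lemma sets_rct_run_terminates_after: "{\<omega>. terminates_after G t \<omega>} \<in> sets (rct_run G \<Psi>)"
proof -
  have "{\<omega>. terminates_after G t \<omega>} =
      {\<omega>. all_coloured G (\<omega> t)} - (\<Union>s\<in>{..<t}. {\<omega>. all_coloured G (\<omega> s)})"
    by (auto simp: terminates_after_def)
  also have "\<dots> \<in> sets (rct_run G \<Psi>)"
    by (intro sets.Diff sets.finite_UN) (auto intro: sets_rct_run_component[of "all_coloured G"])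
  finally show ?thesis .
qed

end

theory Submission
  imports Defs "HOL-Real_Asymp.Real_Asymp"
begin

text \<open>Part 1. In round one a vertex of degree \<open>d\<close> fails with probability at most \<open>d / k\<close>, where
  \<open>k\<close> is the number of colours. A conflict in round two requires two adjacent vertices that both
  fail in round one and then agree in round two; it is charged to the one farther from the origin,
  which has only \<open>n powr (1 - \<alpha> + o(1))\<close> neighbours closer to the origin. Since \<open>k\<close> is of order
  \<open>n powr (1 / (2 * \<alpha>))\<close>, the expected number of conflicts vanishes, provided that palettes remain
  large. For vertices of high degree this follows from the variance of the number of colours that
  their neighbours avoid. Round one itself almost surely leaves a conflict, because most of the
  points not too close to the boundary can be paired with an adjacent representative of their angular
  sector.

  Part 2. The points at distance at most \<open>R / 2\<close> from the origin form a clique \<open>K\<close>, whose order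
  agrees with the chromatic number up to a small power of \<open>n\<close>. In round one, each colour that is
  tried neither by \<open>K\<close> nor by a few exceptional vertices is permanently adopted next to every vertex
  of \<open>K\<close>. By the birthday paradox the colours tried by \<open>K\<close> contain many repetitions, so that fewer
  than \<open>card K\<close> colours remain for \<open>K\<close>.\<close>

subsection \<open>Products of discrete distributions\<close>

text \<open>Both parts come down to comparing exponents of \<open>n\<close>. In part 1 the expected
  number of second-round conflicts is of order (edges) times (inner degree) over the square of the
  number of colours, so \<open>1 + (1 - \<alpha>)\<close> competes with \<open>1 / \<alpha>\<close>.
  The gap \<open>(1 - \<alpha>)\<^sup>2 / \<alpha>\<close> is positive but can be arbitrarily small,
  hence every loss is kept to a factor \<open>n powr \<eta>\<close> with tiny \<eta>. The maximum
  degree is known only up to powers of \<open>n\<close>, which is harmless for the palettes: their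
  bound depends on \<Delta> only through its quotient by the number of colours, and that quotient is
  fixed by \<epsilon>. In part 2 a clique of about \<open>n powr (1 - \<alpha>)\<close> vertices
  draws from about \<open>n powr (1 - \<alpha> + \<delta>)\<close> colours, so about
  \<open>n powr (1 - \<alpha> - \<delta>)\<close> draws are repetitions. These must outnumber the
  exceptional vertices, whose colours are given away for free. Dependence between the positions is
  avoided throughout: the degree and colouring bounds are deterministic consequences of counts in
  polynomially many boxes, and each count deviates by a factor \<open>n powr \<eta>\<close> with
  probability below every power of \<open>n\<close>.\<close>

lemma measure_bind_pmf_eq:
  "measure_pmf.prob (bind_pmf p q) E = measure_pmf.expectation p (\<lambda>x. measure_pmf.prob (q x) E)"
proof -
  have "ennreal (measure_pmf.prob (bind_pmf p q) E) = (\<integral>\<^sup>+x. ennreal (measure_pmf.prob (q x) E) \<partial>p)"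
    by (simp add: measure_pmf.emeasure_eq_measure[symmetric])
  also have "\<dots> = ennreal (measure_pmf.expectation p (\<lambda>x. measure_pmf.prob (q x) E))"
    by (intro nn_integral_eq_integral measure_pmf.integrable_const_bound[where B = 1]) auto
  finally show ?thesis
    by (simp add: integral_nonneg_AE)
qed

lemma expectation_pmf_le_const:
  fixes f :: "'a \<Rightarrow> real"
  assumes "\<And>x. x \<in> set_pmf p \<Longrightarrow> f x \<le> b" "\<And>x. 0 \<le> f x"
  shows "measure_pmf.expectation p f \<le> b"
proof -
  have "integrable (measure_pmf p) f"
    by (rule measure_pmf.integrable_const_bound[where B = b])
       (use assms in \<open>auto simp: AE_measure_pmf_iff\<close>)
  then show ?thesis
    by (intro measure_pmf.integral_le_const) (use assms in \<open>auto simp: AE_measure_pmf_iff\<close>)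
qed

text \<open>Conditioning for product distributions: the coordinates outside \<open>A\<close> are
  revealed first and stay fixed while the block \<open>A\<close> is sampled. The later first-round
  estimates differ mainly in the choice of \<open>A\<close>.\<close>

lemma prob_Pi_pmf_split:
  assumes "finite V" "A \<subseteq> V"
  shows "measure_pmf.prob (Pi_pmf V d p) E =
    measure_pmf.expectation (Pi_pmf (V - A) d p)
      (\<lambda>g. measure_pmf.prob (Pi_pmf A d p) {f. (\<lambda>x. if x \<in> A then f x else g x) \<in> E})"
proof -
  have fin: "finite A" "finite (V - A)" using assms by (auto intro: finite_subset)
  have "Pi_pmf V d p = Pi_pmf (A \<union> (V - A)) d p" using assms by (simp add: Un_absorb1)
  also have "\<dots> = map_pmf (\<lambda>(f,g) x. if x \<in> A then f x else g x)
             (pair_pmf (Pi_pmf A d p) (Pi_pmf (V - A) d p))"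
    by (rule Pi_pmf_union) (use fin in auto)
  also have "\<dots> = bind_pmf (Pi_pmf (V - A) d p)
      (\<lambda>g. map_pmf (\<lambda>f x. if x \<in> A then f x else g x) (Pi_pmf A d p))"
    by (subst pair_commute_pmf) (simp add: pair_pmf_def map_pmf_def bind_assoc_pmf bind_return_pmf)
  finally show ?thesis by (simp add: measure_bind_pmf_eq vimage_def)
qed

text \<open>Once all coordinates except \<open>v\<close> are revealed, \<open>f v\<close> has to hit
  the single value \<open>f u\<close>. The default \<open>d\<close> is excluded because two vertices
  without a candidate are not in conflict.\<close>

lemma prob_Pi_pmf_eq_le:
  assumes "finite V" "u \<in> V" "v \<in> V" "u \<noteq> v" "\<And>y. y \<noteq> d \<Longrightarrow> pmf (p v) y \<le> b" "0 \<le> b"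
  shows "measure_pmf.prob (Pi_pmf V d p) {f. f u = f v \<and> f v \<noteq> d} \<le> b"
proof -
  have "measure_pmf.prob (Pi_pmf {v} d p)
      {f. (\<lambda>x. if x \<in> {v} then f x else g x) \<in> {f. f u = f v \<and> f v \<noteq> d}} \<le> b" for g
  proof -
    have eq: "(\<lambda>a b. if b = v then a else d) -` {f. (\<lambda>x. if x \<in> {v} then f x else g x) \<in> {f. f u = f v \<and> f v \<noteq> d}}
       = (if g u = d then {} else {g u})"
      using assms(4) by auto
    then show ?thesis
      using assms(5)[of "g u"] assms(6)
      by (simp only: Pi_pmf_singleton measure_map_pmf eq) (auto simp: measure_pmf_single)
  qed
  then show ?thesis
    using assms(1,3)
    by (subst prob_Pi_pmf_split[where A = "{v}"]) (simp, simp, rule expectation_pmf_le_const, simp_all only: measure_nonneg)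
qed

subsection \<open>Finitely many rounds\<close>

text \<open>A discrete stand-in for the first \<open>n\<close> rounds of \<open>rct_run\<close>, so
  that finite horizons can be handled with \<open>pmf\<close> calculus. Entries beyond
  \<open>n\<close> keep the dummy value \<open>\<lambda>_. None\<close>; thus a path is determined
  by its first \<open>n + 1\<close> entries.\<close>

primrec rct_path :: "'v ugraph \<Rightarrow> 'c set \<Rightarrow> nat \<Rightarrow> (nat \<Rightarrow> 'v \<Rightarrow> 'c option) pmf" where
  "rct_path G \<Psi> 0 = return_pmf (\<lambda>_ _. None)"
| "rct_path G \<Psi> (Suc n) =
     bind_pmf (rct_path G \<Psi> n) (\<lambda>s. map_pmf (\<lambda>x. s(Suc n := x)) (rct_round G \<Psi> (s n)))"

text \<open>The weights have the same product form as the cylinder probabilities in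
  \<open>rct_run_cylinder\<close>, which is what links the discrete paths to the Ionescu-Tulcea
  measure.\<close>

lemma pmf_rct_path:
  "pmf (rct_path G \<Psi> n) s =
    (if s 0 = (\<lambda>_. None) \<and> (\<forall>t>n. s t = (\<lambda>_. None))
     then \<Prod>t<n. pmf (rct_round G \<Psi> (s t)) (s (Suc t)) else 0)"
proof (induction n arbitrary: s)
  case 0
  have "s = (\<lambda>_ _. None) \<longleftrightarrow> s 0 = (\<lambda>_. None) \<and> (\<forall>t>0. s t = (\<lambda>_. None))"
    by (metis (mono_tags) ext gr0I)
  then show ?case by (auto simp: indicator_def)
next
  case (Suc n)
  \<comment> \<open>The only path of length \<open>n\<close> that can be extended to
    \<open>s\<close>: its last entry is reset to the dummy value.\<close>
  let ?s = "s(Suc n := (\<lambda>_. None))"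
  have inj: "inj (\<lambda>x. s'(Suc n := x))" for s' :: "nat \<Rightarrow> 'a \<Rightarrow> 'b option"
    by (rule injI) (metis fun_upd_same)
  have supp: "s' (Suc n) = (\<lambda>_. None)" if "s' \<in> set_pmf (rct_path G \<Psi> n)" for s'
    using that by (auto simp: set_pmf_iff Suc.IH split: if_splits)
  have step: "pmf (map_pmf (\<lambda>x. s'(Suc n := x)) (rct_round G \<Psi> (s' n))) s =
      (if s' = ?s then pmf (rct_round G \<Psi> (s n)) (s (Suc n)) else 0)"
    if "s' \<in> set_pmf (rct_path G \<Psi> n)" for s'
  proof (cases "s' = ?s")
    case True
    then have "s = s'(Suc n := s (Suc n))" by simp
    then have "pmf (map_pmf (\<lambda>x. s'(Suc n := x)) (rct_round G \<Psi> (s' n))) s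
        = pmf (rct_round G \<Psi> (s' n)) (s (Suc n))"
      by (metis pmf_map_inj'[OF inj])
    moreover have "s' n = s n" using True by simp
    ultimately show ?thesis using True by simp
  next
    case False
    have "s \<notin> range (\<lambda>x. s'(Suc n := x))"
    proof
      assume "s \<in> range (\<lambda>x. s'(Suc n := x))"
      then obtain x where "s = s'(Suc n := x)" by blast
      then have "?s = s'" using supp[OF that] by (simp add: fun_upd_idem)
      then show False using False by simp
    qed
    then have "pmf (map_pmf (\<lambda>x. s'(Suc n := x)) (rct_round G \<Psi> (s' n))) s = 0"
      by (auto simp: pmf_eq_0_set_pmf)
    then show ?thesis using False by simp
  qed
  have "pmf (rct_path G \<Psi> (Suc n)) s =
      measure_pmf.expectation (rct_path G \<Psi> n)
        (\<lambda>s'. if s' = ?s then pmf (rct_round G \<Psi> (s n)) (s (Suc n)) else 0)"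
    unfolding rct_path.simps pmf_bind by (intro integral_cong_AE) (auto simp: AE_measure_pmf_iff step)
  also have "\<dots> = pmf (rct_path G \<Psi> n) ?s * pmf (rct_round G \<Psi> (s n)) (s (Suc n))"
    by (subst integral_measure_pmf[of "{?s}"]) (auto split: if_splits)
  also have "\<dots> = (if s 0 = (\<lambda>_. None) \<and> (\<forall>t>Suc n. s t = (\<lambda>_. None))
     then \<Prod>t<Suc n. pmf (rct_round G \<Psi> (s t)) (s (Suc t)) else 0)"
  proof -
    have "(\<forall>t>n. ?s t = (\<lambda>_. None)) \<longleftrightarrow> (\<forall>t>Suc n. s t = (\<lambda>_. None))"
      by auto
    moreover have "(\<Prod>t<n. pmf (rct_round G \<Psi> (?s t)) (?s (Suc t))) =
        (\<Prod>t<n. pmf (rct_round G \<Psi> (s t)) (s (Suc t)))"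
      by (intro prod.cong) auto
    ultimately show ?thesis by (auto simp: Suc.IH)
  qed
  finally show ?case .
qed

lemma finite_set_pmf_rct_path:
  assumes "finite (verts G)" "finite \<Psi>"
  shows "finite (set_pmf (rct_path G \<Psi> n))"
proof -
  have "finite (set_pmf (candidate G \<Psi> c u))" for c u
    using assms by (auto simp: candidate_def palette_def set_pmf_of_set)
  then have "finite (set_pmf (rct_round G \<Psi> c))" for c
    using assms by (auto simp: rct_round_def set_Pi_pmf intro!: finite_PiE_dflt)
  then show ?thesis by (induction n) auto
qed

text \<open>The support of \<open>rct_path\<close> is finite, so the event meets it in finitely many
  paths. Their cylinders are disjoint because the dummy tails agree, both measures give them the
  same weight, and by \<open>loc\<close> they lie inside the event.\<close>

lemma prob_rct_path_le_rct_prob: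
  fixes G :: "'v ugraph" and \<Psi> :: "'c set"
  assumes fin: "finite (verts G)" "finite \<Psi>"
    and meas: "{\<omega>. E \<omega>} \<in> sets (rct_run G \<Psi>)"
    and loc: "\<And>\<omega> \<omega>'. (\<And>t. t \<le> n \<Longrightarrow> \<omega> t = \<omega>' t) \<Longrightarrow> E \<omega> \<Longrightarrow> E \<omega>'"
  shows "measure_pmf.prob (rct_path G \<Psi> n) {\<omega>. E \<omega>} \<le> rct_prob G \<Psi> E"
proof -
  interpret prob_space "rct_run G \<Psi>" by (rule prob_space_rct_run)
  define F where "F = set_pmf (rct_path G \<Psi> n) \<inter> {\<omega>. E \<omega>}"
  let ?cyl = "\<lambda>s. {\<omega>. \<forall>t\<le>n. \<omega> t = s t}"
  have F: "finite F" unfolding F_def using finite_set_pmf_rct_path[OF fin] by blast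
  have cyl: "?cyl s \<in> sets (rct_run G \<Psi>)" for s :: "nat \<Rightarrow> 'v \<Rightarrow> 'c option"
  proof -
    have "?cyl s = (\<Inter>t\<in>{..n}. {\<omega>. \<omega> t = s t})" by auto
    also have "\<dots> \<in> sets (rct_run G \<Psi>)"
      using sets_rct_run_component[of "\<lambda>x. x = s t" for t] by (intro sets.finite_INT) auto
    finally show ?thesis .
  qed
  have supp: "s 0 = (\<lambda>_. None)" "\<forall>t>n. s t = (\<lambda>_. None)" if "s \<in> F" for s
    using that by (auto simp: F_def set_pmf_iff pmf_rct_path split: if_splits)
  have disj: "disjoint_family_on ?cyl F"
  proof -
    have "s = s'" if "s \<in> F" "s' \<in> F" "\<And>t. t \<le> n \<Longrightarrow> s t = s' t" for s s'
      using supp[OF that(1)] supp[OF that(2)] that(3) by (metis ext not_le)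
    then show ?thesis unfolding disjoint_family_on_def by fastforce
  qed
  have "measure_pmf.prob (rct_path G \<Psi> n) {\<omega>. E \<omega>} = measure_pmf.prob (rct_path G \<Psi> n) F"
    unfolding F_def by (simp add: measure_Int_set_pmf Int_commute)
  also have "\<dots> = (\<Sum>s\<in>F. pmf (rct_path G \<Psi> n) s)"
    using F by (rule measure_measure_pmf_finite)
  also have "\<dots> = (\<Sum>s\<in>F. measure (rct_run G \<Psi>) (?cyl s))"
  proof (rule sum.cong)
    fix s assume "s \<in> F"
    then show "pmf (rct_path G \<Psi> n) s = measure (rct_run G \<Psi>) (?cyl s)"
      using supp[of s] rct_run_cylinder[of G \<Psi> n s] by (simp add: pmf_rct_path rct_prob_def)
  qed simp
  also have "\<dots> = measure (rct_run G \<Psi>) (\<Union>s\<in>F. ?cyl s)"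
    using F cyl disj by (intro finite_measure_finite_Union[symmetric]) auto
  also have "\<dots> \<le> rct_prob G \<Psi> E"
    unfolding rct_prob_def
    using meas by (intro finite_measure_mono) (auto simp: F_def intro: loc)
  finally show ?thesis .
qed

lemma map_rct_path_last:
  "map_pmf (\<lambda>s. s (Suc n)) (rct_path G \<Psi> (Suc n)) =
    bind_pmf (map_pmf (\<lambda>s. s n) (rct_path G \<Psi> n)) (rct_round G \<Psi>)"
  by (simp add: map_bind_pmf bind_map_pmf pmf.map_comp o_def)

lemma map_rct_path_1: "map_pmf (\<lambda>s. s 1) (rct_path G \<Psi> 1) = rct_round G \<Psi> (\<lambda>_. None)"
  using map_rct_path_last[of 0 G \<Psi>] by (simp add: bind_return_pmf)

lemma map_rct_path_prefix:
  "map_pmf (\<lambda>s. s n) (rct_path G \<Psi> (Suc n)) = map_pmf (\<lambda>s. s n) (rct_path G \<Psi> n)"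
  by (simp add: map_bind_pmf pmf.map_comp o_def map_pmf_def[symmetric])

text \<open>Termination after exactly two rounds fails only if round one already colours everything
  or round two leaves a gap. A nonempty vertex set rules out termination at time 0.\<close>

lemma rct_prob_terminates_after_2_ge:
  assumes fin: "finite (verts G)" "finite \<Psi>" and ne: "verts G \<noteq> {}"
  shows "rct_prob G \<Psi> (terminates_after G 2) \<ge>
    1 - measure_pmf.prob (rct_round G \<Psi> (\<lambda>_. None)) {x. all_coloured G x}
      - measure_pmf.prob (bind_pmf (rct_round G \<Psi> (\<lambda>_. None)) (rct_round G \<Psi>)) {x. \<not> all_coloured G x}"
proof -
  let ?P = "rct_path G \<Psi> 2"
  let ?A = "{s :: nat \<Rightarrow> 'a \<Rightarrow> 'b option. all_coloured G (s 1)}"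
  let ?B = "{s :: nat \<Rightarrow> 'a \<Rightarrow> 'b option. \<not> all_coloured G (s 2)}"
  have two: "(2::nat) = Suc 1" by simp
  have 1: "measure_pmf.prob ?P ?A = measure_pmf.prob (rct_round G \<Psi> (\<lambda>_. None)) {x. all_coloured G x}"
    unfolding two map_rct_path_1[symmetric] map_rct_path_prefix[of 1, symmetric]
    by (simp only: measure_map_pmf vimage_Collect_eq)
  have 2: "measure_pmf.prob ?P ?B =
      measure_pmf.prob (bind_pmf (rct_round G \<Psi> (\<lambda>_. None)) (rct_round G \<Psi>)) {x. \<not> all_coloured G x}"
    unfolding two map_rct_path_1[symmetric] map_rct_path_last[of 1, symmetric]
    by (simp only: measure_map_pmf vimage_Collect_eq)
  have start: "s 0 = (\<lambda>_. None)" if "s \<in> set_pmf ?P" for s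
    using that by (auto simp: set_pmf_iff pmf_rct_path split: if_splits)
  have "1 = measure_pmf.prob ?P UNIV" by simp
  also have "\<dots> \<le> measure_pmf.prob ?P ({s. terminates_after G 2 s} \<union> (?A \<union> ?B))"
  proof (rule measure_pmf.finite_measure_mono_AE)
    show "AE s in ?P. s \<in> UNIV \<longrightarrow> s \<in> {s. terminates_after G 2 s} \<union> (?A \<union> ?B)"
      using ne by (auto simp: AE_measure_pmf_iff terminates_after_def all_coloured_def less_2_cases_iff dest!: start)
  qed auto
  also have "\<dots> \<le> measure_pmf.prob ?P {s. terminates_after G 2 s} + (measure_pmf.prob ?P ?A + measure_pmf.prob ?P ?B)"
    by (intro order.trans[OF measure_Un_le] add_left_mono measure_Un_le) auto
  also have "measure_pmf.prob ?P {s. terminates_after G 2 s} \<le> rct_prob G \<Psi> (terminates_after G 2)"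
    by (rule prob_rct_path_le_rct_prob[OF fin sets_rct_run_terminates_after]) (auto simp: terminates_after_def)
  finally show ?thesis using 1 2 by simp
qed

text \<open>\<open>I\<close> is an absorbing set of incomplete states. Whatever probability enters
  it in round one stays there for ever, so a single round decides about the infinite run.\<close>

lemma rct_prob_never_terminates_ge:
  assumes fin: "finite (verts G)" "finite \<Psi>" and ne: "verts G \<noteq> {}"
    and closed: "\<And>x y. I x \<Longrightarrow> y \<in> set_pmf (rct_round G \<Psi> x) \<Longrightarrow> I y"
    and stuck: "\<And>x. I x \<Longrightarrow> \<not> all_coloured G x"
  shows "rct_prob G \<Psi> (never_terminates G) \<ge> measure_pmf.prob (rct_round G \<Psi> (\<lambda>_. None)) {x. I x}"
proof -
  interpret R: prob_space "rct_run G \<Psi>" by (rule prob_space_rct_run)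
  let ?p = "measure_pmf.prob (rct_round G \<Psi> (\<lambda>_. None)) {x. I x}"
  define E where "E n = (\<lambda>\<omega>. \<forall>t\<le>n. \<not> all_coloured G (\<omega> t :: 'a \<Rightarrow> 'b option))" for n :: nat
  have path: "?p \<le> measure_pmf.prob (rct_path G \<Psi> (Suc n)) {s. \<forall>t\<in>{1..Suc n}. I (s t)}" for n
  proof (induction n)
    case 0
    have "?p = measure_pmf.prob (rct_path G \<Psi> 1) {s. I (s 1)}"
      unfolding map_rct_path_1[symmetric] by simp
    then show ?case by simp
  next
    case (Suc n)
    let ?J = "\<lambda>n. {s. \<forall>t\<in>{1..Suc n}. I (s t)}"
    have "measure_pmf.prob (rct_path G \<Psi> (Suc n)) (?J n) =
        measure_pmf.expectation (rct_path G \<Psi> (Suc n)) (indicator (?J n))"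
      by simp
    also have "\<dots> \<le> measure_pmf.expectation (rct_path G \<Psi> (Suc n))
        (\<lambda>s. measure_pmf.prob (map_pmf (\<lambda>x. s(Suc (Suc n) := x)) (rct_round G \<Psi> (s (Suc n)))) (?J (Suc n)))"
    proof (rule integral_mono)
      fix s :: "nat \<Rightarrow> 'a \<Rightarrow> 'b option"
      show "indicator (?J n) s \<le>
        measure_pmf.prob (map_pmf (\<lambda>x. s(Suc (Suc n) := x)) (rct_round G \<Psi> (s (Suc n)))) (?J (Suc n))"
      proof (cases "s \<in> ?J n")
        case True
        have "measure_pmf.prob (map_pmf (\<lambda>x. s(Suc (Suc n) := x)) (rct_round G \<Psi> (s (Suc n)))) (?J (Suc n)) = 1"
          using True closed[of "s (Suc n)"]
          by (intro measure_pmf.prob_eq_1[THEN iffD2]) (auto simp: AE_measure_pmf_iff)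
        then show ?thesis by (simp add: indicator_def)
      qed simp
    qed (auto intro!: measure_pmf.integrable_const_bound[where B = 1])
    also have "\<dots> = measure_pmf.prob (rct_path G \<Psi> (Suc (Suc n))) (?J (Suc n))"
      unfolding rct_path.simps(2)[of _ _ "Suc n"] by (rule measure_bind_pmf_eq[symmetric])
    finally show ?case using Suc by linarith
  qed
  have E: "{\<omega>. E n \<omega>} \<in> sets (rct_run G \<Psi>)" for n
  proof -
    have "{\<omega>. E n \<omega>} = (\<Inter>t\<in>{..n}. {\<omega>. \<not> all_coloured G (\<omega> t)})" by (auto simp: E_def)
    also have "\<dots> \<in> sets (rct_run G \<Psi>)"
      by (intro sets.finite_INT) (auto intro: sets_rct_run_component[of "\<lambda>c. \<not> all_coloured G c"])
    finally show ?thesis .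
  qed
  have "?p \<le> measure (rct_run G \<Psi>) {\<omega>. E n \<omega>}" for n
  proof -
    have start: "s 0 = (\<lambda>_. None)" if "s \<in> set_pmf (rct_path G \<Psi> (Suc n))" for s
      using that by (auto simp: set_pmf_iff pmf_rct_path simp del: rct_path.simps split: if_splits)
    have "?p \<le> measure_pmf.prob (rct_path G \<Psi> (Suc n)) {s. \<forall>t\<in>{1..Suc n}. I (s t)}"
      by (rule path)
    also have "\<dots> \<le> measure_pmf.prob (rct_path G \<Psi> (Suc n)) {\<omega>. E (Suc n) \<omega>}"
    proof (rule measure_pmf.finite_measure_mono_AE)
      have "E (Suc n) s" if "s \<in> set_pmf (rct_path G \<Psi> (Suc n))" "\<forall>t\<in>{1..Suc n}. I (s t)" for s
        unfolding E_def
      proof (intro allI impI)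
        fix t assume "t \<le> Suc n"
        then show "\<not> all_coloured G (s t)"
          using ne start[OF that(1)] that(2) stuck[of "s t"] by (cases t) (auto simp: all_coloured_def)
      qed
      then show "AE s in rct_path G \<Psi> (Suc n). s \<in> {s. \<forall>t\<in>{1..Suc n}. I (s t)} \<longrightarrow> s \<in> {\<omega>. E (Suc n) \<omega>}"
        by (auto simp: AE_measure_pmf_iff simp del: rct_path.simps)
    qed auto
    also have "\<dots> \<le> rct_prob G \<Psi> (E (Suc n))"
      by (rule prob_rct_path_le_rct_prob[OF fin E]) (auto simp: E_def)
    also have "\<dots> \<le> measure (rct_run G \<Psi>) {\<omega>. E n \<omega>}"
    proof -
      have "{\<omega>. E (Suc n) \<omega>} \<subseteq> {\<omega>. E n \<omega>}" by (auto simp: E_def)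
      from R.finite_measure_mono[OF this E[of n]] show ?thesis by (simp add: rct_prob_def)
    qed
    finally show ?thesis .
  qed
  \<comment> \<open>Continuity from above: the events \<open>E n\<close> decrease to
    non-termination, and the lower bound \<open>?p\<close> does not depend on
    \<open>n\<close>.\<close>
  moreover have "(\<lambda>n. measure (rct_run G \<Psi>) {\<omega>. E n \<omega>}) \<longlonglongrightarrow> measure (rct_run G \<Psi>) (\<Inter>n. {\<omega>. E n \<omega>})"
    using E by (intro R.finite_Lim_measure_decseq) (auto simp: decseq_def E_def)
  moreover have "(\<Inter>n. {\<omega>. E n \<omega>}) = {\<omega>. never_terminates G \<omega>}"
    by (auto simp: E_def never_terminates_def)
  ultimately show ?thesis
    by (auto simp: rct_prob_def intro: LIMSEQ_le_const)
qed

subsection \<open>The first round\<close>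

text \<open>In round one every palette equals the whole colour space, so the candidates are
  independent and uniform. The vertex set is a parameter because parts of it are sampled
  separately.\<close>

definition first_cands :: "'v set \<Rightarrow> 'c set \<Rightarrow> ('v \<Rightarrow> 'c option) pmf" where
  "first_cands V \<Psi> = Pi_pmf V None (\<lambda>_. map_pmf Some (pmf_of_set \<Psi>))"

context
  fixes \<Psi> :: "'c set"
  assumes fin_Psi: "finite \<Psi>" and ne_Psi: "\<Psi> \<noteq> {}"
begin

lemma card_Psi_pos: "0 < card \<Psi>"
  using fin_Psi ne_Psi by (simp add: card_gt_0_iff)

lemma rct_round_empty:
  "rct_round G \<Psi> (\<lambda>_. None) = map_pmf (adopt G (\<lambda>_. None)) (first_cands (verts G) \<Psi>)"
proof -
  have "candidate G \<Psi> (\<lambda>_. None) = (\<lambda>_. map_pmf Some (pmf_of_set \<Psi>))"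
    using ne_Psi by (auto simp: fun_eq_iff candidate_def palette_def)
  then show ?thesis by (simp add: rct_round_def first_cands_def)
qed

lemma set_pmf_first_cands:
  assumes "finite V" "f \<in> set_pmf (first_cands V \<Psi>)"
  shows "v \<in> V \<Longrightarrow> f v \<in> Some ` \<Psi>" "v \<notin> V \<Longrightarrow> f v = None"
  using assms fin_Psi ne_Psi by (auto simp: first_cands_def set_Pi_pmf PiE_dflt_def)

lemma prob_first_cands_split:
  assumes "finite V" "A \<subseteq> V"
  shows "measure_pmf.prob (first_cands V \<Psi>) E =
    measure_pmf.expectation (first_cands (V - A) \<Psi>)
      (\<lambda>g. measure_pmf.prob (first_cands A \<Psi>) {f. (\<lambda>x. if x \<in> A then f x else g x) \<in> E})"
  unfolding first_cands_def using assms by (rule prob_Pi_pmf_split)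

lemma prob_colour_avoid:
  assumes "S \<subseteq> \<Psi>"
  shows "measure_pmf.prob (map_pmf Some (pmf_of_set \<Psi>)) (- Some ` S) = 1 - card S / card \<Psi>"
proof -
  have "Some -` (- Some ` S) = - S" by auto
  moreover have "card (\<Psi> \<inter> - S) = card \<Psi> - card S"
    using assms fin_Psi by (metis Diff_eq card_Diff_subset finite_subset)
  ultimately show ?thesis
    using fin_Psi ne_Psi card_Psi_pos card_mono[OF fin_Psi assms]
    by (simp add: measure_pmf_of_set of_nat_diff diff_divide_distrib)
qed

lemma prob_first_cands_avoid:
  assumes "finite V" "A \<subseteq> V" "\<And>w. w \<in> A \<Longrightarrow> S w \<subseteq> \<Psi>"
  shows "measure_pmf.prob (first_cands V \<Psi>) {f. \<forall>w\<in>A. f w \<notin> Some ` S w}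
    = (\<Prod>w\<in>A. 1 - card (S w) / card \<Psi>)"
proof -
  let ?B = "\<lambda>w. if w \<in> A then - Some ` S w else UNIV"
  have "{f. \<forall>w\<in>A. f w \<notin> Some ` S w} = Pi V ?B"
    using assms(2) by (auto simp: Pi_iff split: if_splits) blast
  then have "measure_pmf.prob (first_cands V \<Psi>) {f. \<forall>w\<in>A. f w \<notin> Some ` S w}
      = (\<Prod>w\<in>V. measure_pmf.prob (map_pmf Some (pmf_of_set \<Psi>)) (?B w))"
    unfolding first_cands_def using assms(1) by (simp only: measure_Pi_pmf_Pi)
  also have "\<dots> = (\<Prod>w\<in>V. if w \<in> A then 1 - card (S w) / card \<Psi> else 1)"
    using assms(3) prob_colour_avoid by (intro prod.cong refl) (auto simp del: measure_map_pmf)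
  also have "\<dots> = (\<Prod>w\<in>A. 1 - card (S w) / card \<Psi>)"
    using assms(1,2) by (simp add: prod.If_cases Int_absorb1)
  finally show ?thesis .
qed

lemma prob_first_cands_avoid_one:
  assumes "finite V" "A \<subseteq> V" "\<And>w. w \<in> A \<Longrightarrow> h w \<in> Some ` \<Psi>"
  shows "measure_pmf.prob (first_cands V \<Psi>) {f. \<forall>w\<in>A. f w \<noteq> h w} = (1 - 1 / card \<Psi>) ^ card A"
proof -
  have h: "h w = Some (the (h w))" "the (h w) \<in> \<Psi>" if "w \<in> A" for w
    using assms(3)[OF that] by auto
  have "{f. \<forall>w\<in>A. f w \<noteq> h w} = {f. \<forall>w\<in>A. f w \<notin> Some ` {the (h w)}}"
    using h(1) by auto
  then show ?thesis
    using prob_first_cands_avoid[OF assms(1,2), of "\<lambda>w. {the (h w)}"] h(2) by simp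
qed

lemma prob_first_cands_eq:
  assumes "finite V" "u \<in> V" "v \<in> V" "u \<noteq> v"
  shows "measure_pmf.prob (first_cands V \<Psi>) {f. f u = f v} \<le> 1 / card \<Psi>"
proof -
  have "measure_pmf.prob (first_cands V \<Psi>) {f. f u = f v}
      \<le> measure_pmf.prob (first_cands V \<Psi>) {f. f u = f v \<and> f v \<noteq> None}"
    using set_pmf_first_cands(1)[OF assms(1)] assms(3)
    by (intro measure_pmf.finite_measure_mono_AE) (auto simp: AE_measure_pmf_iff)
  also have "\<dots> \<le> 1 / card \<Psi>"
    unfolding first_cands_def
  proof (rule prob_Pi_pmf_eq_le[OF assms])
    fix y :: "'c option" assume "y \<noteq> None"
    then obtain x where y: "y = Some x" by auto
    have "pmf (map_pmf Some (pmf_of_set \<Psi>)) y = pmf (pmf_of_set \<Psi>) x"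
      unfolding y by (rule pmf_map_inj') simp
    then show "pmf (map_pmf Some (pmf_of_set \<Psi>)) y \<le> 1 / card \<Psi>"
      using fin_Psi ne_Psi by (simp add: indicator_def)
  qed simp
  finally show ?thesis .
qed

lemma prob_uncoloured_le:
  assumes "finite (verts G)" "v \<in> verts G" "v \<notin> neighbours G v"
  shows "measure_pmf.prob (first_cands (verts G) \<Psi>) {f. adopt G (\<lambda>_. None) f v = None}
    \<le> card (neighbours G v) / card \<Psi>"
proof -
  let ?P = "measure_pmf.prob (first_cands (verts G) \<Psi>)"
  have N: "neighbours G v \<subseteq> verts G" by (auto simp: neighbours_def)
  have "?P {f. adopt G (\<lambda>_. None) f v = None} \<le> ?P (\<Union>u\<in>neighbours G v. {f. f u = f v})"
  proof (rule measure_pmf.finite_measure_mono_AE)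
    have "\<exists>u\<in>neighbours G v. f u = f v"
      if "f \<in> set_pmf (first_cands (verts G) \<Psi>)" "adopt G (\<lambda>_. None) f v = None" for f
    proof -
      have "f v \<noteq> None" using set_pmf_first_cands(1)[OF assms(1) that(1) assms(2)] by auto
      then show ?thesis using that(2) by (auto simp: adopt_def split: if_splits)
    qed
    then show "AE f in first_cands (verts G) \<Psi>. f \<in> {f. adopt G (\<lambda>_. None) f v = None} \<longrightarrow>
        f \<in> (\<Union>u\<in>neighbours G v. {f. f u = f v})"
      by (auto simp: AE_measure_pmf_iff)
  qed simp
  also have "\<dots> \<le> (\<Sum>u\<in>neighbours G v. ?P {f. f u = f v})"
    using N assms(1) by (intro measure_pmf.finite_measure_subadditive_finite) (auto intro: finite_subset)
  also have "\<dots> \<le> (\<Sum>u\<in>neighbours G v. 1 / card \<Psi>)"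
    using N assms by (intro sum_mono prob_first_cands_eq) auto
  finally show ?thesis by simp
qed

text \<open>Reveal the candidates outside \<open>A\<close>. Each \<open>a\<close> in
  \<open>A\<close> then has a neighbour \<open>h a\<close> with a known candidate and must avoid
  this one colour; these choices are independent over \<open>A\<close>.\<close>

lemma prob_all_coloured_first_round_le:
  assumes "finite (verts G)" "A \<subseteq> verts G"
    and h: "\<And>a. a \<in> A \<Longrightarrow> h a \<in> neighbours G a - A"
  shows "measure_pmf.prob (rct_round G \<Psi> (\<lambda>_. None)) {x. all_coloured G x} \<le> (1 - 1 / card \<Psi>) ^ card A"
proof -
  let ?V = "verts G"
  have hV: "h a \<in> ?V - A" if "a \<in> A" for a
    using h[OF that] by (auto simp: neighbours_def)
  let ?E = "{f. all_coloured G (adopt G (\<lambda>_. None) f)}"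
  have sub: "{f. (\<lambda>x. if x \<in> A then f x else g x) \<in> ?E} \<subseteq> {f. \<forall>w\<in>A. f w \<noteq> g (h w)}" for g :: "'a \<Rightarrow> 'c option"
  proof clarify
    fix f w assume *: "all_coloured G (adopt G (\<lambda>_. None) (\<lambda>x. if x \<in> A then f x else g x))"
      "w \<in> A" "f w = g (h w)"
    have "h w \<in> neighbours G w" "h w \<notin> A" "w \<in> ?V" using h[OF *(2)] assms(2) *(2) by auto
    moreover from this have "adopt G (\<lambda>_. None) (\<lambda>x. if x \<in> A then f x else g x) w \<noteq> None"
      using *(1) unfolding all_coloured_def by blast
    ultimately show False
      using *(2,3) by (auto simp: adopt_def split: if_splits)
  qed
  have "measure_pmf.prob (rct_round G \<Psi> (\<lambda>_. None)) {x. all_coloured G x} = measure_pmf.prob (first_cands ?V \<Psi>) ?E"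
    by (simp add: rct_round_empty vimage_def)
  also have "\<dots> \<le> (1 - 1 / card \<Psi>) ^ card A"
    unfolding prob_first_cands_split[OF assms(1,2)]
  proof (rule expectation_pmf_le_const)
    fix g assume g: "g \<in> set_pmf (first_cands (?V - A) \<Psi>)"
    have "measure_pmf.prob (first_cands A \<Psi>) {f. (\<lambda>x. if x \<in> A then f x else g x) \<in> ?E}
      \<le> measure_pmf.prob (first_cands A \<Psi>) {f. \<forall>w\<in>A. f w \<noteq> g (h w)}"
      by (intro measure_pmf.finite_measure_mono sub) auto
    also have "\<dots> = (1 - 1 / card \<Psi>) ^ card A"
      using assms(1,2) hV g
      by (intro prob_first_cands_avoid_one set_pmf_first_cands(1)[of "?V - A"]) (auto intro: finite_subset)
    finally show "measure_pmf.prob (first_cands A \<Psi>) {f. (\<lambda>x. if x \<in> A then f x else g x) \<in> ?E}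
      \<le> (1 - 1 / card \<Psi>) ^ card A" .
  qed simp
  finally show ?thesis .
qed

text \<open>The indicators of the events that a given colour is avoided on \<open>W\<close> are negatively correlated,
  so the number of avoided colours has variance at most its mean.\<close>

lemma prob_few_avoided_colours_le:
  assumes "finite V" "W \<subseteq> V" "2 \<le> card \<Psi>"
  defines "m \<equiv> card \<Psi> * (1 - 1 / card \<Psi>) ^ card W"
  shows "measure_pmf.prob (first_cands V \<Psi>)
      {f. real (card {x \<in> \<Psi>. \<forall>w\<in>W. f w \<noteq> Some x}) \<le> m / 2} \<le> 4 / m"
proof -
  let ?Q = "first_cands V \<Psi>" and ?k = "real (card \<Psi>)"
  let ?Z = "\<lambda>x f. indicator {f. \<forall>w\<in>W. f w \<noteq> Some x} f :: real"
  define U where "U f = (\<Sum>x\<in>\<Psi>. ?Z x f)" for f :: "'a \<Rightarrow> 'c option"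
  have k: "?k \<ge> 2" using assms(3) by simp
  have mpos: "m > 0" unfolding m_def using k by (intro mult_pos_pos zero_less_power) auto
  have U: "real (card {x \<in> \<Psi>. \<forall>w\<in>W. f w \<noteq> Some x}) = U f" for f
    using fin_Psi unfolding U_def by (simp add: indicator_def sum.If_cases Int_def)
  have U0: "0 \<le> U f" "U f \<le> ?k" for f
    unfolding U[symmetric] using fin_Psi by (auto intro!: card_mono)
  have int: "integrable ?Q g" if "\<And>f. \<bar>g f\<bar> \<le> b" for g and b :: real
    using that by (intro measure_pmf.integrable_const_bound[where B = b]) auto
  have EZ: "measure_pmf.expectation ?Q (?Z x) = (1 - 1 / ?k) ^ card W" if "x \<in> \<Psi>" for x
    using prob_first_cands_avoid_one[OF assms(1,2), of "\<lambda>_. Some x"] that by simp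
  have EU: "measure_pmf.expectation ?Q U = m"
    unfolding U_def
    by (subst Bochner_Integration.integral_sum) (auto simp: EZ[simplified] m_def intro: int[of _ 1])
  have EZZ: "measure_pmf.expectation ?Q (\<lambda>f. ?Z x f * ?Z y f) \<le>
      ((1 - 1 / ?k) ^ card W)\<^sup>2 + (if x = y then (1 - 1 / ?k) ^ card W else 0)" if "x \<in> \<Psi>" "y \<in> \<Psi>" for x y
  proof (cases "x = y")
    case True
    have "(\<lambda>f. ?Z x f * ?Z x f) = ?Z x" by (rule ext) (auto simp: indicator_def)
    then show ?thesis using EZ[OF that(1)] True by simp
  next
    case False
    have "(\<lambda>f. ?Z x f * ?Z y f) = indicator {f. \<forall>w\<in>W. f w \<notin> Some ` {x, y}}"
      by (auto simp: indicator_def fun_eq_iff)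
    then have "measure_pmf.expectation ?Q (\<lambda>f. ?Z x f * ?Z y f) = (1 - 2 / ?k) ^ card W"
      using prob_first_cands_avoid[OF assms(1,2), of "\<lambda>_. {x, y}"] that False by simp
    \<comment> \<open>Negative correlation: avoiding two colours jointly is at most as likely as
      independence would predict.\<close>
    also have "\<dots> \<le> ((1 - 1 / ?k)\<^sup>2) ^ card W"
      using k by (intro power_mono) (auto simp: power2_eq_square field_simps)
    finally show ?thesis using False by (simp add: power_mult[symmetric] mult.commute)
  qed
  have "measure_pmf.expectation ?Q (\<lambda>f. (U f)\<^sup>2) = (\<Sum>x\<in>\<Psi>. \<Sum>y\<in>\<Psi>. measure_pmf.expectation ?Q (\<lambda>f. ?Z x f * ?Z y f))"
    unfolding U_def power2_eq_square sum_product
    by (subst Bochner_Integration.integral_sum, rule Bochner_Integration.integrable_sum,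
        (rule int[of _ 1], auto simp: indicator_def)[1],
        intro sum.cong refl, rule Bochner_Integration.integral_sum, rule int[of _ 1])
       (auto simp: indicator_def)
  also have "\<dots> \<le> (\<Sum>x\<in>\<Psi>. \<Sum>y\<in>\<Psi>. ((1 - 1 / ?k) ^ card W)\<^sup>2 + (if x = y then (1 - 1 / ?k) ^ card W else 0))"
    by (intro sum_mono EZZ)
  also have "\<dots> = m\<^sup>2 + m"
    using fin_Psi by (simp add: sum.distrib m_def power2_eq_square algebra_simps)
  finally have EU2: "measure_pmf.expectation ?Q (\<lambda>f. (U f)\<^sup>2) \<le> m\<^sup>2 + m" .
  have U2: "integrable ?Q (\<lambda>f. (U f)\<^sup>2)"
    using U0 by (intro int[of _ "?k\<^sup>2"]) (auto intro: power_mono)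
  have "measure_pmf.variance ?Q U = measure_pmf.expectation ?Q (\<lambda>f. (U f)\<^sup>2) - m\<^sup>2"
    using U0 by (subst measure_pmf.variance_eq) (auto simp: EU intro!: U2 int[of _ ?k])
  then have var: "measure_pmf.variance ?Q U \<le> m" using EU2 by simp
  have "measure_pmf.prob ?Q {f. U f \<le> m / 2} \<le> measure_pmf.prob ?Q {f \<in> space ?Q. m / 2 \<le> \<bar>U f - measure_pmf.expectation ?Q U\<bar>}"
    using mpos by (intro measure_pmf.finite_measure_mono) (auto simp: EU)
  also have "\<dots> \<le> measure_pmf.variance ?Q U / (m / 2)\<^sup>2"
    using mpos by (intro measure_pmf.Chebyshev_inequality U2) auto
  also have "\<dots> \<le> m / (m / 2)\<^sup>2" using var by (intro divide_right_mono) auto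
  also have "\<dots> = 4 / m" using mpos by (simp add: power2_eq_square field_simps)
  finally show ?thesis unfolding U .
qed

end

subsection \<open>Two rounds\<close>

text \<open>\<open>I\<close> orients the edges with out-degree at most \<open>\<kappa>\<close>.
  Charging a conflict to the tail of its edge makes the union bound run over \<open>\<kappa>\<close>
  neighbours instead of all of them, and a given pair agrees with probability at most
  \<open>1 / q\<close> because the tail draws from at least \<open>q\<close> colours.\<close>

lemma prob_round_incomplete_le:
  assumes fin: "finite (verts G)"
    and loopfree: "\<And>v. v \<in> verts G \<Longrightarrow> v \<notin> neighbours G v"
    and I: "\<And>v. v \<in> verts G \<Longrightarrow> I v \<subseteq> neighbours G v"
    and orient: "\<And>u v. v \<in> verts G \<Longrightarrow> u \<in> neighbours G v \<Longrightarrow> u \<in> I v \<or> v \<in> I u"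
    and card_I: "\<And>v. v \<in> verts G \<Longrightarrow> card (I v) \<le> \<kappa>"
    and fin_Psi: "finite \<Psi>" and q: "0 < q"
    and pal: "\<And>v. v \<in> verts G \<Longrightarrow> c v = None \<Longrightarrow> q \<le> real (card (palette G \<Psi> c v))"
  shows "measure_pmf.prob (rct_round G \<Psi> c) {x. \<not> all_coloured G x}
    \<le> (\<Sum>v\<in>verts G. if c v = None then \<kappa> / q else 0)"
proof -
  let ?V = "verts G"
  let ?Q = "Pi_pmf ?V None (candidate G \<Psi> c)"
  let ?U = "{v\<in>?V. c v = None}"
  let ?C = "\<lambda>v u. {f. f u = f v \<and> f v \<noteq> None}"
  have N: "neighbours G v \<subseteq> ?V" for v by (auto simp: neighbours_def)
  have finI: "finite (I v)" if "v \<in> ?V" for v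
    using I[OF that] N[of v] fin by (meson finite_subset)
  \<comment> \<open>Since \<open>q > 0\<close> excludes empty palettes, having a candidate is the
    same as being uncoloured; hence both ends of a conflict are uncoloured before the round.\<close>
  have cand: "(c v = None \<longleftrightarrow> f v \<noteq> None)" if f: "f \<in> set_pmf ?Q" and v: "v \<in> ?V" for f v
  proof -
    have "f v \<in> set_pmf (candidate G \<Psi> c v)"
      using f v fin by (auto simp: set_Pi_pmf PiE_dflt_def)
    moreover have "palette G \<Psi> c v \<noteq> {}" if "c v = None" using pal[OF v that] q by auto
    ultimately show ?thesis by (auto simp: candidate_def split: if_splits)
  qed
  have sub: "f \<in> (\<Union>v\<in>?U. \<Union>u\<in>I v. ?C v u)"
    if f: "f \<in> set_pmf ?Q" and nc: "\<not> all_coloured G (adopt G c f)" for f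
  proof -
    obtain v where v: "v \<in> ?V" "adopt G c f v = None"
      using nc by (auto simp: all_coloured_def)
    have cv: "c v = None" using v(2) by (auto simp: adopt_def split: if_splits)
    then have fv: "f v \<noteq> None" using cand[OF f v(1)] by simp
    then obtain u where u: "u \<in> neighbours G v" "f u = f v"
      using v(2) cv by (auto simp: adopt_def split: if_splits)
    have uV: "u \<in> ?V" using u N by auto
    have cu: "c u = None" using cand[OF f uV] fv u(2) by simp
    have "u \<in> I v \<or> v \<in> I u" using orient[OF v(1) u(1)] .
    then show ?thesis
    proof
      assume "u \<in> I v"
      then show ?thesis using v(1) cv fv u(2) by blast
    next
      assume "v \<in> I u"
      then show ?thesis using uV cu fv u(2) by (intro UN_I[of u] UN_I[of v]) auto
    qed
  qed
  have "measure_pmf.prob (rct_round G \<Psi> c) {x. \<not> all_coloured G x}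
      = measure_pmf.prob ?Q {f. \<not> all_coloured G (adopt G c f)}"
    by (simp add: rct_round_def vimage_def)
  also have "\<dots> \<le> measure_pmf.prob ?Q (\<Union>v\<in>?U. \<Union>u\<in>I v. ?C v u)"
    by (intro measure_pmf.finite_measure_mono_AE) (auto simp: AE_measure_pmf_iff dest!: sub)
  also have "\<dots> \<le> (\<Sum>v\<in>?U. measure_pmf.prob ?Q (\<Union>u\<in>I v. ?C v u))"
    using fin by (intro measure_pmf.finite_measure_subadditive_finite) auto
  also have "\<dots> \<le> (\<Sum>v\<in>?U. \<kappa> / q)"
  proof (rule sum_mono)
    fix v assume v: "v \<in> ?U"
    have "measure_pmf.prob ?Q (\<Union>u\<in>I v. ?C v u) \<le> (\<Sum>u\<in>I v. measure_pmf.prob ?Q (?C v u))"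
      using v finI by (intro measure_pmf.finite_measure_subadditive_finite) auto
    also have "\<dots> \<le> (\<Sum>u\<in>I v. 1 / q)"
    proof (rule sum_mono)
      fix u assume "u \<in> I v"
      then have u: "u \<in> ?V" "u \<noteq> v" using v I[of v] N[of v] loopfree[of v] by auto
      have pal_v: "q \<le> real (card (palette G \<Psi> c v))" "c v = None" using pal v by auto
      have fin_pal: "finite (palette G \<Psi> c v)" using fin_Psi by (auto simp: palette_def)
      have ne: "palette G \<Psi> c v \<noteq> {}" using pal_v q by auto
      show "measure_pmf.prob ?Q (?C v u) \<le> 1 / q"
      proof (rule prob_Pi_pmf_eq_le[OF fin u(1) _ u(2)])
        fix y :: "'b option" assume "y \<noteq> None"
        then obtain x where y: "y = Some x" by auto
        have "pmf (candidate G \<Psi> c v) y = pmf (pmf_of_set (palette G \<Psi> c v)) x"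
          using ne pal_v(2) unfolding y by (simp add: candidate_def pmf_map_inj')
        also have "\<dots> \<le> 1 / card (palette G \<Psi> c v)"
          using ne fin_pal by (simp add: indicator_def)
        also have "\<dots> \<le> 1 / q" using pal_v(1) q by (intro divide_left_mono) auto
        finally show "pmf (candidate G \<Psi> c v) y \<le> 1 / q" .
      qed (use v q in auto)
    qed
    also have "\<dots> = card (I v) / q" by simp
    also have "\<dots> \<le> \<kappa> / q" using card_I v q by (intro divide_right_mono) auto
    finally show "measure_pmf.prob ?Q (\<Union>u\<in>I v. ?C v u) \<le> \<kappa> / q" .
  qed
  also have "\<dots> = (\<Sum>v\<in>?V. if c v = None then \<kappa> / q else 0)"
    using fin by (simp add: sum.If_cases Int_def)
  finally show ?thesis .
qed

text \<open>A vertex of degree at most half the number of colours keeps half of its palette for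
  certain. By counting edges there are few vertices of larger degree, and Chebyshev's inequality
  treats them; they account for the \<open>4\<close>, the orientation accounts for
  \<open>\<kappa>\<close>.\<close>

lemma prob_two_rounds_incomplete_le:
  assumes fin: "finite (verts G)"
    and loopfree: "\<And>v. v \<in> verts G \<Longrightarrow> v \<notin> neighbours G v"
    and I: "\<And>v. v \<in> verts G \<Longrightarrow> I v \<subseteq> neighbours G v"
    and orient: "\<And>u v. v \<in> verts G \<Longrightarrow> u \<in> neighbours G v \<Longrightarrow> u \<in> I v \<or> v \<in> I u"
    and card_I: "\<And>v. v \<in> verts G \<Longrightarrow> card (I v) \<le> \<kappa>"
    and fin_Psi: "finite \<Psi>" and card_Psi: "2 \<le> card \<Psi>"
    and deg: "\<And>v. v \<in> verts G \<Longrightarrow> card (neighbours G v) \<le> \<Delta>"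
  shows "measure_pmf.prob (bind_pmf (rct_round G \<Psi> (\<lambda>_. None)) (rct_round G \<Psi>)) {x. \<not> all_coloured G x}
    \<le> 2 * real (\<Sum>v\<in>verts G. card (neighbours G v)) * (4 + real \<kappa>)
        / ((real (card \<Psi>))\<^sup>2 * (1 - 1 / card \<Psi>) ^ \<Delta>)"
proof -
  let ?V = "verts G" and ?k = "real (card \<Psi>)" and ?N = "neighbours G"
  let ?Q = "first_cands ?V \<Psi>" and ?s = "adopt G (\<lambda>_. None) :: _ \<Rightarrow> _ \<Rightarrow> 'b option"
  let ?S = "real (\<Sum>v\<in>?V. card (?N v))"
  \<comment> \<open>By the degree bound, \<open>?k * e\<close> is at most the expected number of
    colours avoided by any neighbourhood, and \<open>q\<close> is half of it.\<close>
  define e where "e = (1 - 1 / ?k) ^ \<Delta>"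
  define q where "q = ?k * e / 2"
  have ne_Psi: "\<Psi> \<noteq> {}" using card_Psi by auto
  have k: "?k \<ge> 2" using card_Psi by simp
  have e: "0 < e" "e \<le> 1" unfolding e_def using k by (auto intro!: power_le_one)
  have q: "0 < q" "q \<le> ?k / 2" unfolding q_def using k e by auto
  have N: "?N v \<subseteq> ?V" for v by (auto simp: neighbours_def)
  have finN: "finite (?N v)" for v using N fin by (rule finite_subset)
  \<comment> \<open>Colours that no neighbour even tries. They surely survive in the palette, and
    unlike the adopted colours they can be analysed directly from the independent
    candidates.\<close>
  define free where "free f v = {x\<in>\<Psi>. \<forall>w\<in>?N v. f w \<noteq> Some x}" for f :: "'a \<Rightarrow> 'b option" and v
  have free_sub: "free f v \<subseteq> palette G \<Psi> (?s f) v" for f v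
    by (auto simp: free_def palette_def adopt_def split: if_splits)
  have free_card: "real (card (free f v)) \<ge> ?k - card (?N v)" for f v
  proof -
    have "card \<Psi> \<le> card (free f v \<union> (\<lambda>w. the (f w)) ` ?N v)"
      using fin_Psi finN by (intro card_mono) (force simp: free_def image_iff)+
    also have "\<dots> \<le> card (free f v) + card (?N v)"
      by (rule order.trans[OF card_Un_le]) (auto intro!: card_image_le finN)
    finally show ?thesis by linarith
  qed
  define H where "H = {v\<in>?V. ?k / 2 < card (?N v)}"
  have finH: "finite H" unfolding H_def using fin by auto
  have "card H * (?k / 2) = (\<Sum>v\<in>H. ?k / 2)" by simp
  also have "\<dots> \<le> (\<Sum>v\<in>H. real (card (?N v)))" by (intro sum_mono) (auto simp: H_def)
  also have "\<dots> \<le> (\<Sum>v\<in>?V. real (card (?N v)))" using fin by (intro sum_mono2) (auto simp: H_def)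
  finally have card_H: "card H \<le> 2 * ?S / ?k" using k by (simp add: field_simps)
  define bad where "bad = {f. \<exists>v\<in>H. real (card (free f v)) \<le> q}"
  have prob_bad: "measure_pmf.prob ?Q bad \<le> card H * (2 / q)"
  proof -
    have "measure_pmf.prob ?Q bad = measure_pmf.prob ?Q (\<Union>v\<in>H. {f. real (card (free f v)) \<le> q})"
      unfolding bad_def by (intro arg_cong[where f = "measure_pmf.prob ?Q"]) auto
    also have "\<dots> \<le> (\<Sum>v\<in>H. measure_pmf.prob ?Q {f. real (card (free f v)) \<le> q})"
      using finH by (intro measure_pmf.finite_measure_subadditive_finite) auto
    also have "\<dots> \<le> (\<Sum>v\<in>H. 2 / q)"
    proof (rule sum_mono)
      fix v assume v: "v \<in> H"
      let ?m = "?k * (1 - 1 / ?k) ^ card (?N v)"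
      have "e \<le> (1 - 1 / ?k) ^ card (?N v)"
        unfolding e_def using k deg v by (intro power_decreasing) (auto simp: H_def)
      then have qm: "2 * q \<le> ?m" unfolding q_def using k by simp
      have "measure_pmf.prob ?Q {f. real (card (free f v)) \<le> q} \<le> measure_pmf.prob ?Q {f. real (card (free f v)) \<le> ?m / 2}"
        using qm by (intro measure_pmf.finite_measure_mono) auto
      also have "\<dots> \<le> 4 / ?m"
        unfolding free_def by (rule prob_few_avoided_colours_le[OF fin_Psi ne_Psi fin N card_Psi])
      also have "\<dots> \<le> 4 / (2 * q)" using qm q by (intro divide_left_mono) auto
      finally show "measure_pmf.prob ?Q {f. real (card (free f v)) \<le> q} \<le> 2 / q" by simp
    qed
    finally show ?thesis by simp
  qed
  \<comment> \<open>A bound for each outcome of round one: a bad outcome is charged the trivial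
    probability 1, a good one the union bound over its uncoloured vertices.\<close>
  have round2: "measure_pmf.prob (rct_round G \<Psi> (?s f)) {x. \<not> all_coloured G x}
      \<le> indicator bad f + (\<Sum>v\<in>?V. indicator {f. ?s f v = None} f * (real \<kappa> / q))" for f
  proof (cases "f \<in> bad")
    case True
    have "0 \<le> (\<Sum>v\<in>?V. indicator {f. ?s f v = None} f * (real \<kappa> / q))"
      using q by (intro sum_nonneg) auto
    moreover have "measure_pmf.prob (rct_round G \<Psi> (?s f)) {x. \<not> all_coloured G x} \<le> 1" by simp
    moreover have "indicator bad f = (1 :: real)" using True by simp
    ultimately show ?thesis by linarith
  next
    case False
    have "q \<le> real (card (palette G \<Psi> (?s f) v))" if v: "v \<in> ?V" for v
    proof -
      have "q \<le> card (free f v)"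
      proof (cases "v \<in> H")
        case True then show ?thesis using False by (auto simp: bad_def)
      next
        case False
        then show ?thesis using v free_card[of v f] q by (auto simp: H_def)
      qed
      also have "\<dots> \<le> card (palette G \<Psi> (?s f) v)"
        using fin_Psi free_sub by (intro of_nat_mono card_mono) (auto simp: palette_def)
      finally show ?thesis .
    qed
    then have "measure_pmf.prob (rct_round G \<Psi> (?s f)) {x. \<not> all_coloured G x}
      \<le> (\<Sum>v\<in>?V. if ?s f v = None then \<kappa> / q else 0)"
      using I by (intro prob_round_incomplete_le[OF fin loopfree I orient card_I fin_Psi q(1)]) auto
    also have "\<dots> = (\<Sum>v\<in>?V. indicator {f. ?s f v = None} f * (real \<kappa> / q))"
      by (intro sum.cong) (auto simp: indicator_def)
    finally show ?thesis using False by simp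
  qed
  have int: "integrable ?Q g" if "\<And>f. \<bar>g f\<bar> \<le> b" for g and b :: real
    using that by (intro measure_pmf.integrable_const_bound[where B = b]) auto
  have int1: "integrable ?Q (\<lambda>f. indicator {f. ?s f v = None} f * (real \<kappa> / q))" for v
    using q by (intro int[of _ "\<kappa> / q"]) (auto simp: indicator_def)
  have int2: "integrable ?Q (\<lambda>f. \<Sum>v\<in>?V. indicator {f. ?s f v = None} f * (real \<kappa> / q))"
    by (intro Bochner_Integration.integrable_sum int1)
  have int_bad: "integrable ?Q (\<lambda>f. indicator bad f :: real)"
    by (intro int[of _ 1]) auto
  have "measure_pmf.prob (bind_pmf (rct_round G \<Psi> (\<lambda>_. None)) (rct_round G \<Psi>)) {x. \<not> all_coloured G x}
    = measure_pmf.expectation ?Q (\<lambda>f. measure_pmf.prob (rct_round G \<Psi> (?s f)) {x. \<not> all_coloured G x})"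
    unfolding measure_bind_pmf_eq rct_round_empty[OF fin_Psi ne_Psi] by simp
  also have "\<dots> \<le> measure_pmf.expectation ?Q
      (\<lambda>f. indicator bad f + (\<Sum>v\<in>?V. indicator {f. ?s f v = None} f * (real \<kappa> / q)))"
    by (intro integral_mono Bochner_Integration.integrable_add int_bad int2 round2) (auto intro: int[of _ 1])
  also have "\<dots> = measure_pmf.prob ?Q bad + (\<Sum>v\<in>?V. measure_pmf.prob ?Q {f. ?s f v = None} * (real \<kappa> / q))"
    unfolding Bochner_Integration.integral_add[OF int_bad int2] Bochner_Integration.integral_sum[OF int1] by simp
  also have "\<dots> \<le> card H * (2 / q) + (\<Sum>v\<in>?V. (card (?N v) / ?k) * (\<kappa> / q))"
    using prob_bad q loopfree
    by (intro add_mono sum_mono mult_right_mono prob_uncoloured_le[OF fin_Psi ne_Psi fin]) auto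
  also have "\<dots> = card H * (2 / q) + ?S / ?k * (\<kappa> / q)"
    by (simp add: sum_distrib_right sum_divide_distrib)
  also have "\<dots> \<le> 2 * ?S / ?k * (2 / q) + ?S / ?k * (\<kappa> / q)"
    using card_H q by (intro add_right_mono mult_right_mono) auto
  also have "\<dots> = 2 * ?S * (4 + real \<kappa>) / (?k\<^sup>2 * e)"
    using k e by (simp add: q_def power2_eq_square field_simps)
  finally show ?thesis unfolding e_def .
qed

theorem rct_terminates_after_2:
  assumes fin: "finite (verts G)" and ne: "verts G \<noteq> {}"
    and loopfree: "\<And>v. v \<in> verts G \<Longrightarrow> v \<notin> neighbours G v"
    and I: "\<And>v. v \<in> verts G \<Longrightarrow> I v \<subseteq> neighbours G v"
    and orient: "\<And>u v. v \<in> verts G \<Longrightarrow> u \<in> neighbours G v \<Longrightarrow> u \<in> I v \<or> v \<in> I u"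
    and card_I: "\<And>v. v \<in> verts G \<Longrightarrow> card (I v) \<le> \<kappa>"
    and fin_Psi: "finite \<Psi>" and card_Psi: "2 \<le> card \<Psi>"
    and deg: "\<And>v. v \<in> verts G \<Longrightarrow> card (neighbours G v) \<le> \<Delta>"
    and A: "A \<subseteq> verts G" and h: "\<And>a. a \<in> A \<Longrightarrow> h a \<in> neighbours G a - A"
  shows "rct_prob G \<Psi> (terminates_after G 2) \<ge> 1 - exp (- real (card A) / card \<Psi>)
    - 2 * real (\<Sum>v\<in>verts G. card (neighbours G v)) * (4 + real \<kappa>) * exp (2 * real \<Delta> / card \<Psi>) / (real (card \<Psi>))\<^sup>2"
proof -
  let ?k = "real (card \<Psi>)"
  let ?S = "real (\<Sum>v\<in>verts G. card (neighbours G v))"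
  have k: "?k \<ge> 2" using card_Psi by simp
  have ne_Psi: "\<Psi> \<noteq> {}" using card_Psi by auto
  have "(1 - 1 / ?k) ^ card A \<le> exp (- 1 / ?k) ^ card A"
    using k exp_ge_add_one_self[of "- 1 / ?k"] by (intro power_mono) auto
  also have "\<dots> = exp (- real (card A) / ?k)" by (simp add: exp_of_nat_mult[symmetric])
  finally have 1: "(1 - 1 / ?k) ^ card A \<le> exp (- real (card A) / ?k)" .
  \<comment> \<open>At \<open>x = 1 / ?k \<le> 1 / 2\<close> the logarithm satisfies
    \<open>ln (1 - x) \<ge> - 2 * x\<close>, so the palette factor is controlled by
    \<open>\<Delta> / ?k\<close> alone.\<close>
  have "exp (- (2 * real \<Delta> / ?k)) = exp (- 2 / ?k) ^ \<Delta>" by (simp add: exp_of_nat_mult[symmetric] field_simps)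
  also have "\<dots> \<le> (1 - 1 / ?k) ^ \<Delta>"
  proof (rule power_mono)
    have "- (1 / ?k) - 2 * (1 / ?k)\<^sup>2 \<le> ln (1 - 1 / ?k)"
      using k by (intro ln_one_minus_pos_lower_bound) auto
    moreover have "2 * (1 / ?k)\<^sup>2 \<le> 1 / ?k" using k by (simp add: power2_eq_square field_simps)
    ultimately have "- 2 / ?k \<le> ln (1 - 1 / ?k)" by simp
    then show "exp (- 2 / ?k) \<le> 1 - 1 / ?k" using k by (subst ln_ge_iff[symmetric]) auto
  qed simp
  finally have 2: "exp (- (2 * real \<Delta> / ?k)) \<le> (1 - 1 / ?k) ^ \<Delta>" .
  have "2 * ?S * (4 + real \<kappa>) / (?k\<^sup>2 * (1 - 1 / ?k) ^ \<Delta>) \<le> 2 * ?S * (4 + real \<kappa>) / (?k\<^sup>2 * exp (- (2 * real \<Delta> / ?k)))"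
    using k by (intro divide_left_mono mult_left_mono 2 mult_pos_pos mult_nonneg_nonneg zero_less_power)
      (auto intro: sum_nonneg)
  also have "\<dots> = 2 * ?S * (4 + real \<kappa>) * exp (2 * real \<Delta> / ?k) / ?k\<^sup>2"
    by (simp add: exp_minus field_simps)
  finally have 3: "2 * ?S * (4 + real \<kappa>) / (?k\<^sup>2 * (1 - 1 / ?k) ^ \<Delta>)
      \<le> 2 * ?S * (4 + real \<kappa>) * exp (2 * real \<Delta> / ?k) / ?k\<^sup>2" .
  have "measure_pmf.prob (rct_round G \<Psi> (\<lambda>_. None)) {x. all_coloured G x} \<le> exp (- real (card A) / ?k)"
    using prob_all_coloured_first_round_le[OF fin_Psi ne_Psi fin A] h 1 by force
  moreover have "measure_pmf.prob (bind_pmf (rct_round G \<Psi> (\<lambda>_. None)) (rct_round G \<Psi>)) {x. \<not> all_coloured G x}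
      \<le> 2 * ?S * (4 + real \<kappa>) / (?k\<^sup>2 * (1 - 1 / ?k) ^ \<Delta>)"
    by (rule prob_two_rounds_incomplete_le) fact+
  ultimately show ?thesis
    using rct_prob_terminates_after_2_ge[OF fin fin_Psi ne] 3 by linarith
qed

subsection \<open>A clique that is short of colours\<close>

text \<open>The birthday bound. The newly inserted vertex is sampled last and has to avoid the
  \<open>card J\<close> distinct colours already present, a factor at most
  \<open>exp (- card J / card \<Psi>)\<close>; the exponents add up to the triangular
  number.\<close>

lemma prob_first_cands_inj_on_le:
  assumes fin_Psi: "finite \<Psi>" and ne_Psi: "\<Psi> \<noteq> {}" and "finite V" "J \<subseteq> V"
  shows "measure_pmf.prob (first_cands V \<Psi>) {f. inj_on f J}
    \<le> exp (- real (card J * (card J - 1)) / (2 * real (card \<Psi>)))"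
proof -
  have "finite J" using assms(3,4) by (rule finite_subset[rotated])
  then show ?thesis using assms(3,4)
  proof (induction J arbitrary: V rule: finite_induct)
    case empty
    then show ?case by simp
  next
    case (insert a J)
    let ?k = "real (card \<Psi>)" and ?m = "real (card J)"
    have k: "?k > 0" using fin_Psi ne_Psi by (simp add: card_gt_0_iff)
    have aV: "{a} \<subseteq> V" using insert.prems by auto
    have bound: "measure_pmf.prob (first_cands {a} \<Psi>)
        {f. (\<lambda>x. if x \<in> {a} then f x else g x) \<in> {f. inj_on f (insert a J)}}
        \<le> exp (- ?m / ?k) * indicator {f. inj_on f J} g"
      if g: "g \<in> set_pmf (first_cands (V - {a}) \<Psi>)" for g
    proof -
      have gJ: "g w \<in> Some ` \<Psi>" if "w \<in> J" for w
        using insert.prems insert.hyps that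
        by (intro set_pmf_first_cands(1)[OF fin_Psi ne_Psi _ g]) auto
      have cong: "inj_on (\<lambda>x. if x = a then y else g x) J = inj_on g J"
          "(\<lambda>x. if x = a then y else g x) ` J = g ` J" for y
        using insert.hyps by (auto intro!: inj_on_cong image_cong)
      have eq: "{f. (\<lambda>x. if x \<in> {a} then f x else g x) \<in> {f. inj_on f (insert a J)}}
          = (if inj_on g J then {f. \<forall>w\<in>{a}. f w \<notin> Some ` (the ` g ` J)} else {})"
      proof -
        have "Some ` (the ` g ` J) = g ` J"
        proof -
          have "Some (the (g w)) = g w" if "w \<in> J" for w
            using gJ[OF that] by auto
          then show ?thesis by (auto simp: image_image)
        qed
        moreover have "inj_on (\<lambda>x. if x \<in> {a} then f x else g x) (insert a J) \<longleftrightarrow> inj_on g J \<and> f a \<notin> g ` J" for f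
        proof -
          have "(\<lambda>x. if x \<in> {a} then f x else g x) = (\<lambda>x. if x = a then f a else g x)" by auto
          then show ?thesis using cong[of "f a"] insert.hyps by (simp add: inj_on_insert)
        qed
        ultimately show ?thesis by auto
      qed
      show ?thesis
      proof (cases "inj_on g J")
        case True
        have sub: "the ` g ` J \<subseteq> \<Psi>"
          using gJ by fastforce
        have "inj_on the (g ` J)"
        proof (rule inj_onI)
          fix x y assume "x \<in> g ` J" "y \<in> g ` J" "the x = the y"
          moreover have "w \<noteq> None" if "w \<in> g ` J" for w
            using gJ that by fastforce
          ultimately show "x = y" by (metis option.expand)
        qed
        then have "card (the ` g ` J) = card J" using True by (simp add: card_image)
        then have "measure_pmf.prob (first_cands {a} \<Psi>) {f. \<forall>w\<in>{a}. f w \<notin> Some ` (the ` g ` J)} = 1 - ?m / ?k"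
          using prob_first_cands_avoid[OF fin_Psi ne_Psi, of "{a}" "{a}" "\<lambda>_. the ` g ` J"] sub by simp
        also have "\<dots> \<le> exp (- ?m / ?k)" using exp_ge_add_one_self[of "- ?m / ?k"] by simp
        finally show ?thesis unfolding eq using True by simp
      next
        case False
        then show ?thesis unfolding eq by simp
      qed
    qed
    have "measure_pmf.prob (first_cands V \<Psi>) {f. inj_on f (insert a J)}
      \<le> measure_pmf.expectation (first_cands (V - {a}) \<Psi>) (\<lambda>g. exp (- ?m / ?k) * indicator {f. inj_on f J} g)"
      unfolding prob_first_cands_split[OF fin_Psi ne_Psi insert.prems(1) aV]
      using bound
      by (intro integral_mono_AE measure_pmf.integrable_const_bound[where B = 1])
         (auto simp: AE_measure_pmf_iff indicator_def divide_nonneg_nonneg)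
    also have "\<dots> = exp (- ?m / ?k) * measure_pmf.prob (first_cands (V - {a}) \<Psi>) {f. inj_on f J}"
      by simp
    also have "\<dots> \<le> exp (- ?m / ?k) * exp (- real (card J * (card J - 1)) / (2 * ?k))"
      using insert.IH[of "V - {a}"] insert.prems insert.hyps by (intro mult_left_mono) auto
    also have "\<dots> = exp (- ?m / ?k + - real (card J * (card J - 1)) / (2 * ?k))"
      by (rule exp_add[symmetric])
    also have "- ?m / ?k + - real (card J * (card J - 1)) / (2 * ?k)
        = - real (card (insert a J) * (card (insert a J) - 1)) / (2 * ?k)"
      using insert.hyps k by (cases "card J") (auto simp: field_simps)
    finally show ?case .
  qed
qed

text \<open>If at most \<open>T\<close> colours are lost to repetitions, some subset of size
  \<open>card K - T\<close> is coloured injectively. A union bound over the complements of size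
  \<open>T\<close> costs \<open>card K ^ T\<close>. Later \<open>T\<close> is the number of
  exceptional vertices.\<close>

lemma prob_first_cands_image_large_le:
  assumes fin_Psi: "finite \<Psi>" and ne_Psi: "\<Psi> \<noteq> {}" and "finite V" "K \<subseteq> V" "T \<le> card K"
  shows "measure_pmf.prob (first_cands V \<Psi>) {f. card K \<le> card (f ` K) + T}
    \<le> real (card K) ^ T * exp (- real ((card K - T) * (card K - T - 1)) / (2 * real (card \<Psi>)))"
proof -
  let ?P = "measure_pmf.prob (first_cands V \<Psi>)" and ?m = "card K - T"
  let ?J = "{J. J \<subseteq> K \<and> card J = ?m}"
  have finK: "finite K" using assms(3,4) by (rule finite_subset[rotated])
  have "?P {f. card K \<le> card (f ` K) + T} \<le> ?P (\<Union>J\<in>?J. {f. inj_on f J})"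
  proof (intro measure_pmf.finite_measure_mono subsetI)
    fix f :: "'b \<Rightarrow> 'a option" assume "f \<in> {f. card K \<le> card (f ` K) + T}"
    then have "?m \<le> card (f ` K)" by auto
    then obtain Y where Y: "Y \<subseteq> f ` K" "card Y = ?m" "finite Y"
      by (rule obtain_subset_with_card_n)
    obtain J where J: "J \<subseteq> K" "inj_on f J" "Y = f ` J" using Y(1) by (auto simp: subset_image_inj)
    then have "card J = ?m" using Y(2) by (simp add: card_image)
    then show "f \<in> (\<Union>J\<in>?J. {f. inj_on f J})" using J by auto
  qed auto
  also have "\<dots> \<le> (\<Sum>J\<in>?J. ?P {f. inj_on f J})"
    using finK by (intro measure_pmf.finite_measure_subadditive_finite) auto
  also have "\<dots> \<le> (\<Sum>J\<in>?J. exp (- real (?m * (?m - 1)) / (2 * real (card \<Psi>))))"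
  proof (rule sum_mono)
    fix J assume "J \<in> ?J"
    then have "J \<subseteq> V" "card J = ?m" using assms(4) by auto
    then show "?P {f. inj_on f J} \<le> exp (- real (?m * (?m - 1)) / (2 * real (card \<Psi>)))"
      using prob_first_cands_inj_on_le[OF fin_Psi ne_Psi assms(3), of J] by simp
  qed
  also have "\<dots> = real (card K choose ?m) * exp (- real (?m * (?m - 1)) / (2 * real (card \<Psi>)))"
    using n_subsets[OF finK, of ?m] by simp
  also have "card K choose ?m = card K choose T" using assms(5) by (simp add: binomial_symmetric[symmetric])
  also have "real (card K choose T) * exp (- real (?m * (?m - 1)) / (2 * real (card \<Psi>)))
      \<le> real (card K) ^ T * exp (- real (?m * (?m - 1)) / (2 * real (card \<Psi>)))"
    using binomial_le_pow[OF assms(5)]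
    by (intro mult_right_mono) (simp_all add: of_nat_power[symmetric] del: of_nat_power)
  finally show ?thesis .
qed

text \<open>The colours outside \<open>W\<close> are revealed first. They block some of the vertices of \<open>W\<close>, and
  the number of unblocked ones is controlled by an exponential moment at the scale \<open>M\<close>.\<close>

lemma prob_no_adoption_le:
  fixes d M :: real
  assumes fin_Psi: "finite \<Psi>" and ne_Psi: "\<Psi> \<noteq> {}" and fin: "finite (verts G)"
    and W: "W \<subseteq> verts G" and indep: "\<And>w w'. w \<in> W \<Longrightarrow> w' \<in> W \<Longrightarrow> w' \<notin> neighbours G w"
    and disj: "W \<inter> S = {}" and x: "x \<in> \<Psi>"
    and few: "\<And>w. w \<in> W \<Longrightarrow> real (card (neighbours G w - S)) \<le> d"
    and spread: "\<And>y. y \<in> verts G - S \<Longrightarrow> real (card (neighbours G y \<inter> W)) \<le> M"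
    and M: "card \<Psi> \<le> M" and d: "4 * d \<le> card \<Psi>"
  shows "measure_pmf.prob (first_cands (verts G) \<Psi>)
      {f. (\<forall>y\<in>S. f y \<noteq> Some x) \<and> (\<forall>w\<in>W. f w = Some x \<longrightarrow> (\<exists>y\<in>neighbours G w. f y = Some x))}
    \<le> exp (- real (card W) / (2 * M))"
proof -
  let ?V = "verts G" and ?N = "neighbours G" and ?k = "real (card \<Psi>)"
  let ?E = "{f. (\<forall>y\<in>S. f y \<noteq> Some x) \<and> (\<forall>w\<in>W. f w = Some x \<longrightarrow> (\<exists>y\<in>?N w. f y = Some x))}"
  define Y where "Y = ?V - W - S"
  define a where "a y = real (card (?N y \<inter> W))" for y
  \<comment> \<open>As \<open>W\<close> is independent and the event keeps \<open>x\<close> away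
    from \<open>S\<close>, a vertex of this set that tries \<open>x\<close> would adopt it.\<close>
  define free where "free g = {w\<in>W. \<forall>y\<in>?N w \<inter> Y. g y \<noteq> Some x}" for g :: "'b \<Rightarrow> 'a option"
  \<comment> \<open>Exponential weight of a vertex \<open>y\<close> that tries \<open>x\<close> and
    thereby blocks at most \<open>a y\<close> vertices of \<open>W\<close>. In this product form the
    expectation factorises over the vertices.\<close>
  let ?h = "\<lambda>y z. if y \<in> Y \<and> z = Some x then exp (a y / M) else 1"
  have k: "?k > 0" using fin_Psi ne_Psi by (simp add: card_gt_0_iff)
  have Mpos: "M > 0" using k M by simp
  have finW: "finite W" using W fin by (rule finite_subset)
  have finY: "finite Y" using fin by (simp add: Y_def)
  have sym: "u \<in> ?N v \<longleftrightarrow> v \<in> ?N u" if "u \<in> ?V" "v \<in> ?V" for u v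
    using that by (auto simp: neighbours_def insert_commute)
  have free_card: "real (card W) - (\<Sum>y\<in>Y. if g y = Some x then a y else 0) \<le> card (free g)" for g
  proof -
    have "W - free g \<subseteq> (\<Union>y\<in>{y\<in>Y. g y = Some x}. ?N y \<inter> W)"
    proof
      fix w assume "w \<in> W - free g"
      then obtain y where "w \<in> W" "y \<in> ?N w" "y \<in> Y" "g y = Some x" by (auto simp: free_def)
      then show "w \<in> (\<Union>y\<in>{y\<in>Y. g y = Some x}. ?N y \<inter> W)"
        using sym[of y w] W by (auto simp: Y_def)
    qed
    then have "card (W - free g) \<le> (\<Sum>y\<in>{y\<in>Y. g y = Some x}. card (?N y \<inter> W))"
      using finY finW by (intro order.trans[OF card_mono card_UN_le]) auto
    then have "real (card (W - free g)) \<le> (\<Sum>y\<in>{y\<in>Y. g y = Some x}. a y)"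
      unfolding a_def by (simp flip: of_nat_sum)
    also have "\<dots> = (\<Sum>y\<in>Y. if g y = Some x then a y else 0)"
      using finY by (simp add: sum.If_cases Int_def)
    also have "card (W - free g) = card W - card (free g)"
      using finW by (intro card_Diff_subset) (auto simp: free_def intro: finite_subset)
    finally show ?thesis by linarith
  qed
  have inner: "measure_pmf.prob (first_cands W \<Psi>) {f. (\<lambda>v. if v \<in> W then f v else g v) \<in> ?E}
      \<le> exp (- real (card W) / M) * (\<Prod>y\<in>?V - W. ?h y (g y))" for g
  proof -
    have "measure_pmf.prob (first_cands W \<Psi>) {f. (\<lambda>v. if v \<in> W then f v else g v) \<in> ?E}
        \<le> measure_pmf.prob (first_cands W \<Psi>) {f. \<forall>w\<in>free g. f w \<noteq> Some x}"
    proof (intro measure_pmf.finite_measure_mono subsetI CollectI ballI notI)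
      fix f w assume f: "f \<in> {f. (\<lambda>v. if v \<in> W then f v else g v) \<in> ?E}" and w: "w \<in> free g" "f w = Some x"
      have wW: "w \<in> W" using w by (auto simp: free_def)
      obtain y where y: "y \<in> ?N w" "(if y \<in> W then f y else g y) = Some x"
        using f wW w(2) by auto
      have "y \<notin> W" using indep wW y(1) by blast
      moreover have "y \<notin> S" using f y(2) by auto
      moreover have "y \<in> ?V" using y(1) by (auto simp: neighbours_def)
      ultimately show False using w y by (auto simp: free_def Y_def)
    qed auto
    also have "\<dots> = (1 - 1 / ?k) ^ card (free g)"
      using x finW by (intro prob_first_cands_avoid_one[OF fin_Psi ne_Psi]) (auto simp: free_def)
    \<comment> \<open>The true rate \<open>1 / ?k\<close> is weakened to \<open>1 / M\<close>, so
      that the exponents \<open>a y / M\<close> are at most 1 and the exponential can be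
      linearised.\<close>
    also have "\<dots> \<le> exp (- 1 / M) ^ card (free g)"
    proof (rule power_mono)
      have "1 - 1 / ?k \<le> 1 - 1 / M" using k M by (simp add: frac_le)
      also have "\<dots> \<le> exp (- 1 / M)" using exp_ge_add_one_self[of "- 1 / M"] by simp
      finally show "1 - 1 / ?k \<le> exp (- 1 / M)" .
    qed (use k in simp)
    also have "\<dots> = exp (- (real (card (free g)) / M))"
      by (simp add: exp_of_nat_mult[symmetric])
    also have "\<dots> \<le> exp (- ((card W - (\<Sum>y\<in>Y. if g y = Some x then a y else 0)) / M))"
      using free_card[of g] Mpos by (simp add: divide_right_mono)
    also have "\<dots> = exp (- real (card W) / M) * exp (\<Sum>y\<in>Y. (if g y = Some x then a y else 0) / M)"
      by (simp add: exp_add[symmetric] sum_divide_distrib diff_divide_distrib)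
    also have "exp (\<Sum>y\<in>Y. (if g y = Some x then a y else 0) / M) = (\<Prod>y\<in>Y. ?h y (g y))"
      using finY by (subst exp_sum) (auto intro!: prod.cong)
    also have "\<dots> = (\<Prod>y\<in>?V - W. ?h y (g y))"
      using fin by (intro prod.mono_neutral_left) (auto simp: Y_def)
    finally show ?thesis .
  qed
  have h_bound: "\<bar>?h y z\<bar> \<le> exp (a y / M)" for y z by (auto simp: a_def Mpos less_imp_le)
  have h_int: "integrable (measure_pmf p) (?h y)" for p y
    using h_bound by (intro measure_pmf.integrable_const_bound[where B = "exp (a y / M)"]) auto
  have Eh: "measure_pmf.expectation (map_pmf Some (pmf_of_set \<Psi>)) (?h y)
      \<le> exp (if y \<in> Y then 2 * a y / (M * ?k) else 0)" for y
  proof (cases "y \<in> Y")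
    case True
    let ?z = "a y / M"
    have "a y \<le> M" using spread[of y] True by (auto simp: a_def Y_def)
    then have z: "0 \<le> ?z" "?z \<le> 1" using Mpos by (auto simp: a_def)
    have "exp ?z - 1 \<le> 2 * ?z"
      using exp_bound[OF z] z mult_left_le[of ?z ?z] by (simp add: power2_eq_square)
    have "measure_pmf.expectation (map_pmf Some (pmf_of_set \<Psi>)) (?h y)
        = measure_pmf.expectation (pmf_of_set \<Psi>) (\<lambda>z. 1 + (exp ?z - 1) * indicator {x} z)"
      using True by (auto intro!: Bochner_Integration.integral_cong simp: indicator_def)
    also have "\<dots> = 1 + (exp ?z - 1) * (1 / ?k)"
    proof -
      have "integrable (measure_pmf (pmf_of_set \<Psi>)) (\<lambda>z. indicator {x} z :: real)"
        by (intro measure_pmf.integrable_const_bound[where B = 1]) auto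
      then show ?thesis using fin_Psi ne_Psi x by (simp add: measure_pmf_of_set)
    qed
    also have "\<dots> \<le> 1 + 2 * ?z * (1 / ?k)"
      using \<open>exp ?z - 1 \<le> 2 * ?z\<close> k by (intro add_left_mono mult_right_mono) auto
    also have "\<dots> \<le> exp (2 * ?z * (1 / ?k))" by (rule exp_ge_add_one_self)
    finally show ?thesis using True by simp
  qed simp
  \<comment> \<open>Double counting of the edges between \<open>Y\<close> and
    \<open>W\<close>.\<close>
  have sum_a: "(\<Sum>y\<in>Y. a y) \<le> card W * d"
  proof -
    have "(\<Sum>y\<in>Y. card (?N y \<inter> W)) = (\<Sum>w\<in>W. card {y\<in>Y. w \<in> ?N y})"
      using finY finW by (subst sum_multicount_gen[of W Y "\<lambda>w y. w \<in> ?N y", symmetric])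
        (auto simp: Int_def conj_commute)
    also have "\<dots> \<le> (\<Sum>w\<in>W. card (?N w - S))"
    proof (intro sum_mono card_mono)
      fix w assume w: "w \<in> W"
      show "finite (?N w - S)" using fin by (auto simp: neighbours_def)
      show "{y \<in> Y. w \<in> ?N y} \<subseteq> ?N w - S" using sym[of w] w W by (auto simp: Y_def)
    qed
    finally have "(\<Sum>y\<in>Y. a y) \<le> (\<Sum>w\<in>W. real (card (?N w - S)))"
      unfolding a_def by (simp flip: of_nat_sum)
    also have "\<dots> \<le> (\<Sum>w\<in>W. d)" by (intro sum_mono few)
    finally show ?thesis by simp
  qed
  have "measure_pmf.prob (first_cands ?V \<Psi>) ?E
      \<le> measure_pmf.expectation (first_cands (?V - W) \<Psi>) (\<lambda>g. exp (- real (card W) / M) * (\<Prod>y\<in>?V - W. ?h y (g y)))"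
    unfolding prob_first_cands_split[OF fin_Psi ne_Psi fin W]
  proof (rule integral_mono[OF _ _ inner])
    show "integrable (first_cands (?V - W) \<Psi>) (\<lambda>g. exp (- real (card W) / M) * (\<Prod>y\<in>?V - W. ?h y (g y)))"
      unfolding first_cands_def using fin
      by (intro integrable_mult_right integrable_prod_Pi_pmf h_int) auto
  qed (auto intro!: measure_pmf.integrable_const_bound[where B = 1])
  also have "\<dots> = exp (- real (card W) / M) *
      (\<Prod>y\<in>?V - W. measure_pmf.expectation (map_pmf Some (pmf_of_set \<Psi>)) (?h y))"
    unfolding integral_mult_right_zero first_cands_def
    using fin h_int by (subst expectation_prod_Pi_pmf[where f = ?h]) simp_all
  also have "\<dots> \<le> exp (- real (card W) / M) * (\<Prod>y\<in>?V - W. exp (if y \<in> Y then 2 * a y / (M * ?k) else 0))"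
    by (intro mult_left_mono prod_mono conjI Eh integral_nonneg_AE) auto
  also have "(\<Prod>y\<in>?V - W. exp (if y \<in> Y then 2 * a y / (M * ?k) else 0)) = exp (\<Sum>y\<in>Y. 2 * a y / (M * ?k))"
  proof -
    have "Y \<subseteq> ?V - W" by (auto simp: Y_def)
    then show ?thesis
      using fin by (subst exp_sum[symmetric]) (auto simp: sum.If_cases Int_absorb1)
  qed
  also have "(\<Sum>y\<in>Y. 2 * a y / (M * ?k)) = 2 * (\<Sum>y\<in>Y. a y) / (M * ?k)"
    by (simp add: sum_divide_distrib sum_distrib_left)
  \<comment> \<open>The hypothesis \<open>4 * d \<le> card \<Psi>\<close> ensures that blocking
    consumes at most half of the exponent \<open>card W / M\<close>.\<close>
  also have "exp (- real (card W) / M) * exp (2 * (\<Sum>y\<in>Y. a y) / (M * ?k)) \<le> exp (- real (card W) / (2 * M))"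
  proof -
    have "2 * (\<Sum>y\<in>Y. a y) / (M * ?k) \<le> 2 * (card W * d) / (M * ?k)"
      using sum_a Mpos k by (intro divide_right_mono) auto
    also have "\<dots> \<le> (card W / (2 * M))"
      using mult_left_mono[OF d, of "real (card W)"] Mpos k by (simp add: field_simps)
    finally have "2 * (\<Sum>y\<in>Y. a y) / (M * ?k) \<le> card W / (2 * M)" .
    moreover have "- real (card W) / M + card W / (2 * M) = - real (card W) / (2 * M)"
      using Mpos by (simp add: field_simps)
    ultimately have "- real (card W) / M + 2 * (\<Sum>y\<in>Y. a y) / (M * ?k) \<le> - real (card W) / (2 * M)"
      by linarith
    then show ?thesis by (simp add: exp_add[symmetric])
  qed
  finally show ?thesis .
qed


lemma palette_rct_round_subset:
  assumes "y \<in> set_pmf (rct_round G \<Psi> c)" "finite (verts G)"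
  shows "palette G \<Psi> y v \<subseteq> palette G \<Psi> c v"
proof -
  obtain f where f: "f \<in> set_pmf (Pi_pmf (verts G) None (candidate G \<Psi> c))" "y = adopt G c f"
    using assms(1) by (auto simp: rct_round_def)
  have "c u = Some x \<Longrightarrow> y u = Some x" if "u \<in> verts G" for u x
  proof -
    assume cu: "c u = Some x"
    have "f u \<in> set_pmf (candidate G \<Psi> c u)"
      using f(1) that assms(2) by (auto simp: set_Pi_pmf PiE_dflt_def)
    then have "f u = None" using cu by (simp add: candidate_def)
    then show ?thesis using f(2) cu by (simp add: adopt_def)
  qed
  then show ?thesis by (fastforce simp: palette_def neighbours_def)
qed

text \<open>After an adoption no neighbour holds the same colour: not from before, since the colour
  was in the palette, and not from this round, since no neighbour tried it.\<close>

lemma rct_round_cases: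
  assumes "y \<in> set_pmf (rct_round G \<Psi> c)" "finite (verts G)" "finite \<Psi>" "v \<in> verts G"
  obtains "y v = c v"
  | x where "c v = None" "y v = Some x" "x \<in> palette G \<Psi> c v" "\<And>u. u \<in> neighbours G v \<Longrightarrow> y u \<noteq> Some x"
proof -
  obtain f where f: "f \<in> set_pmf (Pi_pmf (verts G) None (candidate G \<Psi> c))" "y = adopt G c f"
    using assms(1) by (auto simp: rct_round_def)
  have fv: "f v \<in> set_pmf (candidate G \<Psi> c v)"
    using f(1) assms(2,4) by (auto simp: set_Pi_pmf PiE_dflt_def)
  show ?thesis
  proof (cases "f v \<noteq> None \<and> (\<forall>u\<in>neighbours G v. f u \<noteq> f v)")
    case False
    then have "y v = c v" unfolding f(2) adopt_def by (simp only: if_False)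
    then show ?thesis by (rule that(1))
  next
    case True
    then obtain x where x: "f v = Some x" by auto
    have "finite (palette G \<Psi> c v)" using assms(3) by (auto simp: palette_def)
    then have c: "c v = None" "x \<in> palette G \<Psi> c v"
      using fv x by (auto simp: candidate_def split: if_splits)
    have "y u \<noteq> Some x" if "u \<in> neighbours G v" for u
      using True x c(2) that f(2) by (auto simp: adopt_def palette_def)
    then show ?thesis using that(2)[of x] True x c f(2) by (auto simp: adopt_def)
  qed
qed

text \<open>The absorbing invariant of part 2. Each vertex of \<open>K\<close> is confined to
  \<open>S\<close>, either by its colour or by its remaining palette; the second clause says that
  the colouring is proper inside \<open>K\<close>, as the pigeonhole argument on the clique
  requires.\<close>

definition short_of_colours ::
  "'v ugraph \<Rightarrow> 'c set \<Rightarrow> 'v set \<Rightarrow> 'c set \<Rightarrow> ('v \<Rightarrow> 'c option) \<Rightarrow> bool" where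
  "short_of_colours G \<Psi> K S c \<longleftrightarrow>
     (\<forall>v\<in>K. (case c v of None \<Rightarrow> palette G \<Psi> c v \<subseteq> S | Some x \<Rightarrow> x \<in> S) \<and>
       (\<forall>x. c v = Some x \<longrightarrow> (\<forall>u\<in>neighbours G v \<inter> K. c u \<noteq> Some x)))"

lemma short_of_colours_round:
  assumes c: "short_of_colours G \<Psi> K S c" and y: "y \<in> set_pmf (rct_round G \<Psi> c)"
    and fin: "finite (verts G)" "finite \<Psi>" and K: "K \<subseteq> verts G"
  shows "short_of_colours G \<Psi> K S y"
  unfolding short_of_colours_def
proof (intro ballI conjI allI impI)
  fix v assume v: "v \<in> K"
  then have vV: "v \<in> verts G" using K by auto
  have inv: "case c v of None \<Rightarrow> palette G \<Psi> c v \<subseteq> S | Some x \<Rightarrow> x \<in> S"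
    using c v by (auto simp: short_of_colours_def)
  have pal: "palette G \<Psi> y v \<subseteq> palette G \<Psi> c v"
    using y fin(1) by (rule palette_rct_round_subset)
  show "case y v of None \<Rightarrow> palette G \<Psi> y v \<subseteq> S | Some x \<Rightarrow> x \<in> S"
    using y fin vV by (rule rct_round_cases) (use inv pal in \<open>auto split: option.splits\<close>)
  fix x u assume yv: "y v = Some x" and u: "u \<in> neighbours G v \<inter> K"
  have uV: "u \<in> verts G" using u K by auto
  have vu: "v \<in> neighbours G u" using u vV by (auto simp: neighbours_def insert_commute)
  show "y u \<noteq> Some x"
    using y fin vV
  proof (rule rct_round_cases)
    assume eq: "y v = c v"
    show "y u \<noteq> Some x"
      using y fin uV
    proof (rule rct_round_cases)
      assume "y u = c u"
      then show ?thesis using c v u yv eq by (auto simp: short_of_colours_def)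
    next
      fix z assume "y u = Some z" "\<And>w. w \<in> neighbours G u \<Longrightarrow> y w \<noteq> Some z"
      then show ?thesis using vu yv by auto
    qed
  qed (use yv u in auto)
qed

lemma short_of_colours_not_all_coloured:
  assumes c: "short_of_colours G \<Psi> K S c" and K: "K \<subseteq> verts G"
    and clique: "\<And>u v. u \<in> K \<Longrightarrow> v \<in> K \<Longrightarrow> u \<noteq> v \<Longrightarrow> u \<in> neighbours G v"
    and S: "finite S" "card S < card K"
  shows "\<not> all_coloured G c"
proof
  assume all: "all_coloured G c"
  have col: "c v \<noteq> None" if "v \<in> K" for v using all that K by (auto simp: all_coloured_def)
  have "(\<lambda>v. the (c v)) ` K \<subseteq> S"
  proof clarify
    fix v assume v: "v \<in> K"
    obtain x where x: "c v = Some x" using col[OF v] by auto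
    have "case c v of None \<Rightarrow> palette G \<Psi> c v \<subseteq> S | Some x \<Rightarrow> x \<in> S"
      using c v unfolding short_of_colours_def by blast
    then show "the (c v) \<in> S" by (simp add: x)
  qed
  moreover have "inj_on (\<lambda>v. the (c v)) K"
  proof (rule inj_onI, rule ccontr)
    fix u v assume uv: "u \<in> K" "v \<in> K" "the (c u) = the (c v)" "u \<noteq> v"
    have "c u = c v" using uv col by (metis option.expand)
    moreover obtain x where "c v = Some x" using col uv(2) by auto
    moreover have "\<forall>x. c v = Some x \<longrightarrow> (\<forall>u\<in>neighbours G v \<inter> K. c u \<noteq> Some x)"
      using c uv(2) unfolding short_of_colours_def by blast
    ultimately show False using uv(1) clique[OF uv(1,2,4)] by simp
  qed
  ultimately have "card K \<le> card S" using S(1) by (intro card_inj_on_le[of "\<lambda>v. the (c v)"]) auto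
  then show False using S(2) by simp
qed

text \<open>After round one the vertices of \<open>K\<close> are confined to colours tried by
  \<open>K\<close> or by the exceptional set \<open>B\<close>, since any other colour is adopted
  inside each \<open>W v\<close>. If \<open>K\<close> produced more than \<open>card B\<close>
  repetitions, fewer than \<open>card K\<close> colours remain. The two error terms are the birthday
  bound and a union over all vertices of \<open>K\<close> and all colours.\<close>

theorem rct_never_terminates:
  fixes d M w :: real
  assumes fin: "finite (verts G)" and fin_Psi: "finite \<Psi>" and ne_Psi: "\<Psi> \<noteq> {}"
    and K: "K \<subseteq> verts G" "K \<noteq> {}" and B: "B \<subseteq> verts G" "card B \<le> card K"
    and clique: "\<And>u v. u \<in> K \<Longrightarrow> v \<in> K \<Longrightarrow> u \<noteq> v \<Longrightarrow> u \<in> neighbours G v"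
    and W: "\<And>v. v \<in> K \<Longrightarrow> W v \<subseteq> neighbours G v" "\<And>v. v \<in> K \<Longrightarrow> W v \<inter> (K \<union> B) = {}"
    and indep: "\<And>v u u'. v \<in> K \<Longrightarrow> u \<in> W v \<Longrightarrow> u' \<in> W v \<Longrightarrow> u' \<notin> neighbours G u"
    and few: "\<And>v u. v \<in> K \<Longrightarrow> u \<in> W v \<Longrightarrow> real (card (neighbours G u - (K \<union> B))) \<le> d"
    and spread: "\<And>v y. v \<in> K \<Longrightarrow> y \<in> verts G - (K \<union> B) \<Longrightarrow> real (card (neighbours G y \<inter> W v)) \<le> M"
    and card_W: "\<And>v. v \<in> K \<Longrightarrow> w \<le> card (W v)"
    and M: "card \<Psi> \<le> M" and d: "4 * d \<le> card \<Psi>"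
  shows "rct_prob G \<Psi> (never_terminates G) \<ge> 1
    - real (card K) ^ card B * exp (- real ((card K - card B) * (card K - card B - 1)) / (2 * real (card \<Psi>)))
    - real (card K) * real (card \<Psi>) * exp (- w / (2 * M))"
proof -
  let ?V = "verts G" and ?N = "neighbours G"
  let ?Q = "first_cands ?V \<Psi>" and ?s = "adopt G (\<lambda>_. None) :: _ \<Rightarrow> _ \<Rightarrow> 'b option"
  \<comment> \<open>This plays the role of \<open>S\<close> in the invariant.\<close>
  define col where "col f = {x\<in>\<Psi>. Some x \<in> f ` (K \<union> B)}" for f :: "'a \<Rightarrow> 'b option"
  define bad1 where "bad1 = {f :: 'a \<Rightarrow> 'b option. card K \<le> card (f ` K) + card B}"
  \<comment> \<open>Neither \<open>K\<close> nor \<open>B\<close> tries \<open>x\<close>, yet no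
    vertex of \<open>W v\<close> adopts it, so \<open>x\<close> may survive in the palette of
    \<open>v\<close>.\<close>
  define bad2 where "bad2 v x = {f. (\<forall>y\<in>K \<union> B. f y \<noteq> Some x) \<and>
      (\<forall>w\<in>W v. f w = Some x \<longrightarrow> (\<exists>y\<in>?N w. f y = Some x))}" for v and x :: 'b
  define good where "good c \<longleftrightarrow> (\<exists>S. finite S \<and> card S < card K \<and> short_of_colours G \<Psi> K S c)" for c
  have finK: "finite K" and finB: "finite B" using fin K B by (auto intro: finite_subset)
  have Mpos: "M > 0" using M fin_Psi ne_Psi by (metis card_gt_0_iff of_nat_0_less_iff order_less_le_trans)
  have good_first: "good (?s f)"
    if f: "f \<in> set_pmf ?Q" and nb1: "f \<notin> bad1" and nb2: "\<And>v x. v \<in> K \<Longrightarrow> x \<in> \<Psi> \<Longrightarrow> f \<notin> bad2 v x" for f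
    unfolding good_def
  proof (intro exI conjI)
    show "finite (col f)" using fin_Psi by (simp add: col_def)
    have "card (col f) = card (Some ` col f)" by (simp add: card_image)
    also have "\<dots> \<le> card (f ` K \<union> f ` B)" using finK finB by (intro card_mono) (auto simp: col_def)
    also have "\<dots> \<le> card (f ` K) + card B"
      using card_Un_le[of "f ` K" "f ` B"] card_image_le[OF finB, of f] by linarith
    also have "\<dots> < card K" using nb1 by (simp add: bad1_def)
    finally show "card (col f) < card K" .
    have fPsi: "f v \<in> Some ` \<Psi>" if "v \<in> ?V" for v
      using set_pmf_first_cands(1)[OF fin_Psi ne_Psi fin f that] .
    show "short_of_colours G \<Psi> K (col f) (?s f)"
      unfolding short_of_colours_def
    proof (intro ballI conjI allI impI)
      fix v assume v: "v \<in> K"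
      show "case ?s f v of None \<Rightarrow> palette G \<Psi> (?s f) v \<subseteq> col f | Some x \<Rightarrow> x \<in> col f"
      proof (cases "?s f v")
        case None
        have "x \<in> col f" if x: "x \<in> palette G \<Psi> (?s f) v" for x
        proof (rule ccontr)
          assume nx: "x \<notin> col f"
          have xP: "x \<in> \<Psi>" using x by (auto simp: palette_def)
          have "f \<notin> bad2 v x" using nb2 v xP by blast
          moreover have "\<forall>y\<in>K \<union> B. f y \<noteq> Some x" using nx xP by (force simp: col_def image_iff)
          ultimately obtain u where u: "u \<in> W v" "f u = Some x" "\<forall>y\<in>?N u. f y \<noteq> Some x"
            by (auto simp: bad2_def)
          then have "?s f u = Some x" by (simp add: adopt_def)
          then show False using x u(1) W(1)[OF v] by (auto simp: palette_def)
        qed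
        then show ?thesis using None by auto
      next
        case (Some x)
        then have "f v = Some x" by (auto simp: adopt_def split: if_splits)
        then show ?thesis using Some fPsi[of v] v K(1) by (auto simp: col_def image_iff intro!: bexI[of _ v])
      qed
      fix x u assume "?s f v = Some x" "u \<in> ?N v \<inter> K"
      then show "?s f u \<noteq> Some x" by (auto simp: adopt_def split: if_splits)
    qed
  qed
  have bad2: "measure_pmf.prob ?Q (bad2 v x) \<le> exp (- w / (2 * M))" if "v \<in> K" "x \<in> \<Psi>" for v x
  proof -
    have "measure_pmf.prob ?Q (bad2 v x) \<le> exp (- real (card (W v)) / (2 * M))"
      unfolding bad2_def
      using that W(1)[OF that(1)]
      by (intro prob_no_adoption_le[OF fin_Psi ne_Psi fin _ indep W(2) _ few spread M d])
         (auto simp: neighbours_def)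
    also have "\<dots> \<le> exp (- w / (2 * M))"
      using card_W[OF that(1)] Mpos by (simp add: divide_right_mono)
    finally show ?thesis .
  qed
  let ?U = "\<Union>v\<in>K. \<Union>x\<in>\<Psi>. bad2 v x"
  have "measure_pmf.prob ?Q ?U \<le> (\<Sum>v\<in>K. measure_pmf.prob ?Q (\<Union>x\<in>\<Psi>. bad2 v x))"
    using finK by (intro measure_pmf.finite_measure_subadditive_finite) auto
  also have "\<dots> \<le> (\<Sum>v\<in>K. \<Sum>x\<in>\<Psi>. measure_pmf.prob ?Q (bad2 v x))"
    using fin_Psi by (intro sum_mono measure_pmf.finite_measure_subadditive_finite) auto
  also have "\<dots> \<le> (\<Sum>v\<in>K. \<Sum>x\<in>\<Psi>. exp (- w / (2 * M)))"
    by (intro sum_mono bad2)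
  finally have U: "measure_pmf.prob ?Q ?U \<le> real (card K) * real (card \<Psi>) * exp (- w / (2 * M))"
    by (simp add: mult.assoc)
  have bad1: "measure_pmf.prob ?Q bad1 \<le>
    real (card K) ^ card B * exp (- real ((card K - card B) * (card K - card B - 1)) / (2 * real (card \<Psi>)))"
    unfolding bad1_def by (rule prob_first_cands_image_large_le[OF fin_Psi ne_Psi fin K(1) B(2)])
  have "1 = measure_pmf.prob ?Q UNIV" by simp
  also have "\<dots> \<le> measure_pmf.prob ?Q ({f. good (?s f)} \<union> (bad1 \<union> ?U))"
    by (intro measure_pmf.finite_measure_mono_AE) (auto simp: AE_measure_pmf_iff intro: good_first)
  also have "\<dots> \<le> measure_pmf.prob ?Q {f. good (?s f)} + (measure_pmf.prob ?Q bad1 + measure_pmf.prob ?Q ?U)"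
    by (intro order.trans[OF measure_Un_le] add_left_mono measure_Un_le) auto
  also have "measure_pmf.prob ?Q {f. good (?s f)} = measure_pmf.prob (rct_round G \<Psi> (\<lambda>_. None)) {x. good x}"
    by (simp add: rct_round_empty[OF fin_Psi ne_Psi] vimage_def)
  also have "\<dots> \<le> rct_prob G \<Psi> (never_terminates G)"
  proof (rule rct_prob_never_terminates_ge[OF fin fin_Psi])
    show "?V \<noteq> {}" using K by auto
    show "good y" if "good x" "y \<in> set_pmf (rct_round G \<Psi> x)" for x y
      using that short_of_colours_round[OF _ that(2) fin fin_Psi K(1)] unfolding good_def by blast
    show "\<not> all_coloured G x" if "good x" for x
      using that short_of_colours_not_all_coloured[OF _ K(1) clique] unfolding good_def by blast
  qed
  finally show ?thesis using U bad1 by linarith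
qed

subsection \<open>Tails of the counts of a Poisson process\<close>

lemma (in prob_space) prob_many_events_le:
  fixes t :: real
  assumes "finite I" "\<And>i. i \<in> I \<Longrightarrow> E i \<in> events" "t > 0"
  shows "prob {\<omega>\<in>space M. t \<le> real (card {i\<in>I. \<omega> \<in> E i})} \<le> (\<Sum>i\<in>I. prob (E i)) / t"
proof -
  have eq: "real (card {i\<in>I. \<omega> \<in> E i}) = (\<Sum>i\<in>I. indicator (E i) \<omega>)" for \<omega>
    using assms(1) by (simp add: indicator_def sum.If_cases Int_def)
  have int: "integrable M (\<lambda>\<omega>. \<Sum>i\<in>I. indicator (E i) \<omega> :: real)"
    using assms by (intro Bochner_Integration.integrable_sum integrable_real_indicator) (auto simp: emeasure_eq_measure)
  have "prob {\<omega>\<in>space M. t \<le> (\<Sum>i\<in>I. indicator (E i) \<omega>)} \<le> (\<integral>\<omega>. (\<Sum>i\<in>I. indicator (E i) \<omega>) \<partial>M) / t"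
    using assms by (intro integral_Markov_inequality_measure[OF int, where A = "{}"]) (auto intro!: sum_nonneg)
  also have "(\<integral>\<omega>. (\<Sum>i\<in>I. indicator (E i) \<omega>) \<partial>M) = (\<Sum>i\<in>I. prob (E i))"
    using assms by (subst Bochner_Integration.integral_sum) (auto simp: emeasure_eq_measure)
  finally show ?thesis unfolding eq .
qed

context
  fixes \<mu> :: "'a measure"
  assumes fin_mu: "finite_measure \<mu>" and pos_mu: "measure \<mu> (space \<mu>) > 0"
begin

interpretation P: prob_space "poisson_process \<mu>"
  using fin_mu pos_mu by (rule prob_space_poisson_process)

lemma sets_points_in: "B \<in> sets \<mu> \<Longrightarrow> {\<omega>\<in>space (poisson_process \<mu>). points_in B \<omega> \<in> S} \<in> P.events"
  by measurable

lemma prob_points_in_eq: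
  assumes "B \<in> sets \<mu>"
  shows "P.prob {\<omega>\<in>space (poisson_process \<mu>). points_in B \<omega> = c}
    = measure \<mu> B ^ c / fact c * exp (- measure \<mu> B)"
  using poisson_process_counts[OF fin_mu pos_mu, of "{()}" "\<lambda>_. B" "\<lambda>_. c"] assms
  by (simp add: disjoint_family_on_def)

text \<open>Chernoff's bound through the Poisson generating function. The sign of \<theta> is free,
  so that one statement yields both the upper and the lower tail.\<close>

lemma prob_points_in_exponential_tail:
  fixes \<theta> t :: real
  assumes B: "B \<in> sets \<mu>" and S: "\<And>c. c \<in> S \<Longrightarrow> t \<le> \<theta> * real c"
  shows "P.prob {\<omega>\<in>space (poisson_process \<mu>). points_in B \<omega> \<in> S}
    \<le> exp (measure \<mu> B * (exp \<theta> - 1) - t)"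
proof -
  let ?l = "measure \<mu> B"
  let ?A = "\<lambda>c. {\<omega>\<in>space (poisson_process \<mu>). points_in B \<omega> = c \<and> c \<in> S}"
  have "?A c = {\<omega>\<in>space (poisson_process \<mu>). points_in B \<omega> \<in> {c} \<inter> S}" for c by auto
  then have "?A c \<in> P.events" for c using sets_points_in[OF B, of "{c} \<inter> S"] by (simp only:)
  then have ev: "range ?A \<subseteq> P.events" by blast
  have "(\<lambda>c. P.prob (?A c)) sums P.prob (\<Union>c. ?A c)"
    by (rule P.finite_measure_UNION[OF ev]) (auto simp: disjoint_family_on_def)
  also have "(\<Union>c. ?A c) = {\<omega>\<in>space (poisson_process \<mu>). points_in B \<omega> \<in> S}" by auto
  finally have 1: "(\<lambda>c. P.prob (?A c)) sums P.prob {\<omega>\<in>space (poisson_process \<mu>). points_in B \<omega> \<in> S}" .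
  have "(\<lambda>c. (?l * exp \<theta>) ^ c / fact c) sums exp (?l * exp \<theta>)"
    using exp_converges[of "?l * exp \<theta>"] by (simp add: field_simps)
  from sums_mult[OF this, of "exp (- t - ?l)"]
  have 2: "(\<lambda>c. exp (- t - ?l) * ((?l * exp \<theta>) ^ c / fact c)) sums (exp (- t - ?l) * exp (?l * exp \<theta>))" .
  have "P.prob (?A c) \<le> exp (- t - ?l) * ((?l * exp \<theta>) ^ c / fact c)" for c
  proof (cases "c \<in> S")
    case True
    have "P.prob (?A c) = ?l ^ c / fact c * exp (- ?l) * 1"
      using True prob_points_in_eq[OF B, of c] by simp
    also have "\<dots> \<le> ?l ^ c / fact c * exp (- ?l) * exp (\<theta> * c - t)"
      using S[OF True] by (intro mult_left_mono) auto
    also have "\<dots> = exp (- t - ?l) * ((?l * exp \<theta>) ^ c / fact c)"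
      by (simp add: exp_diff exp_minus power_mult_distrib exp_of_nat2_mult field_simps)
    finally show ?thesis .
  qed simp
  from sums_le[OF this 1 2] show ?thesis
    by (simp add: exp_add[symmetric] algebra_simps)
qed

lemma prob_points_in_ge_le:
  assumes "B \<in> sets \<mu>"
  shows "P.prob {\<omega>\<in>space (poisson_process \<mu>). x \<le> real (points_in B \<omega>)} \<le> exp (2 * measure \<mu> B - x)"
proof -
  have "P.prob {\<omega>\<in>space (poisson_process \<mu>). points_in B \<omega> \<in> {c. x \<le> real c}} \<le> exp (measure \<mu> B * (exp 1 - 1) - x)"
    by (rule prob_points_in_exponential_tail[OF assms]) simp
  also have "\<dots> \<le> exp (2 * measure \<mu> B - x)"
    using exp_le mult_left_mono[of "exp 1 - 1 :: real" 2 "measure \<mu> B"] by simp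
  finally show ?thesis by simp
qed

lemma prob_points_in_le_le:
  assumes "B \<in> sets \<mu>" "l \<le> measure \<mu> B"
  shows "P.prob {\<omega>\<in>space (poisson_process \<mu>). real (points_in B \<omega>) \<le> l / 2} \<le> exp (- l / 10)"
proof -
  have "P.prob {\<omega>\<in>space (poisson_process \<mu>). points_in B \<omega> \<in> {c. real c \<le> l / 2}}
      \<le> exp (measure \<mu> B * (exp (- 1) - 1) - (- l / 2))"
    by (rule prob_points_in_exponential_tail[OF assms(1)]) simp
  also have "\<dots> \<le> exp (- l / 10)"
  proof -
    \<comment> \<open>Taking \<theta> equal to -1, \<open>exp (- 1) \<le> 2 / 5\<close> gives the
      exponent \<open>- 3 / 5 + 1 / 2 = - 1 / 10\<close> times the mass.\<close>
    have "exp (1::real) \<ge> 5 / 2" using exp_lower_Taylor_quadratic[of "1::real"] by simp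
    then have "exp (- 1) \<le> (2 / 5 :: real)" by (simp add: exp_minus field_simps)
    then have "measure \<mu> B * (exp (- 1) - 1) \<le> measure \<mu> B * (- 3 / 5)" by (intro mult_left_mono) auto
    then show ?thesis using assms(2) by simp
  qed
  finally show ?thesis by simp
qed

lemma prob_points_in_pos_le:
  assumes "B \<in> sets \<mu>"
  shows "P.prob {\<omega>\<in>space (poisson_process \<mu>). points_in B \<omega> \<noteq> 0} \<le> measure \<mu> B"
proof -
  have "P.prob {\<omega>\<in>space (poisson_process \<mu>). points_in B \<omega> \<noteq> 0}
      = P.prob (space (poisson_process \<mu>) - {\<omega>\<in>space (poisson_process \<mu>). points_in B \<omega> = 0})"
    by (intro arg_cong[where f = P.prob]) auto
  also have "\<dots> = 1 - exp (- measure \<mu> B)"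
    using sets_points_in[OF assms, of "{0}"] prob_points_in_eq[OF assms, of 0] by (subst P.prob_compl) auto
  also have "\<dots> \<le> measure \<mu> B" using exp_ge_add_one_self[of "- measure \<mu> B"] by simp
  finally show ?thesis .
qed

text \<open>Counts in disjoint sets are independent, and each set is occupied with probability
  \<open>1 - exp (- a) \<le> a\<close>.\<close>

lemma prob_both_occupied_le:
  assumes A: "A \<in> sets \<mu>" and B: "B \<in> sets \<mu>" and disj: "A \<inter> B = {}"
  shows "P.prob {\<omega>\<in>space (poisson_process \<mu>). points_in A \<omega> \<noteq> 0 \<and> points_in B \<omega> \<noteq> 0}
    \<le> measure \<mu> A * measure \<mu> B"
proof -
  let ?S = "space (poisson_process \<mu>)"
  let ?a = "measure \<mu> A" and ?b = "measure \<mu> B"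
  let ?EA = "{\<omega>\<in>?S. points_in A \<omega> = 0}" and ?EB = "{\<omega>\<in>?S. points_in B \<omega> = 0}"
  have ev: "?EA \<in> P.events" "?EB \<in> P.events"
    using sets_points_in[OF A, of "{0}"] sets_points_in[OF B, of "{0}"] by auto
  have "P.prob {\<omega>\<in>?S. \<forall>i\<in>{True, False}. points_in (if i then A else B) \<omega> = 0}
      = (\<Prod>i\<in>{True, False}. measure \<mu> (if i then A else B) ^ 0 / fact 0 * exp (- measure \<mu> (if i then A else B)))"
    by (rule poisson_process_counts[OF fin_mu pos_mu]) (use A B disj in \<open>auto simp: disjoint_family_on_def\<close>)
  moreover have "{\<omega>\<in>?S. \<forall>i\<in>{True, False}. points_in (if i then A else B) \<omega> = 0} = ?EA \<inter> ?EB" by auto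
  ultimately have both: "P.prob (?EA \<inter> ?EB) = exp (- ?a) * exp (- ?b)" by simp
  have "P.prob {\<omega>\<in>?S. points_in A \<omega> \<noteq> 0 \<and> points_in B \<omega> \<noteq> 0} = P.prob (?S - (?EA \<union> ?EB))"
    by (intro arg_cong[where f = P.prob]) auto
  also have "\<dots> = 1 - P.prob (?EA \<union> ?EB)" using ev by (intro P.prob_compl) auto
  also have "P.prob (?EA \<union> ?EB) = P.prob ?EA + P.prob ?EB - P.prob (?EA \<inter> ?EB)"
    using ev by (intro measure_Un3) (auto simp: fmeasurable_def P.emeasure_eq_measure)
  also have "1 - (P.prob ?EA + P.prob ?EB - P.prob (?EA \<inter> ?EB)) = (1 - exp (- ?a)) * (1 - exp (- ?b))"
    using prob_points_in_eq[OF A, of 0] prob_points_in_eq[OF B, of 0] both by (simp add: algebra_simps)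
  also have "\<dots> \<le> ?a * ?b"
    using exp_ge_add_one_self[of "- ?a"] exp_ge_add_one_self[of "- ?b"] by (intro mult_mono) auto
  finally show ?thesis .
qed

text \<open>The threshold \<open>b * (1 + l i)\<close> serves sets of large and of negligible mass
  alike: \<open>b * l i\<close> absorbs twice the mean, and the remaining \<open>b\<close> yields
  the same tail \<open>exp (- b)\<close> for every set.\<close>

lemma prob_some_count_large_le:
  assumes "finite I" "\<And>i. i \<in> I \<Longrightarrow> B i \<in> sets \<mu>" "\<And>i. i \<in> I \<Longrightarrow> measure \<mu> (B i) \<le> l i" "2 \<le> b"
  shows "P.prob {\<omega>\<in>space (poisson_process \<mu>). \<exists>i\<in>I. b * (1 + l i) \<le> real (points_in (B i) \<omega>)} \<le> card I * exp (- b)"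
proof -
  let ?E = "\<lambda>i. {\<omega>\<in>space (poisson_process \<mu>). b * (1 + l i) \<le> real (points_in (B i) \<omega>)}"
  have "{\<omega>\<in>space (poisson_process \<mu>). \<exists>i\<in>I. b * (1 + l i) \<le> real (points_in (B i) \<omega>)} = (\<Union>i\<in>I. ?E i)"
    by auto
  also have "P.prob \<dots> \<le> (\<Sum>i\<in>I. P.prob (?E i))"
    using assms(1) sets_points_in[OF assms(2), of _ "{c. b * (1 + l _) \<le> real c}"]
    by (intro P.finite_measure_subadditive_finite) auto
  also have "\<dots> \<le> (\<Sum>i\<in>I. exp (- b))"
  proof (rule sum_mono)
    fix i assume i: "i \<in> I"
    have "P.prob (?E i) \<le> exp (2 * measure \<mu> (B i) - b * (1 + l i))"
      by (rule prob_points_in_ge_le[OF assms(2)[OF i]])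
    also have "2 * measure \<mu> (B i) \<le> b * l i"
      using assms(3)[OF i] assms(4) by (intro mult_mono) auto
    finally show "P.prob (?E i) \<le> exp (- b)" by (simp add: algebra_simps)
  qed
  finally show ?thesis by simp
qed

lemma prob_some_count_small_le:
  assumes "finite I" "\<And>i. i \<in> I \<Longrightarrow> B i \<in> sets \<mu>" "\<And>i. i \<in> I \<Longrightarrow> l \<le> measure \<mu> (B i)"
  shows "P.prob {\<omega>\<in>space (poisson_process \<mu>). \<exists>i\<in>I. real (points_in (B i) \<omega>) \<le> l / 2} \<le> card I * exp (- l / 10)"
proof -
  let ?E = "\<lambda>i. {\<omega>\<in>space (poisson_process \<mu>). real (points_in (B i) \<omega>) \<le> l / 2}"
  have "{\<omega>\<in>space (poisson_process \<mu>). \<exists>i\<in>I. real (points_in (B i) \<omega>) \<le> l / 2} = (\<Union>i\<in>I. ?E i)"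
    by auto
  also have "P.prob \<dots> \<le> (\<Sum>i\<in>I. P.prob (?E i))"
    using assms(1) sets_points_in[OF assms(2), of _ "{c. real c \<le> l / 2}"]
    by (intro P.finite_measure_subadditive_finite) auto
  also have "\<dots> \<le> (\<Sum>i\<in>I. exp (- l / 10))"
    by (intro sum_mono prob_points_in_le_le assms)
  finally show ?thesis by simp
qed

lemma prob_many_pairs_occupied_le:
  fixes t a b :: real
  assumes "finite I" "\<And>i. i \<in> I \<Longrightarrow> A i \<in> sets \<mu>" "\<And>i. i \<in> I \<Longrightarrow> B i \<in> sets \<mu>"
    "\<And>i. i \<in> I \<Longrightarrow> A i \<inter> B i = {}" "t > 0"
    "\<And>i. i \<in> I \<Longrightarrow> measure \<mu> (A i) \<le> a" "\<And>i. i \<in> I \<Longrightarrow> measure \<mu> (B i) \<le> b"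
  shows "P.prob {\<omega>\<in>space (poisson_process \<mu>).
      t \<le> real (card {i\<in>I. points_in (A i) \<omega> \<noteq> 0 \<and> points_in (B i) \<omega> \<noteq> 0})} \<le> card I * (a * b) / t"
proof -
  let ?S = "space (poisson_process \<mu>)"
  let ?E = "\<lambda>i. {\<omega>\<in>?S. points_in (A i) \<omega> \<noteq> 0 \<and> points_in (B i) \<omega> \<noteq> 0}"
  have "?E i = {\<omega>\<in>?S. points_in (A i) \<omega> \<in> -{0}} \<inter> {\<omega>\<in>?S. points_in (B i) \<omega> \<in> -{0}}" for i by auto
  then have ev: "?E i \<in> P.events" if "i \<in> I" for i
    using sets_points_in[OF assms(2)[OF that], of "-{0}"] sets_points_in[OF assms(3)[OF that], of "-{0}"]
    by (simp only: sets.Int)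
  have "P.prob {\<omega>\<in>?S. t \<le> real (card {i\<in>I. \<omega> \<in> ?E i})} \<le> (\<Sum>i\<in>I. P.prob (?E i)) / t"
    by (rule P.prob_many_events_le[OF assms(1) ev assms(5)])
  also have "\<dots> \<le> (\<Sum>i\<in>I. a * b) / t"
  proof (intro divide_right_mono sum_mono)
    fix i assume i: "i \<in> I"
    have "P.prob (?E i) \<le> measure \<mu> (A i) * measure \<mu> (B i)"
      by (rule prob_both_occupied_le) (use assms i in auto)
    also have "\<dots> \<le> a * b" using assms(6,7)[OF i] by (intro mult_mono) (auto intro: order.trans[OF measure_nonneg])
    finally show "P.prob (?E i) \<le> a * b" .
  qed (use assms in simp)
  also have "{\<omega>\<in>?S. t \<le> real (card {i\<in>I. \<omega> \<in> ?E i})} =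
      {\<omega>\<in>?S. t \<le> real (card {i\<in>I. points_in (A i) \<omega> \<noteq> 0 \<and> points_in (B i) \<omega> \<noteq> 0})}"
    by (intro Collect_cong conj_cong refl) simp
  finally show ?thesis by simp
qed

end

subsection \<open>The intensity measure\<close>

lemma sets_hrg_intensity [simp]: "sets (hrg_intensity \<alpha> C n) = sets borel"
  by (simp add: hrg_intensity_def)

lemma box_borel [measurable]: "{a..b} \<times> {c..<d} \<in> sets (borel :: (real \<times> real) measure)"
  unfolding borel_prod[symmetric] by (intro pair_measureI) auto

context
  fixes \<alpha> C :: real and n :: nat
  assumes alpha: "\<alpha> > 0" and R: "hrg_radius C n > 0" and n: "n > 0"
begin

lemma cosh_minus_1_pos: "cosh (\<alpha> * hrg_radius C n) - 1 > 0"
  using alpha R cosh_real_strict_mono[of 0 "\<alpha> * hrg_radius C n"] by simp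

lemma finite_measure_hrg_intensity: "finite_measure (hrg_intensity \<alpha> C n)"
  by (rule finite_measureI) (simp add: emeasure_hrg_intensity[OF alpha R])

lemma measure_hrg_intensity_pos: "measure (hrg_intensity \<alpha> C n) (space (hrg_intensity \<alpha> C n)) > 0"
  using n by (simp add: measure_def emeasure_hrg_intensity[OF alpha R])

lemma measure_hrg_box:
  fixes a b c d :: real
  assumes r: "0 \<le> a" "a \<le> b" "b \<le> hrg_radius C n" and phi: "0 \<le> c" "c \<le> d" "d \<le> 2 * pi"
  shows "measure (hrg_intensity \<alpha> C n) ({a..b} \<times> {c..<d}) =
    real n * (d - c) / (2 * pi) * ((cosh (\<alpha> * b) - cosh (\<alpha> * a)) / (cosh (\<alpha> * hrg_radius C n) - 1))"
proof -
  let ?R = "hrg_radius C n"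
  let ?D = "cosh (\<alpha> * ?R) - 1"
  let ?f = "\<lambda>r. real n * hrg_density \<alpha> ?R r"
  have D: "?D > 0" by (rule cosh_minus_1_pos)
  have [measurable]: "(sinh :: real \<Rightarrow> real) \<in> borel_measurable borel"
    by (intro borel_measurable_continuous_onI continuous_intros)
  have nn: "0 \<le> ?f r" if "0 \<le> r" for r
    unfolding hrg_density_def using alpha D that by (intro mult_nonneg_nonneg divide_nonneg_nonneg) auto
  have [measurable]: "?f \<in> borel_measurable borel"
    unfolding hrg_density_def by measurable
  have "emeasure (hrg_intensity \<alpha> C n) ({a..b} \<times> {c..<d}) =
    (\<integral>\<^sup>+(r, \<phi>). ennreal (?f r) * indicator ({a..b} \<times> {c..<d}) (r, \<phi>) \<partial>(lborel \<Otimes>\<^sub>M lborel))"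
    unfolding hrg_intensity_def lborel_prod
    using r phi by (subst emeasure_density)
      (auto simp: lborel_prod[symmetric] case_prod_beta intro!: nn_integral_cong split: split_indicator)
  also have "\<dots> = (\<integral>\<^sup>+r. \<integral>\<^sup>+\<phi>. (ennreal (?f r) * indicator {a..b} r) * indicator {c..<d} \<phi> \<partial>lborel \<partial>lborel)"
    by (subst lborel.nn_integral_fst[symmetric])
       (auto intro!: nn_integral_cong simp: case_prod_beta split: split_indicator)
  also have "\<dots> = (\<integral>\<^sup>+r. ennreal (d - c) * (ennreal (?f r) * indicator {a..b} r) \<partial>lborel)"
    using phi by (intro nn_integral_cong, subst nn_integral_cmult_indicator) (auto simp: mult.commute)
  also have "\<dots> = ennreal (d - c) * (\<integral>\<^sup>+r. ennreal (?f r) * indicator {a..b} r \<partial>lborel)"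
    by (rule nn_integral_cmult) measurable
  also have "(\<integral>\<^sup>+r. ennreal (?f r) * indicator {a..b} r \<partial>lborel) =
      ennreal (real n / (2 * pi * ?D) * cosh (\<alpha> * b) - real n / (2 * pi * ?D) * cosh (\<alpha> * a))"
  proof (rule nn_integral_FTC_Icc[where F = "\<lambda>r. real n / (2 * pi * ?D) * cosh (\<alpha> * r)"])
    fix x assume "x \<in> {a..b}"
    show "((\<lambda>r. real n / (2 * pi * ?D) * cosh (\<alpha> * r)) has_real_derivative ?f x) (at x)"
    proof -
      define K where "K = real n / (2 * pi * ?D)"
      have "((\<lambda>r. K * cosh (\<alpha> * r)) has_real_derivative K * (\<alpha> * sinh (\<alpha> * x))) (at x)"
        by (auto intro!: derivative_eq_intros)
      then show ?thesis by (simp add: K_def hrg_density_def mult_ac)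
    qed
  qed (use r nn in auto)
  also have "ennreal (d - c) * \<dots> =
      ennreal (real n * (d - c) / (2 * pi) * ((cosh (\<alpha> * b) - cosh (\<alpha> * a)) / ?D))"
    using phi by (subst ennreal_mult'[symmetric]) (auto simp: diff_divide_distrib[symmetric] algebra_simps)
  finally have *: "emeasure (hrg_intensity \<alpha> C n) ({a..b} \<times> {c..<d}) =
      ennreal (real n * (d - c) / (2 * pi) * ((cosh (\<alpha> * b) - cosh (\<alpha> * a)) / ?D))" .
  have "cosh (\<alpha> * a) \<le> cosh (\<alpha> * b)"
    using r alpha by (intro cosh_real_nonneg_le_iff[THEN iffD2]) auto
  then have "0 \<le> real n * (d - c) / (2 * pi) * ((cosh (\<alpha> * b) - cosh (\<alpha> * a)) / ?D)"
    using phi D by (intro mult_nonneg_nonneg divide_nonneg_nonneg) auto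
  then show ?thesis unfolding measure_def * by simp
qed

lemma measure_hrg_outside:
  "measure (hrg_intensity \<alpha> C n) (- ({0..hrg_radius C n} \<times> {0..<2 * pi})) = 0"
proof -
  have [measurable]: "(sinh :: real \<Rightarrow> real) \<in> borel_measurable borel"
    by (intro borel_measurable_continuous_onI continuous_intros)
  have [simp]: "- ({0..hrg_radius C n} \<times> {0..<2 * pi}) \<in> sets (borel \<Otimes>\<^sub>M borel)"
    unfolding borel_prod using box_borel by (rule borel_comp)
  have "emeasure (hrg_intensity \<alpha> C n) (- ({0..hrg_radius C n} \<times> {0..<2 * pi})) = 0"
    unfolding hrg_intensity_def hrg_density_def
    by (subst emeasure_density)
       (auto simp: lborel_prod[symmetric] case_prod_beta nn_integral_0_iff_AE split: split_indicator)
  then show ?thesis by (simp add: measure_def)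
qed

end

subsection \<open>Adjacency and angles\<close>

text \<open>Circular distance at most \<open>w\<close> for two angles in a period; the second
  disjunct is the passage through angle 0.\<close>

definition near :: "real \<Rightarrow> real \<Rightarrow> real \<Rightarrow> bool" where
  "near w \<phi> \<phi>' \<longleftrightarrow> \<bar>\<phi> - \<phi>'\<bar> \<le> w \<or> 2 * pi - w \<le> \<bar>\<phi> - \<phi>'\<bar>"

lemma near_mono: "near w \<phi> \<phi>' \<Longrightarrow> w \<le> w' \<Longrightarrow> near w' \<phi> \<phi>'"
  by (auto simp: near_def)

lemma near_trans:
  assumes "near w a b" "near w' b c" "a \<in> {0..<2 * pi}" "b \<in> {0..<2 * pi}" "c \<in> {0..<2 * pi}"
  shows "near (w + w') a c"
  using assms by (auto simp: near_def abs_if split: if_splits)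

lemma hyp_dist_sym: "hyp_dist p q = hyp_dist q p"
proof -
  have "cos (snd p - snd q) = cos (snd q - snd p)" by (metis cos_minus minus_diff_eq)
  then show ?thesis by (simp add: hyp_dist_def case_prod_beta mult_ac)
qed

text \<open>In this form of the hyperbolic law of cosines both summands on the left are nonnegative,
  so radial and angular contributions can be estimated separately.\<close>

lemma hyp_dist_le_iff:
  assumes "0 \<le> r" "0 \<le> r'" "0 \<le> R"
  shows "hyp_dist (r, \<phi>) (r', \<phi>') \<le> R \<longleftrightarrow>
    cosh (r - r') + sinh r * sinh r' * (1 - cos (\<phi> - \<phi>')) \<le> cosh R"
proof -
  have "hyp_dist (r, \<phi>) (r', \<phi>') \<le> R \<longleftrightarrow> cosh (hyp_dist (r, \<phi>) (r', \<phi>')) \<le> cosh R"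
    using cosh_hyp_dist(2)[OF assms(1,2)] assms(3) by (simp add: cosh_real_nonneg_le_iff)
  then show ?thesis
    unfolding cosh_hyp_dist(1)[OF assms(1,2)] by (simp add: cosh_diff algebra_simps)
qed

lemma sin_ge_quarter:
  assumes "0 \<le> x" "x \<le> pi / 2"
  shows "x / 4 \<le> sin x"
proof (cases "x \<le> pi / 6")
  case True
  have "sin 0 - 0 / 4 \<le> sin x - x / 4"
  proof (rule DERIV_nonneg_imp_nondecreasing[OF assms(1)])
    fix y assume y: "0 \<le> y" "y \<le> x"
    have "cos (pi / 3) \<le> cos y" using y True pi_gt_zero by (intro cos_monotone_0_pi_le) auto
    then have "cos y - 1 / 4 \<ge> 0" by (simp add: cos_60)
    moreover have "((\<lambda>x. sin x - x / 4) has_real_derivative (cos y - 1 / 4)) (at y)"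
      by (auto intro!: derivative_eq_intros)
    ultimately show "\<exists>z. ((\<lambda>x. sin x - x / 4) has_real_derivative z) (at y) \<and> 0 \<le> z" by blast
  qed
  then show ?thesis by simp
next
  case False
  have "sin (pi / 6) \<le> sin x" using False assms by (intro sin_monotone_2pi_le) auto
  then show ?thesis using assms pi_less_4 by (simp add: sin_30)
qed

lemma one_minus_cos_ge:
  assumes "0 \<le> x" "x \<le> pi"
  shows "x\<^sup>2 / 32 \<le> 1 - cos x"
proof -
  have "1 - cos x = 2 * (sin (x / 2))\<^sup>2" using cos_double_sin[of "x / 2"] by simp
  moreover have "(x / 8)\<^sup>2 \<le> (sin (x / 2))\<^sup>2"
    using sin_ge_quarter[of "x / 2"] assms by (intro power_mono) auto
  ultimately show ?thesis by (simp add: power_divide)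
qed

lemma one_minus_cos_le: "1 - cos x \<le> x\<^sup>2 / (2 :: real)"
proof -
  have "(sin (x / 2))\<^sup>2 \<le> (x / 2)\<^sup>2"
    using abs_sin_x_le_abs_x[of "x / 2"] by (subst abs_le_square_iff[symmetric])
  moreover have "1 - cos x = 2 * (sin (x / 2))\<^sup>2" using cos_double_sin[of "x / 2"] by simp
  ultimately show ?thesis by (simp add: power_divide)
qed

lemma sinh_le_half_exp: "sinh (x::real) \<le> exp x / 2"
  by (simp add: sinh_field_def)

lemma sinh_ge_quarter_exp: "1 \<le> (x::real) \<Longrightarrow> exp x / 4 \<le> sinh x"
proof -
  assume x: "1 \<le> x"
  have "2 \<le> exp (2 * x)" using x exp_ge_add_one_self[of "2 * x"] by linarith
  then have "2 * exp (- x) \<le> exp x"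
    by (simp add: exp_minus field_simps mult_exp_exp)
  then show ?thesis by (simp add: sinh_field_def)
qed

lemma exp_half_squared: "(exp (x / 2))\<^sup>2 = exp (x::real)"
  using exp_double[of "x / 2"] by simp

text \<open>Dropping the radial term leaves
  \<open>sinh r * sinh r' * (1 - cos \<theta>) \<le> exp R\<close>. The factors 4, 4 and 32 lost in
  the elementary bounds multiply to 512, which is below \<open>24\<^sup>2\<close>.\<close>

lemma hyp_dist_le_imp_near:
  assumes r: "r \<in> {0..R}" "r' \<in> {0..R}" and phi: "\<phi> \<in> {0..<2 * pi}" "\<phi>' \<in> {0..<2 * pi}"
    and dist: "hyp_dist (r, \<phi>) (r', \<phi>') \<le> R"
  shows "near (24 * exp ((R - r - r') / 2)) \<phi> \<phi>'"
proof -
  define \<theta> where "\<theta> = min \<bar>\<phi> - \<phi>'\<bar> (2 * pi - \<bar>\<phi> - \<phi>'\<bar>)"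
  have \<theta>: "0 \<le> \<theta>" "\<theta> \<le> pi" using phi by (auto simp: \<theta>_def abs_if min_def)
  have near_iff: "near w \<phi> \<phi>' \<longleftrightarrow> \<theta> \<le> w" for w by (auto simp: near_def \<theta>_def)
  have "cos \<theta> = cos (\<phi> - \<phi>')"
  proof (cases "\<bar>\<phi> - \<phi>'\<bar> \<le> 2 * pi - \<bar>\<phi> - \<phi>'\<bar>")
    case True
    then show ?thesis unfolding \<theta>_def by (simp add: min_absorb1)
  next
    case False
    then have "cos \<theta> = cos (2 * pi - \<bar>\<phi> - \<phi>'\<bar>)" unfolding \<theta>_def by (simp add: min_absorb2)
    also have "\<dots> = cos \<bar>\<phi> - \<phi>'\<bar>" by (simp add: cos_diff)
    finally show ?thesis by simp
  qed
  show ?thesis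
  proof (cases "1 \<le> r \<and> 1 \<le> r'")
    \<comment> \<open>A point within distance 1 of the origin: the asserted angle then exceeds half
      a turn, so there is nothing to restrict.\<close>
    case False
    then have "- 1 / 2 \<le> (R - r - r') / 2" using r by auto
    then have "exp (- 1 / 2) \<le> exp ((R - r - r') / 2)" by simp
    moreover have "1 / 2 \<le> exp (- 1 / 2 :: real)" using exp_ge_add_one_self[of "- 1 / 2 :: real"] by simp
    ultimately have "4 \<le> 24 * exp ((R - r - r') / 2)" by linarith
    then show ?thesis unfolding near_iff using \<theta> pi_less_4 by linarith
  next
    case True
    have "cosh (r - r') + sinh r * sinh r' * (1 - cos \<theta>) \<le> cosh R"
      using dist r hyp_dist_le_iff[of r r' R \<phi> \<phi>'] \<open>cos \<theta> = cos (\<phi> - \<phi>')\<close> by simp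
    moreover have "cosh R \<le> exp R" using r by (simp add: cosh_field_def)
    moreover have "exp r / 4 * (exp r' / 4) * (\<theta>\<^sup>2 / 32) \<le> sinh r * sinh r' * (1 - cos \<theta>)"
      using True \<theta> by (intro mult_mono sinh_ge_quarter_exp one_minus_cos_ge) auto
    moreover have "0 < cosh (r - r')" by (rule cosh_real_pos)
    ultimately have "exp r / 4 * (exp r' / 4) * (\<theta>\<^sup>2 / 32) \<le> exp R" by linarith
    then have "exp (r + r') * \<theta>\<^sup>2 \<le> 512 * exp R" by (simp add: exp_add)
    then have "\<theta>\<^sup>2 \<le> 512 * (exp R / exp (r + r'))" by (simp add: field_simps)
    also have "exp R / exp (r + r') = exp (R - r - r')" by (simp add: exp_diff[symmetric] diff_diff_add)
    also have "512 * exp (R - r - r') \<le> (24 * exp ((R - r - r') / 2))\<^sup>2"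
      by (simp add: power_mult_distrib exp_half_squared)
    finally show ?thesis unfolding near_iff by (rule power2_le_imp_le) simp
  qed
qed

text \<open>The angular term is at most \<open>exp R / 8\<close>. The margin 1 in the radial
  difference brings the radial term down to \<open>exp R / 4 + 1 / 2\<close>, and
  \<open>exp R \<ge> 4\<close> fits the sum under \<open>exp R / 2\<close>.\<close>

lemma near_imp_hyp_dist_le:
  assumes r: "0 \<le> r" "0 \<le> r'" "\<bar>r - r'\<bar> \<le> R - 1" "2 \<le> R"
    and near: "\<bar>\<phi> - \<phi>'\<bar> \<le> exp ((R - r - r') / 2)"
  shows "hyp_dist (r, \<phi>) (r', \<phi>') \<le> R"
proof -
  have "(\<phi> - \<phi>')\<^sup>2 \<le> (exp ((R - r - r') / 2))\<^sup>2"
    using near by (simp add: abs_le_square_iff[symmetric])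
  also have "\<dots> = exp (R - r - r')" by (rule exp_half_squared)
  finally have "1 - cos (\<phi> - \<phi>') \<le> exp (R - r - r') / 2"
    using one_minus_cos_le[of "\<phi> - \<phi>'"] by linarith
  then have "sinh r * sinh r' * (1 - cos (\<phi> - \<phi>')) \<le> exp r / 2 * (exp r' / 2) * (exp (R - r - r') / 2)"
    using r by (intro mult_mono sinh_le_half_exp) auto
  also have "\<dots> = exp R / 8" by (simp add: exp_add[symmetric])
  finally have 1: "sinh r * sinh r' * (1 - cos (\<phi> - \<phi>')) \<le> exp R / 8" .
  have "cosh (r - r') = cosh \<bar>r - r'\<bar>" by simp
  also have "\<dots> \<le> cosh (R - 1)" using r by (intro cosh_real_nonneg_le_iff[THEN iffD2]) auto
  also have "\<dots> \<le> exp (R - 1) / 2 + 1 / 2" using r by (simp add: cosh_field_def)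
  also have "exp (R - 1) \<le> exp R / 2"
    using exp_ge_add_one_self[of "1::real"] by (simp add: exp_diff field_simps)
  finally have 2: "cosh (r - r') \<le> exp R / 4 + 1 / 2" by simp
  have "exp R \<ge> exp 1 * exp 1" using r by (simp add: exp_add[symmetric])
  moreover have "exp 1 * exp 1 \<ge> 2 * (2::real)"
    using exp_ge_add_one_self[of "1::real"] by (intro mult_mono) auto
  ultimately have "exp R \<ge> 4" by simp
  then have "exp R / 4 + 1 / 2 + exp R / 8 \<le> exp R / 2" by simp
  also have "\<dots> \<le> cosh R" by (simp add: cosh_field_def)
  finally show ?thesis using 1 2 r by (simp add: hyp_dist_le_iff)
qed

text \<open>The triangle inequality through the origin.\<close>

lemma small_radii_imp_hyp_dist_le:
  assumes "0 \<le> r" "0 \<le> r'" "r + r' \<le> R"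
  shows "hyp_dist (r, \<phi>) (r', \<phi>') \<le> R"
proof -
  have "sinh r * sinh r' * (1 - cos (\<phi> - \<phi>')) \<le> sinh r * sinh r' * 2"
    using assms cos_ge_minus_one[of "\<phi> - \<phi>'"] by (intro mult_left_mono) (auto simp del: cos_ge_minus_one)
  then have "cosh (r - r') + sinh r * sinh r' * (1 - cos (\<phi> - \<phi>')) \<le> cosh (r + r')"
    by (simp add: cosh_diff cosh_add)
  also have "\<dots> \<le> cosh R" using assms by (intro cosh_real_nonneg_le_iff[THEN iffD2]) auto
  finally show ?thesis using assms by (simp add: hyp_dist_le_iff)
qed

subsection \<open>Sectors\<close>

definition sector :: "nat \<Rightarrow> nat \<Rightarrow> real set" where
  "sector M s = {2 * pi * s / M ..< 2 * pi * (s + 1) / M}"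

definition slot :: "nat \<Rightarrow> real \<Rightarrow> nat" where
  "slot M \<phi> = nat \<lfloor>\<phi> * M / (2 * pi)\<rfloor>"

text \<open>The cyclic predecessor is written with \<open>+ M - 1\<close> to avoid truncated
  subtraction at slot 0.\<close>

definition adjacent_slots :: "nat \<Rightarrow> nat \<Rightarrow> nat set" where
  "adjacent_slots M s = {s, (s + 1) mod M, (s + M - 1) mod M}"

lemma card_adjacent_slots: "card (adjacent_slots M s) \<le> 3"
  unfolding adjacent_slots_def by (simp add: card_insert_if)

lemma adjacent_slots_less: "s < M \<Longrightarrow> adjacent_slots M s \<subseteq> {..<M}"
  by (auto simp: adjacent_slots_def)

lemma slot_less:
  assumes "0 < M" "\<phi> \<in> {0..<2 * pi}"
  shows "slot M \<phi> < M"
proof -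
  have "\<phi> * M / (2 * pi) < M" using assms by (simp add: field_simps)
  then have "\<lfloor>\<phi> * M / (2 * pi)\<rfloor> < int M" by linarith
  then show ?thesis using assms(1) by (simp add: slot_def)
qed

lemma real_slot:
  assumes "\<phi> \<in> {0..<2 * pi}"
  shows "real (slot M \<phi>) \<le> \<phi> * M / (2 * pi)" "\<phi> * M / (2 * pi) < real (slot M \<phi>) + 1"
proof -
  have "0 \<le> \<phi> * M / (2 * pi)" using assms by simp
  then show "real (slot M \<phi>) \<le> \<phi> * M / (2 * pi)" "\<phi> * M / (2 * pi) < real (slot M \<phi>) + 1"
    unfolding slot_def by linarith+
qed

lemma mem_sector_slot:
  assumes "0 < M" "\<phi> \<in> {0..<2 * pi}"
  shows "\<phi> \<in> sector M (slot M \<phi>)"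
  using real_slot[OF assms(2), of M] assms(1) by (simp add: sector_def field_simps)

lemma sector_width: "0 < M \<Longrightarrow> \<phi> \<in> sector M s \<Longrightarrow> \<phi>' \<in> sector M s \<Longrightarrow> \<bar>\<phi> - \<phi>'\<bar> \<le> 2 * pi / M"
  by (auto simp: sector_def abs_if field_simps)

lemma near_adjacent_slots:
  assumes M: "0 < M" and phi: "\<phi> \<in> {0..<2 * pi}" "\<phi>' \<in> {0..<2 * pi}"
    and near: "near w \<phi> \<phi>'" and w: "w \<le> 2 * pi / M"
  shows "slot M \<phi>' \<in> adjacent_slots M (slot M \<phi>)"
proof -
  let ?s = "slot M \<phi>" and ?s' = "slot M \<phi>'"
  \<comment> \<open>Angles in units of one sector width: the slots are their integer parts, so
    closeness of the angles leaves a cyclic difference of at most one.\<close>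
  define x x' where "x = \<phi> * M / (2 * pi)" and "x' = \<phi>' * M / (2 * pi)"
  have s: "real ?s \<le> x" "x < real ?s + 1" "real ?s' \<le> x'" "x' < real ?s' + 1"
    unfolding x_def x'_def using phi by (auto intro: real_slot)
  have less: "?s < M" "?s' < M" using slot_less[OF M] phi by auto
  have "near (2 * pi / M) \<phi> \<phi>'" using near w by (rule near_mono)
  moreover have "\<phi> - \<phi>' = 2 * pi / M * (x - x')" using M by (simp add: x_def x'_def field_simps)
  then have abs: "\<bar>\<phi> - \<phi>'\<bar> = 2 * pi / M * \<bar>x - x'\<bar>" by (simp add: abs_mult)
  moreover have "2 * pi - 2 * pi / M = 2 * pi / M * (M - 1)" using M by (simp add: field_simps)
  ultimately have "\<bar>x - x'\<bar> \<le> 1 \<or> real M - 1 \<le> \<bar>x - x'\<bar>"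
    using M unfolding near_def by (auto simp: mult_le_cancel_left1 mult_le_cancel_left_pos divide_simps)
  then have "\<bar>real ?s - real ?s'\<bar> < 2 \<or> real M - 2 < \<bar>real ?s - real ?s'\<bar>"
    using s by linarith
  then have "\<bar>int ?s - int ?s'\<bar> \<le> 1 \<or> int M - 1 \<le> \<bar>int ?s - int ?s'\<bar>"
    by linarith
  then consider "?s' = ?s" | "?s' = ?s + 1" | "?s = ?s' + 1" | "?s = 0" "?s' = M - 1" | "?s' = 0" "?s = M - 1"
    using less by linarith
  then show ?thesis
  proof cases
    case 2
    then show ?thesis using less by (simp add: adjacent_slots_def)
  next
    case 3
    then have "(?s + M - 1) mod M = ?s'" using less by (simp add: mod_if)
    then show ?thesis by (simp add: adjacent_slots_def)
  next
    case 5
    then have "(?s + 1) mod M = ?s'" using M by simp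
    then show ?thesis by (simp add: adjacent_slots_def)
  qed (use M in \<open>simp_all add: adjacent_slots_def\<close>)
qed

subsection \<open>Degenerate graphs\<close>

text \<open>Greedy colouring: a vertex with at most \<open>k\<close> neighbours is removed, the rest
  is coloured by induction, and one of the \<open>k + 1\<close> colours is free for it.\<close>

lemma degenerate_colouring:
  fixes G :: "'v ugraph"
  assumes "finite V" "\<And>v. {v} \<notin> edges G"
    and "\<And>S. S \<subseteq> V \<Longrightarrow> S \<noteq> {} \<Longrightarrow> \<exists>v\<in>S. card {u\<in>S. {v, u} \<in> edges G} \<le> k"
  shows "\<exists>c :: 'v \<Rightarrow> nat. c ` V \<subseteq> {..<k + 1} \<and> (\<forall>u\<in>V. \<forall>v\<in>V. {u, v} \<in> edges G \<longrightarrow> c u \<noteq> c v)"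
  using assms(1,3)
proof (induction "card V" arbitrary: V)
  case 0
  then show ?case by auto
next
  case (Suc m)
  have "V \<noteq> {}" using Suc.hyps(2) by auto
  then obtain v where v: "v \<in> V" "card {u\<in>V. {v, u} \<in> edges G} \<le> k"
    using Suc.prems(2)[of V] by auto
  have m: "m = card (V - {v})" using Suc.hyps(2) v(1) Suc.prems(1) by simp
  have "\<exists>c :: 'v \<Rightarrow> nat. c ` (V - {v}) \<subseteq> {..<k + 1} \<and>
      (\<forall>a\<in>V - {v}. \<forall>b\<in>V - {v}. {a, b} \<in> edges G \<longrightarrow> c a \<noteq> c b)"
  proof (rule Suc.hyps(1)[OF m])
    show "finite (V - {v})" using Suc.prems(1) by simp
    fix S assume "S \<subseteq> V - {v}" "S \<noteq> {}"
    then show "\<exists>w\<in>S. card {u\<in>S. {w, u} \<in> edges G} \<le> k" using Suc.prems(2)[of S] by auto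
  qed
  then obtain c :: "'v \<Rightarrow> nat" where c: "c ` (V - {v}) \<subseteq> {..<k + 1}"
    "\<And>a b. a \<in> V - {v} \<Longrightarrow> b \<in> V - {v} \<Longrightarrow> {a, b} \<in> edges G \<Longrightarrow> c a \<noteq> c b"
    by blast
  have "\<not> {..<k + 1} \<subseteq> c ` {u\<in>V. {v, u} \<in> edges G}"
  proof
    assume "{..<k + 1} \<subseteq> c ` {u\<in>V. {v, u} \<in> edges G}"
    then have "card {..<k + 1} \<le> card (c ` {u\<in>V. {v, u} \<in> edges G})"
      using Suc.prems(1) by (intro card_mono) auto
    also have "\<dots> \<le> k" using v(2) card_image_le[of "{u\<in>V. {v, u} \<in> edges G}" c] Suc.prems(1) by simp
    finally show False by simp
  qed
  then obtain x where x: "x < k + 1" "x \<notin> c ` {u\<in>V. {v, u} \<in> edges G}" by auto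
  have "(c(v := x)) ` V \<subseteq> {..<k + 1}" using c(1) x(1) by auto
  moreover have "(c(v := x)) a \<noteq> (c(v := x)) b" if "a \<in> V" "b \<in> V" "{a, b} \<in> edges G" for a b
  proof -
    have "a \<noteq> b" using that(3) assms(2)[of a] by auto
    then show ?thesis
      using c(2)[of a b] that x(2) by (auto simp: image_iff insert_commute)
  qed
  ultimately show ?case by blast
qed

lemma chromatic_number_le_degeneracy:
  fixes G :: "'v ugraph"
  assumes "finite (verts G)" "\<And>v. {v} \<notin> edges G"
    and "\<And>S. S \<subseteq> verts G \<Longrightarrow> S \<noteq> {} \<Longrightarrow> \<exists>v\<in>S. card {u\<in>S. {v, u} \<in> edges G} \<le> k"
  shows "chromatic_number G \<le> k + 1"
  unfolding chromatic_number_def proper_colouring_def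
  using degenerate_colouring[OF assms] by (intro Least_le)

lemma chromatic_number_pos:
  assumes "finite (verts G)" "\<And>v. {v} \<notin> edges G" "verts G \<noteq> {}"
  shows "0 < chromatic_number G"
proof -
  let ?P = "\<lambda>k. \<exists>c :: 'a \<Rightarrow> nat. c ` verts G \<subseteq> {..<k} \<and> proper_colouring G c"
  have "card {u\<in>S. {v, u} \<in> edges G} \<le> card (verts G)" if "S \<subseteq> verts G" for S v
    using assms(1) that by (intro card_mono) auto
  then have "?P (card (verts G) + 1)"
    unfolding proper_colouring_def by (intro degenerate_colouring[OF assms(1,2)]) auto
  then have "?P (chromatic_number G)" unfolding chromatic_number_def by (rule LeastI)
  then show ?thesis using assms(3) by (auto intro: gr0I)
qed

text \<open>Greedy choice: taking one vertex and discarding its closed neighbourhood uses up at most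
  \<open>d + 1\<close> vertices.\<close>

lemma independent_subset:
  assumes "finite W" "\<And>u v. u \<in> W \<Longrightarrow> v \<in> W \<Longrightarrow> E u v \<longleftrightarrow> E v u" "\<And>u. u \<in> W \<Longrightarrow> \<not> E u u"
    "\<And>u. u \<in> W \<Longrightarrow> card {v\<in>W. E u v} \<le> d"
  shows "\<exists>I\<subseteq>W. card W \<le> card I * (d + 1) \<and> (\<forall>u\<in>I. \<forall>v\<in>I. \<not> E u v)"
  using assms
proof (induction "card W" arbitrary: W rule: less_induct)
  case less
  show ?case
  proof (cases "W = {}")
    case False
    then obtain u where u: "u \<in> W" by auto
    let ?D = "insert u {v\<in>W. E u v}"
    let ?W = "W - ?D"
    have D: "?D \<subseteq> W" "finite ?D" using u less.prems(1) by auto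
    have cD: "card ?D \<le> d + 1" using less.prems(1) less.prems(3,4)[OF u] by (simp add: card_insert_if)
    have less_W: "card ?W < card W" using u less.prems(1) by (intro psubset_card_mono) auto
    have deg_W: "card {v\<in>?W. E w v} \<le> d" if "w \<in> ?W" for w
    proof -
      have "card {v\<in>?W. E w v} \<le> card {v\<in>W. E w v}"
        using less.prems(1) by (intro card_mono) auto
      also have "\<dots> \<le> d" using that by (intro less.prems(4)) simp
      finally show ?thesis .
    qed
    have "\<exists>I\<subseteq>?W. card ?W \<le> card I * (d + 1) \<and> (\<forall>u\<in>I. \<forall>v\<in>I. \<not> E u v)"
    proof (rule less.hyps[OF less_W])
      show "E a b \<longleftrightarrow> E b a" if "a \<in> ?W" "b \<in> ?W" for a b
        using that by (intro less.prems(2)) simp_all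
      show "\<not> E a a" if "a \<in> ?W" for a
        using that by (intro less.prems(3)) simp
    qed (use less.prems(1) deg_W in simp_all)
    then obtain I where I: "I \<subseteq> ?W" "card ?W \<le> card I * (d + 1)" "\<forall>u\<in>I. \<forall>v\<in>I. \<not> E u v"
      by blast
    have "card W = card ?W + card ?D"
      using D less.prems(1) by (simp add: card_Diff_subset card_mono)
    also have "\<dots> \<le> (card I + 1) * (d + 1)" using I(2) cD by simp
    also have "card I + 1 = card (insert u I)"
      using I(1) less.prems(1) finite_subset[OF I(1)] by (subst card_insert_disjoint) auto
    finally have "card W \<le> card (insert u I) * (d + 1)" .
    moreover have "\<forall>a\<in>insert u I. \<forall>b\<in>insert u I. \<not> E a b"
      using I u less.prems(2,3) by blast
    moreover have "insert u I \<subseteq> W" using I(1) u by auto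
    ultimately show ?thesis by blast
  qed auto
qed

subsection \<open>Point configurations without exceptionally dense boxes\<close>

text \<open>Layer \<open>j\<close> holds the points whose distance from the boundary of the disk
  lies between \<open>j\<close> and \<open>j + 1\<close>; \<open>max 0\<close> cuts the innermost
  layer off at the origin.\<close>

definition hbox :: "real \<Rightarrow> nat \<Rightarrow> nat \<Rightarrow> nat \<Rightarrow> (real \<times> real) set" where
  "hbox R M j s = {max 0 (R - real j - 1)..R - real j} \<times> sector M s"

text \<open>Every box at every angular resolution \<open>M\<close> has at most
  \<open>\<beta>\<close> times one plus a bound on its mass. Resolutions up to
  \<open>exp (R / 2)\<close> suffice because edges between boundary points span angles of order
  \<open>exp (- R / 2)\<close>.\<close>

locale hrg_config =
  fixes \<alpha> R \<beta> :: real and n N :: nat and X :: "nat \<Rightarrow> real \<times> real"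
  assumes alpha: "1 / 2 < \<alpha>" "\<alpha> < 1" and R: "2 \<le> R" and beta: "1 \<le> \<beta>"
    and inside: "\<And>i. i < N \<Longrightarrow> X i \<in> {0..R} \<times> {0..<2 * pi}"
    and counts: "\<And>j M s. real j \<le> R \<Longrightarrow> 0 < M \<Longrightarrow> real M \<le> exp (R / 2) \<Longrightarrow> s < M \<Longrightarrow>
      real (points_in (hbox R M j s) (N, X)) \<le> \<beta> * (1 + 4 * real n * exp (- \<alpha> * j) / M)"
begin

definition "G = geometric_graph R (N, X)"
definition "rad i = fst (X i)"
definition "ang i = snd (X i)"
definition "layer i = nat \<lfloor>R - rad i\<rfloor>"
definition "depth = nat \<lfloor>R\<rfloor>"

text \<open>Three adjacent sectors, at most \<open>R + 1\<close> layers, and 96 as the product of 4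
  from the box mass and 24 from the angle. For \<open>R = hrg_radius C n\<close> the first is of
  order \<open>\<beta> * R\<close>, the second of order
  \<open>\<beta> * R * n powr (1 - \<alpha>)\<close>.\<close>

definition "deg_factor = 3 * \<beta> * (R + 1) * (1 + 96 * real n * exp (- R / 2))"
definition "inner_bound = 3 * \<beta> * (R + 1) * (1 + 96 * real n * exp (- \<alpha> * R / 2))"

lemma verts_G [simp]: "verts G = {..<N}"
  by (simp add: G_def geometric_graph_def verts_def)

lemma no_loop_edge: "{v} \<notin> edges G"
  by (auto simp: G_def geometric_graph_def edges_def doubleton_eq_iff)

lemma edge_iff: "{u, v} \<in> edges G \<longleftrightarrow> u < N \<and> v < N \<and> u \<noteq> v \<and> hyp_dist (X u) (X v) \<le> R"
  by (auto simp: G_def geometric_graph_def edges_def doubleton_eq_iff hyp_dist_sym)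

lemma mem_neighbours_iff: "v \<in> neighbours G u \<longleftrightarrow> u < N \<and> v < N \<and> u \<noteq> v \<and> hyp_dist (X u) (X v) \<le> R"
  by (auto simp: neighbours_def edge_iff)

lemma finite_neighbours [simp]: "finite (neighbours G u)"
  by (simp add: neighbours_def)

lemma neighbours_sym: "u \<in> neighbours G v \<longleftrightarrow> v \<in> neighbours G u"
  by (auto simp: mem_neighbours_iff hyp_dist_sym)

lemma rad: "i < N \<Longrightarrow> 0 \<le> rad i" "i < N \<Longrightarrow> rad i \<le> R"
  and ang: "i < N \<Longrightarrow> ang i \<in> {0..<2 * pi}"
  using inside[of i] by (auto simp: rad_def ang_def)

lemma X_eq: "X i = (rad i, ang i)"
  by (simp add: rad_def ang_def)

lemma layer:
  assumes "i < N"
  shows "real (layer i) \<le> R - rad i" "R - rad i \<le> real (layer i) + 1" "layer i \<le> depth" "real (layer i) \<le> R"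
  using rad[OF assms] unfolding layer_def depth_def by linarith+

lemma real_depth: "real depth \<le> R"
  using R unfolding depth_def by linarith

lemma mem_hbox:
  assumes "i < N" "0 < M"
  shows "X i \<in> hbox R M (layer i) (slot M (ang i))"
  using layer[OF assms(1)] rad[OF assms(1)] mem_sector_slot[OF assms(2) ang[OF assms(1)]]
  by (auto simp: X_eq hbox_def)

lemma card_hbox_le:
  assumes "j \<le> depth" "0 < M" "real M \<le> exp (R / 2)" "s < M"
  shows "real (card {i. i < N \<and> X i \<in> hbox R M j s}) \<le> \<beta> * (1 + 4 * real n * exp (- \<alpha> * j) / M)"
  using counts[of j M s] assms real_depth by (simp add: points_in_def)

lemma card_layer_le:
  assumes "j \<le> depth"
  shows "real (card {i. i < N \<and> layer i = j}) \<le> \<beta> * (1 + 4 * real n * exp (- \<alpha> * j))"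
proof -
  have "slot 1 (ang i) = 0" if "i < N" for i
    using slot_less[of 1 "ang i"] ang[OF that] by simp
  then have "{i. i < N \<and> layer i = j} \<subseteq> {i. i < N \<and> X i \<in> hbox R 1 j 0}"
    using mem_hbox[of _ 1] by fastforce
  then have "card {i. i < N \<and> layer i = j} \<le> card {i. i < N \<and> X i \<in> hbox R 1 j 0}"
    by (intro card_mono) auto
  then show ?thesis using card_hbox_le[OF assms, of 1 0] R by simp
qed

lemma adjacent_near:
  assumes "v \<in> neighbours G u"
  shows "near (24 * exp ((R - rad u - rad v) / 2)) (ang u) (ang v)"
  using assms rad ang by (intro hyp_dist_le_imp_near) (auto simp: mem_neighbours_iff X_eq)

text \<open>Neighbours in layer \<open>j\<close> occupy a fraction of the circle bounded by 1 and by
  a multiple of \<open>exp z\<close> with \<open>z = (layer u + j - R) / 2\<close>. Interpolating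
  gives \<open>exp (\<tau> * z)\<close> for each \<open>\<tau>\<close> in the unit interval:
  \<open>\<tau> = 1\<close> suits total degrees, \<open>\<tau> = \<alpha>\<close> inner
  degrees.\<close>

lemma card_neighbours_layer_le:
  assumes u: "u < N" and j: "j \<le> depth" and \<tau>: "0 \<le> \<tau>" "\<tau> \<le> 1"
  shows "real (card {v\<in>neighbours G u. layer v = j})
    \<le> 3 * \<beta> * (1 + 96 * real n * exp (- \<alpha> * j + \<tau> * (layer u + real j - R) / 2))"
proof -
  define z where "z = (real (layer u) + real j - R) / 2"
  define w where "w = 24 * exp (z + 1)"
  let ?S = "{v\<in>neighbours G u. layer v = j}"
  have near: "near w (ang u) (ang v)" if "v \<in> ?S" for v
  proof (rule near_mono)
    show "near (24 * exp ((R - rad u - rad v) / 2)) (ang u) (ang v)"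
      using that by (intro adjacent_near) auto
    have "v < N" using that by (auto simp: mem_neighbours_iff)
    moreover have "layer v = j" using that by simp
    ultimately have "R - rad u - rad v \<le> layer u + real j - R + 2"
      using layer(2)[OF u] layer(2)[OF \<open>v < N\<close>] by simp
    then have "(R - rad u - rad v) / 2 \<le> (layer u + real j - R + 2) / 2"
      by (rule divide_right_mono) simp
    also have "\<dots> = z + 1" by (simp add: z_def add_divide_distrib)
    finally have "(R - rad u - rad v) / 2 \<le> z + 1" .
    then show "24 * exp ((R - rad u - rad v) / 2) \<le> w"
      by (simp add: w_def)
  qed
  have w: "0 < w" by (simp add: w_def)
  have w24: "w \<le> 72 * exp z"
    using exp_le by (simp add: w_def exp_add)
  have "\<exists>M>0. real M \<le> exp (R / 2) \<and> 1 / M \<le> 24 * exp z \<and>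
      (\<forall>v\<in>?S. slot M (ang v) \<in> adjacent_slots M (slot M (ang u)))"
  proof (cases "w \<le> 2 * pi")
    case True
    \<comment> \<open>The finest division into sectors of width at least \<open>w\<close>;
      neighbours then fall into the sector of \<open>u\<close> or one next to it.\<close>
    define M where "M = nat \<lfloor>2 * pi / w\<rfloor>"
    have "1 \<le> 2 * pi / w" using True w by simp
    then have M: "0 < M" "real M \<le> 2 * pi / w" "2 * pi / w \<le> 2 * real M"
    proof -
      have "0 < nat \<lfloor>q\<rfloor> \<and> real (nat \<lfloor>q\<rfloor>) \<le> q \<and> q \<le> 2 * real (nat \<lfloor>q\<rfloor>)" if "1 \<le> q" for q :: real
      proof -
        have "1 \<le> \<lfloor>q\<rfloor>" using that by (simp add: le_floor_iff)
        then have "real (nat \<lfloor>q\<rfloor>) = of_int \<lfloor>q\<rfloor>" "1 \<le> real_of_int \<lfloor>q\<rfloor>" by simp_all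
        then show ?thesis using \<open>1 \<le> \<lfloor>q\<rfloor>\<close> floor_correct[of q] by linarith
      qed
      from this[OF \<open>1 \<le> 2 * pi / w\<close>]
      show "0 < M" "real M \<le> 2 * pi / w" "2 * pi / w \<le> 2 * real M" unfolding M_def by blast+
    qed
    have "z = (real (layer u) + real j) / 2 - R / 2" by (simp add: z_def diff_divide_distrib)
    moreover have "0 \<le> (real (layer u) + real j) / 2" by simp
    ultimately have "- R / 2 \<le> z + 1" by linarith
    then have "24 * exp (- R / 2) \<le> w" by (simp add: w_def)
    then have "2 * pi / w \<le> 2 * pi / (24 * exp (- R / 2))" using w by (intro divide_left_mono) auto
    also have "\<dots> \<le> exp (R / 2)" using pi_less_4 by (simp add: exp_minus field_simps)
    finally have "real M \<le> exp (R / 2)" using M by simp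
    moreover have "1 / M \<le> w / pi"
      using M w by (simp add: field_simps)
    then have "1 / M \<le> 24 * exp z"
    proof -
      have "w / pi \<le> 72 * exp z / 3" using w24 pi_gt3 by (intro frac_le) auto
      then show ?thesis using \<open>1 / M \<le> w / pi\<close> by simp
    qed
    moreover have "w \<le> 2 * pi / M" using M w by (simp add: field_simps)
    then have "slot M (ang v) \<in> adjacent_slots M (slot M (ang u))" if "v \<in> ?S" for v
      using near_adjacent_slots[OF M(1) ang[OF u] _ near[OF that]] ang that by (auto simp: mem_neighbours_iff)
    ultimately show ?thesis using M(1) by blast
  next
    case False
    then have "6 \<le> 72 * exp z" using w24 pi_gt3 by linarith
    moreover have "slot 1 (ang v) \<in> adjacent_slots 1 (slot 1 (ang u))" if "v \<in> ?S" for v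
      using that slot_less[of 1 "ang v"] slot_less[of 1 "ang u"] ang u
      by (auto simp: mem_neighbours_iff adjacent_slots_def)
    ultimately show ?thesis using R by (intro exI[of _ 1]) auto
  qed
  then obtain M where M: "0 < M" "real M \<le> exp (R / 2)" "1 / M \<le> 24 * exp z"
    "\<And>v. v \<in> ?S \<Longrightarrow> slot M (ang v) \<in> adjacent_slots M (slot M (ang u))" by blast
  let ?A = "adjacent_slots M (slot M (ang u))"
  have slots: "?A \<subseteq> {..<M}" using slot_less[OF M(1) ang[OF u]] by (rule adjacent_slots_less)
  have "?S \<subseteq> (\<Union>s\<in>?A. {v. v < N \<and> X v \<in> hbox R M j s})"
    using M(4) mem_hbox[OF _ M(1)] by (fastforce simp: mem_neighbours_iff)
  then have "card ?S \<le> (\<Sum>s\<in>?A. card {v. v < N \<and> X v \<in> hbox R M j s})"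
    by (intro order.trans[OF card_mono card_UN_le]) (auto simp: adjacent_slots_def)
  then have "real (card ?S) \<le> (\<Sum>s\<in>?A. real (card {v. v < N \<and> X v \<in> hbox R M j s}))"
    by (simp flip: of_nat_sum)
  also have "\<dots> \<le> (\<Sum>s\<in>?A. \<beta> * (1 + 4 * real n * exp (- \<alpha> * j) / M))"
    using slots by (intro sum_mono card_hbox_le[OF j M(1,2)]) auto
  also have "\<dots> \<le> 3 * (\<beta> * (1 + 4 * real n * exp (- \<alpha> * j) / M))"
    using card_adjacent_slots[of M "slot M (ang u)"] beta by (simp add: mult_right_mono)
  also have "4 * real n * exp (- \<alpha> * j) / M \<le> 4 * real n * exp (- \<alpha> * j) * (24 * exp (\<tau> * z))"
  proof -
    have "1 / M \<le> 24 * exp (\<tau> * z)"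
    proof (cases "0 \<le> z")
      case True
      then have "1 \<le> exp (\<tau> * z)" using \<tau> by simp
      moreover have "1 / M \<le> 1" using M(1) by simp
      ultimately show ?thesis by linarith
    next
      case False
      then have "z \<le> \<tau> * z" using \<tau> mult_right_mono_neg[of \<tau> 1 z] by simp
      then have "exp z \<le> exp (\<tau> * z)" by simp
      then show ?thesis using M(3) by linarith
    qed
    then have "4 * real n * exp (- \<alpha> * j) * (1 / M) \<le> 4 * real n * exp (- \<alpha> * j) * (24 * exp (\<tau> * z))"
      by (intro mult_left_mono) auto
    then show ?thesis by simp
  qed
  also have "4 * real n * exp (- \<alpha> * j) * (24 * exp (\<tau> * z)) = 96 * real n * exp (- \<alpha> * j + \<tau> * (layer u + real j - R) / 2)"
    by (simp only: exp_add z_def) simp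
  finally show ?thesis using beta by simp
qed

lemma card_le_sum_layers:
  assumes "\<And>v. v \<in> S \<Longrightarrow> v < N"
  shows "real (card S) \<le> (\<Sum>j\<le>depth. real (card {v\<in>S. layer v = j}))"
proof -
  have fin: "finite S" using assms by (meson finite_lessThan finite_subset lessThan_iff subsetI)
  have "card S \<le> card (\<Union>j\<in>{..depth}. {v\<in>S. layer v = j})"
    using fin layer(3) assms by (intro card_mono) auto
  also have "\<dots> \<le> (\<Sum>j\<le>depth. card {v\<in>S. layer v = j})"
    by (intro card_UN_le) auto
  finally have "card S \<le> (\<Sum>j\<le>depth. card {v\<in>S. layer v = j})" .
  then show ?thesis by (simp flip: of_nat_sum)
qed

lemma sum_layers_le:
  assumes "\<And>j. j \<le> depth \<Longrightarrow> f j \<le> c" "0 \<le> c"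
  shows "(\<Sum>j\<le>depth. f j) \<le> (R + 1) * c"
proof -
  have "(\<Sum>j\<le>depth. f j) \<le> (\<Sum>j\<le>depth. c)" using assms by (intro sum_mono) auto
  also have "\<dots> = (real depth + 1) * c" by simp
  also have "\<dots> \<le> (R + 1) * c" using real_depth assms(2) by (intro mult_right_mono) auto
  finally show ?thesis .
qed

text \<open>With \<open>\<tau> = 1\<close> layer \<open>j\<close> contributes a factor
  \<open>exp ((1 / 2 - \<alpha>) * j)\<close>, at most 1 since \<alpha> exceeds 1/2. No layer
  contributes more than the boundary layer bound.\<close>

lemma degree_le:
  assumes u: "u < N"
  shows "real (card (neighbours G u)) \<le> deg_factor * exp (layer u / 2)"
proof -
  let ?c = "3 * \<beta> * (1 + 96 * real n * exp (- R / 2)) * exp (layer u / 2)"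
  have "real (card {v\<in>neighbours G u. layer v = j}) \<le> ?c" if j: "j \<le> depth" for j
  proof -
    have "real (card {v\<in>neighbours G u. layer v = j})
      \<le> 3 * \<beta> * (1 + 96 * real n * exp (- \<alpha> * j + 1 * (layer u + real j - R) / 2))"
      by (rule card_neighbours_layer_le[OF u j]) auto
    also have "\<dots> \<le> 3 * \<beta> * (exp (layer u / 2) + 96 * real n * exp (- R / 2 + layer u / 2))"
    proof -
      have "1 / 2 * real j \<le> \<alpha> * real j" using alpha by (intro mult_right_mono) auto
      moreover have "1 * (layer u + real j - R) / 2 = layer u / 2 + 1 / 2 * j - R / 2" by simp
      ultimately have "- \<alpha> * j + 1 * (layer u + real j - R) / 2 \<le> - R / 2 + layer u / 2" by linarith
      then show ?thesis using beta by (intro mult_left_mono add_mono) auto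
    qed
    also have "\<dots> = ?c" by (simp only: exp_add) (simp add: algebra_simps)
    finally show ?thesis .
  qed
  then have "(\<Sum>j\<le>depth. real (card {v\<in>neighbours G u. layer v = j})) \<le> (R + 1) * ?c"
    using beta by (intro sum_layers_le) auto
  moreover have "real (card (neighbours G u)) \<le> (\<Sum>j\<le>depth. real (card {v\<in>neighbours G u. layer v = j}))"
    by (rule card_le_sum_layers) (auto simp: mem_neighbours_iff)
  moreover have "(R + 1) * ?c = deg_factor * exp (layer u / 2)" unfolding deg_factor_def by (simp only: mult_ac)
  ultimately show ?thesis by linarith
qed

text \<open>With \<open>\<tau> = \<alpha>\<close> the exponent becomes
  \<open>\<alpha> * (layer u - j) / 2 - \<alpha> * R / 2\<close>, and only layers
  \<open>j \<ge> layer u\<close> occur. The resulting bound is uniform in \<open>u\<close>.\<close>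

lemma inner_degree_le:
  assumes u: "u < N"
  shows "real (card {v\<in>neighbours G u. rad v \<le> rad u}) \<le> inner_bound"
proof -
  let ?S = "{v\<in>neighbours G u. rad v \<le> rad u}"
  let ?c = "3 * \<beta> * (1 + 96 * real n * exp (- \<alpha> * R / 2))"
  have "real (card {v\<in>?S. layer v = j}) \<le> ?c" if j: "j \<le> depth" for j
  proof (cases "layer u \<le> j")
    case True
    have "real (card {v\<in>?S. layer v = j}) \<le> real (card {v\<in>neighbours G u. layer v = j})"
      by (intro of_nat_mono card_mono) auto
    also have "\<dots> \<le> 3 * \<beta> * (1 + 96 * real n * exp (- \<alpha> * j + \<alpha> * (layer u + real j - R) / 2))"
      using alpha by (intro card_neighbours_layer_le[OF u j]) auto
    also have "\<dots> \<le> ?c"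
    proof -
      have "\<alpha> * real (layer u) \<le> \<alpha> * real j" using True alpha by (intro mult_left_mono) auto
      moreover have "\<alpha> * (layer u + real j - R) / 2 = \<alpha> * layer u / 2 + \<alpha> * j / 2 - \<alpha> * R / 2"
        by (simp add: field_simps)
      ultimately have "- \<alpha> * j + \<alpha> * (layer u + real j - R) / 2 \<le> - \<alpha> * R / 2" by linarith
      then show ?thesis using beta by (intro mult_left_mono add_mono) auto
    qed
    finally show ?thesis .
  next
    case False
    have "layer u \<le> layer v" if "v \<in> ?S" for v
      using that unfolding layer_def by (intro nat_mono floor_mono) auto
    then have "{v\<in>?S. layer v = j} = {}" using False by auto
    then show ?thesis unfolding \<open>{v\<in>?S. layer v = j} = {}\<close> using beta by simp
  qed
  then have "(\<Sum>j\<le>depth. real (card {v\<in>?S. layer v = j})) \<le> (R + 1) * ?c"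
    using beta by (intro sum_layers_le) auto
  moreover have "real (card ?S) \<le> (\<Sum>j\<le>depth. real (card {v\<in>?S. layer v = j}))"
    by (rule card_le_sum_layers) (auto simp: mem_neighbours_iff)
  moreover have "(R + 1) * ?c = inner_bound" unfolding inner_bound_def by (simp only: mult_ac)
  ultimately show ?thesis by linarith
qed

lemma N_le: "real N \<le> (R + 1) * (\<beta> * (1 + 4 * real n))"
proof -
  have "real (card {v\<in>{..<N}. layer v = j}) \<le> \<beta> * (1 + 4 * real n)" if j: "j \<le> depth" for j
  proof -
    have "real (card {i. i < N \<and> layer i = j}) \<le> \<beta> * (1 + 4 * real n * exp (- \<alpha> * j))"
      by (rule card_layer_le[OF j])
    also have "\<dots> \<le> \<beta> * (1 + 4 * real n)"
    proof -
      have "exp (- \<alpha> * j) \<le> 1" using alpha by simp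
      then have "4 * real n * exp (- \<alpha> * j) \<le> 4 * real n * 1" by (intro mult_left_mono) auto
      then show ?thesis using beta by (intro mult_left_mono) auto
    qed
    finally show ?thesis by simp
  qed
  then have "(\<Sum>j\<le>depth. real (card {v\<in>{..<N}. layer v = j})) \<le> (R + 1) * (\<beta> * (1 + 4 * real n))"
    using beta by (intro sum_layers_le) auto
  then show ?thesis using card_le_sum_layers[of "{..<N}"] by simp
qed

lemma deg_factor_nonneg: "0 \<le> deg_factor" and inner_bound_nonneg: "0 \<le> inner_bound"
  using beta R by (simp_all add: deg_factor_def inner_bound_def)

text \<open>Grouped by layers, the decay \<open>exp (- \<alpha> * j)\<close> of the number of points
  outweighs the growth \<open>exp (j / 2)\<close> of their degrees, so the number of edges is nearly
  linear in \<open>n\<close>.\<close>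

lemma sum_degree_le:
  "real (\<Sum>u<N. card (neighbours G u)) \<le> (R + 1) * (\<beta> * deg_factor * (exp (R / 2) + 4 * real n))"
proof -
  have "real (\<Sum>u<N. card (neighbours G u)) \<le> (\<Sum>u<N. deg_factor * exp (layer u / 2))"
    unfolding of_nat_sum by (intro sum_mono degree_le) auto
  also have "\<dots> = (\<Sum>j\<le>depth. \<Sum>u\<in>{u\<in>{..<N}. layer u = j}. deg_factor * exp (layer u / 2))"
    by (rule sum.group[symmetric]) (auto simp: layer(3))
  also have "\<dots> = (\<Sum>j\<le>depth. real (card {u. u < N \<and> layer u = j}) * (deg_factor * exp (j / 2)))"
    by (intro sum.cong) auto
  also have "\<dots> \<le> (R + 1) * (\<beta> * deg_factor * (exp (R / 2) + 4 * real n))"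
  proof (rule sum_layers_le)
    fix j assume j: "j \<le> depth"
    have "real (card {u. u < N \<and> layer u = j}) * (deg_factor * exp (j / 2)) \<le>
        \<beta> * (1 + 4 * real n * exp (- \<alpha> * j)) * (deg_factor * exp (j / 2))"
      using card_layer_le[OF j] deg_factor_nonneg by (intro mult_right_mono) auto
    also have "\<dots> = \<beta> * deg_factor * (exp (j / 2) + 4 * real n * exp (- \<alpha> * j + j / 2))"
      by (simp only: exp_add) (simp add: algebra_simps)
    also have "\<dots> \<le> \<beta> * deg_factor * (exp (R / 2) + 4 * real n)"
    proof -
      have "(1 / 2 - \<alpha>) * real j \<le> 0" using alpha by (intro mult_nonpos_nonneg) auto
      then have "exp (- \<alpha> * j + j / 2) \<le> 1" by (simp add: algebra_simps)
      then have "4 * real n * exp (- \<alpha> * j + j / 2) \<le> 4 * real n * 1" by (intro mult_left_mono) auto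
      moreover have "exp (j / 2) \<le> exp (R / 2)" using j real_depth by simp
      ultimately show ?thesis using beta deg_factor_nonneg by (intro mult_left_mono add_mono) auto
    qed
    finally show "real (card {u. u < N \<and> layer u = j}) * (deg_factor * exp (j / 2))
      \<le> \<beta> * deg_factor * (exp (R / 2) + 4 * real n)" .
  qed (use beta deg_factor_nonneg in auto)
  finally show ?thesis .
qed

text \<open>The vertex of largest radius in any subset has only inner neighbours there, so the graph
  is degenerate with the inner degree bound.\<close>

lemma chromatic_number_le: "real (chromatic_number G) \<le> inner_bound + 1"
proof -
  have "chromatic_number G \<le> nat \<lfloor>inner_bound\<rfloor> + 1"
  proof (rule chromatic_number_le_degeneracy)
    fix S assume S: "S \<subseteq> verts G" "S \<noteq> {}"
    have fin: "finite S" using S finite_subset by auto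
    have "Max (rad ` S) \<in> rad ` S" using fin S(2) by (intro Max_in) auto
    then obtain v where "v \<in> S" "rad v = Max (rad ` S)" by auto
    then have v: "v \<in> S" "\<And>u. u \<in> S \<Longrightarrow> rad u \<le> rad v" using fin by auto
    have "card {u\<in>S. {v, u} \<in> edges G} \<le> card {u\<in>neighbours G v. rad u \<le> rad v}"
      using v S by (intro card_mono) (auto simp: neighbours_def)
    moreover have "real (card {u\<in>neighbours G v. rad u \<le> rad v}) \<le> inner_bound"
      using v S by (intro inner_degree_le) auto
    ultimately have "card {u\<in>S. {v, u} \<in> edges G} \<le> nat \<lfloor>inner_bound\<rfloor>" by linarith
    then show "\<exists>v\<in>S. card {u\<in>S. {v, u} \<in> edges G} \<le> nat \<lfloor>inner_bound\<rfloor>" using v by blast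
  qed (auto simp: no_loop_edge)
  then show ?thesis using inner_bound_nonneg by linarith
qed

lemma same_sector_adjacent:
  assumes uv: "u < N" "v < N" "u \<noteq> v" and M: "0 < M" "2 * pi / M \<le> exp ((R - rad u - rad v) / 2)"
    and sec: "ang u \<in> sector M s" "ang v \<in> sector M s" and r: "\<bar>rad u - rad v\<bar> \<le> R - 1"
  shows "v \<in> neighbours G u"
proof -
  have "\<bar>ang u - ang v\<bar> \<le> exp ((R - rad u - rad v) / 2)"
    using sector_width[OF M(1) sec] M(2) by simp
  then have "hyp_dist (rad u, ang u) (rad v, ang v) \<le> R"
    using rad uv r R by (intro near_imp_hyp_dist_le) auto
  then show ?thesis using uv by (simp add: mem_neighbours_iff X_eq)
qed

end

section \<open>Maximum degree and the deterministic form of part 1\<close>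

lemma card_neighbours_le_max_degree:
  "finite (verts G) \<Longrightarrow> v \<in> verts G \<Longrightarrow> card (neighbours G v) \<le> max_degree G"
  unfolding max_degree_def by (intro Max_ge) auto

lemma max_degree_leI:
  assumes "finite (verts G)" "\<And>v. v \<in> verts G \<Longrightarrow> real (card (neighbours G v)) \<le> b" "0 \<le> b"
  shows "real (max_degree G) \<le> b"
proof -
  have "max_degree G \<in> insert 0 ((\<lambda>v. card (neighbours G v)) ` verts G)"
    unfolding max_degree_def using assms(1) by (intro Max_in) auto
  then show ?thesis using assms(2,3) by auto
qed

context hrg_config
begin

text \<open>A vertex \<open>u\<close> of radius at most \<open>r1\<close> is adjacent to all other
  points of its sector of width \<open>exp (- r1 / 2)\<close>. Radius at least 1 keeps the radial
  differences below \<open>R - 1\<close>; the lost 1 is \<open>u\<close> itself.\<close>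

lemma max_degree_ge:
  assumes u: "u < N" "1 \<le> rad u" "rad u \<le> r1" and r1: "r1 \<le> R - 1"
    and M: "0 < M" "2 * pi / M \<le> exp (- r1 / 2)"
    and count: "\<And>s. s < M \<Longrightarrow> l \<le> real (card {i. i < N \<and> ang i \<in> sector M s})"
  shows "l - 1 \<le> real (max_degree G)"
proof -
  let ?s = "slot M (ang u)"
  have "v \<in> neighbours G u" if v: "v < N" "ang v \<in> sector M ?s" "v \<noteq> u" for v
  proof (rule same_sector_adjacent[OF u(1) v(1) _ M(1)])
    have "(- r1) / 2 \<le> (R - rad u - rad v) / 2" using u rad[OF v(1)] by simp
    then have "exp (- r1 / 2) \<le> exp ((R - rad u - rad v) / 2)" by simp
    then show "2 * pi / M \<le> exp ((R - rad u - rad v) / 2)" using M(2) by linarith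
    show "ang u \<in> sector M ?s" using mem_sector_slot[OF M(1) ang[OF u(1)]] .
    show "\<bar>rad u - rad v\<bar> \<le> R - 1" using u r1 rad[OF v(1)] by (simp add: abs_if)
  qed (use v in auto)
  then have "card ({i. i < N \<and> ang i \<in> sector M ?s} - {u}) \<le> card (neighbours G u)"
    by (intro card_mono) auto
  also have "\<dots> \<le> max_degree G" using u by (intro card_neighbours_le_max_degree) auto
  finally have "card {i. i < N \<and> ang i \<in> sector M ?s} \<le> max_degree G + 1"
    using card_Diff1_le[of "{i. i < N \<and> ang i \<in> sector M ?s}" u]
      diff_card_le_card_Diff[of "{u}" "{i. i < N \<and> ang i \<in> sector M ?s}"] by simp
  then show ?thesis using count[OF slot_less[OF M(1) ang[OF u(1)]]] by linarith
qed

lemma max_degree_le: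
  assumes "\<And>i. i < N \<Longrightarrow> r0 \<le> rad i"
  shows "real (max_degree G) \<le> deg_factor * exp ((R - r0) / 2)"
proof (rule max_degree_leI)
  fix v assume v: "v \<in> verts G"
  then have "real (layer v) / 2 \<le> (R - r0) / 2" using layer(1)[of v] assms[of v] by simp
  then have "deg_factor * exp (layer v / 2) \<le> deg_factor * exp ((R - r0) / 2)"
    using deg_factor_nonneg by (intro mult_left_mono) auto
  then show "real (card (neighbours G v)) \<le> deg_factor * exp ((R - r0) / 2)"
    using degree_le[of v] v by auto
qed (use deg_factor_nonneg in auto)

text \<open>Every point of \<open>S\<close> other than the representative of its sector is adjacent to the
  representative.\<close>

lemma ex_many_with_outside_neighbour:
  fixes M :: nat
  assumes b: "1 \<le> b" and M: "0 < M" "2 * pi / M \<le> exp ((2 * b - R) / 2)"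
  defines "S \<equiv> {i. i < N \<and> rad i \<le> R - b}"
  shows "\<exists>A h. A \<subseteq> verts G \<and> real (card S) - M \<le> card A \<and> (\<forall>a\<in>A. h a \<in> neighbours G a - A)"
proof -
  let ?f = "\<lambda>i. slot M (ang i)"
  define rep where "rep s = (SOME i. i \<in> S \<and> ?f i = s)" for s
  have rep: "rep (?f i) \<in> S \<and> ?f (rep (?f i)) = ?f i" if "i \<in> S" for i
    unfolding rep_def by (rule someI[of _ i]) (use that in simp)
  define A where "A = S - rep ` {..<M}"
  have finS: "finite S" by (simp add: S_def)
  have "card S - card (rep ` {..<M}) \<le> card A" unfolding A_def by (rule diff_card_le_card_Diff) simp
  moreover have "card (rep ` {..<M}) \<le> M" using card_image_le[of "{..<M}" rep] by simp
  ultimately have "real (card S) - M \<le> card A" by linarith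
  moreover have "rep (?f a) \<in> neighbours G a - A" if a: "a \<in> A" for a
  proof
    have aS: "a \<in> S" and aN: "a < N" using a by (auto simp: A_def S_def)
    have fa: "?f a < M" using slot_less[OF M(1) ang[OF aN]] .
    show "rep (?f a) \<notin> A" using fa by (auto simp: A_def)
    let ?v = "rep (?f a)"
    have vS: "?v \<in> S" "?f ?v = ?f a" using rep[OF aS] by auto
    have vN: "?v < N" using vS by (auto simp: S_def)
    show "?v \<in> neighbours G a"
    proof (rule same_sector_adjacent[OF aN vN _ M(1)])
      show "a \<noteq> ?v" using a fa by (auto simp: A_def)
      have "(2 * b - R) / 2 \<le> (R - rad a - rad ?v) / 2" using aS vS by (simp add: S_def)
      then have "exp ((2 * b - R) / 2) \<le> exp ((R - rad a - rad ?v) / 2)" by simp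
      then show "2 * pi / M \<le> exp ((R - rad a - rad ?v) / 2)" using M(2) by linarith
      show "ang a \<in> sector M (?f a)" using mem_sector_slot[OF M(1) ang[OF aN]] .
      show "ang ?v \<in> sector M (?f a)" using mem_sector_slot[OF M(1) ang[OF vN]] vS(2) by simp
      show "\<bar>rad a - rad ?v\<bar> \<le> R - 1" using aS vS b rad[OF aN] rad[OF vN] by (auto simp: S_def abs_if)
    qed
  qed
  moreover have "A \<subseteq> verts G" by (auto simp: A_def S_def)
  ultimately show ?thesis by (intro exI[of _ A] exI[of _ "\<lambda>a. rep (?f a)"]) auto
qed

text \<open>The quotient of the maximum degree by the number of colours is at most
  \<open>2 / \<epsilon>\<close>, whatever the degree is, so the palette factor is the constant
  \<open>exp (4 / \<epsilon>)\<close>. The upper bound on the degree enters only the first-round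
  error, the lower bound only the second-round error.\<close>

lemma rct_terminates_after_2_ge:
  fixes M1 M2 :: nat and \<epsilon> r0 r1 b l1 l2 :: real
  assumes eps: "0 < \<epsilon>"
    and r0: "\<And>i. i < N \<Longrightarrow> r0 \<le> rad i"
    and u: "u < N" "1 \<le> rad u" "rad u \<le> r1" and r1: "r1 \<le> R - 1"
    and M1: "0 < M1" "2 * pi / M1 \<le> exp (- r1 / 2)"
    and count1: "\<And>s. s < M1 \<Longrightarrow> l1 \<le> real (card {i. i < N \<and> ang i \<in> sector M1 s})"
    and b: "1 \<le> b" and M2: "0 < M2" "2 * pi / M2 \<le> exp ((2 * b - R) / 2)"
    and count2: "l2 \<le> real (card {i. i < N \<and> rad i \<le> R - b})" and l2: "M2 \<le> l2"
    and large: "4 \<le> \<epsilon> * (l1 - 1)"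
  shows "rct_prob G {..<nat \<lfloor>\<epsilon> * real (max_degree G)\<rfloor>} (terminates_after G 2) \<ge> 1
    - exp (- (l2 - M2) / (\<epsilon> * (deg_factor * exp ((R - r0) / 2))))
    - 8 * ((R + 1) * (\<beta> * deg_factor * (exp (R / 2) + 4 * real n))) * (4 + inner_bound) * exp (4 / \<epsilon>)
        / (\<epsilon> * (l1 - 1))\<^sup>2"
proof -
  let ?\<Delta> = "max_degree G"
  define k where "k = nat \<lfloor>\<epsilon> * real ?\<Delta>\<rfloor>"
  let ?S = "real (\<Sum>u<N. card (neighbours G u))"
  let ?hi = "deg_factor * exp ((R - r0) / 2)"
  obtain A h where A: "A \<subseteq> verts G" "real (card {i. i < N \<and> rad i \<le> R - b}) - M2 \<le> card A"
    "\<And>a. a \<in> A \<Longrightarrow> h a \<in> neighbours G a - A"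
    using ex_many_with_outside_neighbour[OF b M2] by blast
  have D1: "l1 - 1 \<le> real ?\<Delta>" by (rule max_degree_ge[OF u r1 M1 count1])
  have D2: "real ?\<Delta> \<le> ?hi" by (rule max_degree_le[OF r0])
  have lo: "\<epsilon> * (l1 - 1) \<le> \<epsilon> * real ?\<Delta>" using D1 eps by (intro mult_left_mono) auto
  have "real k = real_of_int \<lfloor>\<epsilon> * real ?\<Delta>\<rfloor>" using eps by (simp add: k_def)
  \<comment> \<open>Rounding down costs less than 1, hence at most half of
    \<open>\<epsilon> * real ?\<Delta>\<close> by \<open>large\<close>.\<close>
  then have k1: "real k \<le> \<epsilon> * real ?\<Delta>" "\<epsilon> * real ?\<Delta> - 1 < real k" by linarith+
  then have k2: "\<epsilon> * real ?\<Delta> / 2 \<le> real k" "\<epsilon> * (l1 - 1) / 2 \<le> real k" "2 \<le> real k"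
    using lo large by linarith+
  have k_hi: "real k \<le> \<epsilon> * ?hi" using k1(1) mult_left_mono[OF D2, of \<epsilon>] eps by linarith
  have "0 < \<epsilon> * real ?\<Delta>" using lo large by linarith
  then have Dpos: "0 < real ?\<Delta>" using eps by (simp add: zero_less_mult_iff)
  have hi_pos: "0 < ?hi" using Dpos D2 by linarith
  let ?I = "\<lambda>v. {u\<in>neighbours G v. rad u \<le> rad v}"
  define \<kappa> where "\<kappa> = nat \<lfloor>inner_bound\<rfloor>"
  have \<kappa>: "real \<kappa> \<le> inner_bound" using inner_bound_nonneg by (simp add: \<kappa>_def)
  have main: "rct_prob G {..<k} (terminates_after G 2) \<ge> 1 - exp (- real (card A) / card {..<k})
    - 2 * real (\<Sum>v\<in>verts G. card (neighbours G v)) * (4 + real \<kappa>) * exp (2 * real ?\<Delta> / card {..<k}) / (real (card {..<k}))\<^sup>2"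
  proof (rule rct_terminates_after_2[where I = ?I and h = h])
    show "verts G \<noteq> {}" using u by auto
    show "v \<notin> neighbours G v" for v by (simp add: mem_neighbours_iff)
    show "u \<in> ?I v \<or> v \<in> ?I u" if "u \<in> neighbours G v" for u v
      using that neighbours_sym[of u v] by auto
    show "card (?I v) \<le> \<kappa>" if "v \<in> verts G" for v
      using inner_degree_le[of v] that unfolding \<kappa>_def by (simp add: le_nat_floor)
    show "2 \<le> card {..<k}" using k2(3) by simp
    show "card (neighbours G v) \<le> ?\<Delta>" if "v \<in> verts G" for v
      using that by (intro card_neighbours_le_max_degree) auto
  qed (use A in auto)
  have 1: "exp (- real (card A) / real k) \<le> exp (- (l2 - M2) / (\<epsilon> * ?hi))"
  proof -
    have "(l2 - M2) / (\<epsilon> * ?hi) \<le> (l2 - M2) / real k"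
    proof (rule divide_left_mono[OF k_hi])
      have "0 < \<epsilon> * ?hi" using eps hi_pos by (rule mult_pos_pos)
      moreover have "0 < real k" using k2(3) by linarith
      ultimately show "0 < \<epsilon> * ?hi * real k" by (rule mult_pos_pos)
    qed (use l2 in simp)
    also have "\<dots> \<le> real (card A) / real k" using A(2) count2 by (intro divide_right_mono) auto
    finally show ?thesis by (simp only: exp_le_cancel_iff minus_divide_left[symmetric] neg_le_iff_le)
  qed
  have 2: "2 * ?S * (4 + real \<kappa>) * exp (2 * real ?\<Delta> / real k) / (real k)\<^sup>2 \<le>
      2 * ((R + 1) * (\<beta> * deg_factor * (exp (R / 2) + 4 * real n))) * (4 + inner_bound) * exp (4 / \<epsilon>) / (\<epsilon> * (l1 - 1) / 2)\<^sup>2"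
  proof (intro frac_le mult_mono)
    have "2 * real ?\<Delta> / real k \<le> 2 * real ?\<Delta> / (\<epsilon> * real ?\<Delta> / 2)"
      using k2 eps Dpos by (intro divide_left_mono mult_pos_pos) auto
    also have "\<dots> = 4 / \<epsilon>" using Dpos eps by (simp add: field_simps)
    finally show "exp (2 * real ?\<Delta> / real k) \<le> exp (4 / \<epsilon>)" by simp
    show "?S \<le> (R + 1) * (\<beta> * deg_factor * (exp (R / 2) + 4 * real n))" by (rule sum_degree_le)
    show "(\<epsilon> * (l1 - 1) / 2)\<^sup>2 \<le> (real k)\<^sup>2" using k2(2) large by (intro power_mono) auto
    show "0 < (\<epsilon> * (l1 - 1) / 2)\<^sup>2" using large by auto
    show "4 + real \<kappa> \<le> 4 + inner_bound" using \<kappa> by simp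
  qed (use R beta deg_factor_nonneg inner_bound_nonneg in \<open>auto intro!: mult_nonneg_nonneg sum_nonneg\<close>)
  have eq: "2 * ((R + 1) * (\<beta> * deg_factor * (exp (R / 2) + 4 * real n))) * (4 + inner_bound) * exp (4 / \<epsilon>) / (\<epsilon> * (l1 - 1) / 2)\<^sup>2
    = 8 * ((R + 1) * (\<beta> * deg_factor * (exp (R / 2) + 4 * real n))) * (4 + inner_bound) * exp (4 / \<epsilon>) / (\<epsilon> * (l1 - 1))\<^sup>2"
    by (simp add: power_divide)
  show ?thesis
    using main 1 2[unfolded eq] unfolding k_def[symmetric] verts_G card_lessThan by linarith
qed

end

section \<open>Core, blockers and the deterministic form of part 2\<close>

lemma exp_half_le_2: "exp (1 / 2) \<le> (2::real)"
proof (rule power2_le_imp_le)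
  have "(exp (1 / 2))\<^sup>2 = exp (1::real)" by (rule exp_half_squared)
  also have "\<dots> \<le> 2\<^sup>2" using exp_le by simp
  finally show "(exp (1 / 2))\<^sup>2 \<le> (2::real)\<^sup>2" .
qed simp

definition slot_pairs :: "nat \<Rightarrow> (nat \<times> nat) set" where
  "slot_pairs M = Sigma {..<M} (adjacent_slots M)"

lemma finite_slot_pairs [simp]: "finite (slot_pairs M)"
  by (auto simp: slot_pairs_def adjacent_slots_def)

lemma card_slot_pairs: "card (slot_pairs M) \<le> 3 * M"
proof -
  have "card (slot_pairs M) = (\<Sum>s<M. card (adjacent_slots M s))"
    unfolding slot_pairs_def by (rule card_SigmaI) (auto simp: adjacent_slots_def)
  also have "\<dots> \<le> (\<Sum>s<M. 3)" by (intro sum_mono card_adjacent_slots)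
  finally show ?thesis by simp
qed

definition core_box :: "real \<Rightarrow> nat \<Rightarrow> nat \<Rightarrow> (real \<times> real) set" where
  "core_box R M s = {0..R / 2} \<times> sector M s"

text \<open>Open at \<open>R / 2\<close> to be disjoint from the core boxes, which makes the two
  counts independent.\<close>

definition collar_box :: "real \<Rightarrow> real \<Rightarrow> nat \<Rightarrow> nat \<Rightarrow> (real \<times> real) set" where
  "collar_box R \<zeta> M s = {R / 2<..(1 + \<zeta>) * R / 2} \<times> sector M s"

context hrg_config
begin

lemma deg_factor_ge_1: "1 \<le> deg_factor"
proof -
  have "1 * 1 * 1 \<le> (3 * \<beta>) * (R + 1) * (1 + 96 * real n * exp (- R / 2))"
    using beta R by (intro mult_mono) auto
  then show ?thesis by (simp add: deg_factor_def)
qed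

lemma outer_degree_le:
  assumes "w < N" "R - 1 \<le> rad w"
  shows "real (card (neighbours G w)) \<le> 2 * deg_factor"
proof -
  have "real (layer w) \<le> 1" using layer(1)[OF assms(1)] assms(2) by linarith
  then have "exp (layer w / 2) \<le> exp (1 / 2 :: real)" by simp
  also note exp_half_le_2
  finally have "deg_factor * exp (layer w / 2) \<le> deg_factor * 2"
    using deg_factor_nonneg by (intro mult_left_mono) auto
  then show ?thesis using degree_le[OF assms(1)] by simp
qed

definition "core = {i. i < N \<and> rad i \<le> R / 2}"

text \<open>The exceptional set \<open>B\<close>: points just outside the core that may see boundary
  points in the sector of a core vertex. An edge from beyond radius \<open>R / 2\<close> to radius
  at least \<open>R - 1\<close> spans at most \<open>24 * exp (1 / 2) * exp (- R / 4)\<close>, below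
  48 units of \<open>exp (- R / 4)\<close>; one more unit is the sector width.\<close>

definition "blockers \<zeta> = {x. x < N \<and> R / 2 < rad x \<and> rad x \<le> (1 + \<zeta>) * R / 2 \<and>
  (\<exists>v\<in>core. near (49 * exp (- R / 4)) (ang x) (ang v))}"

lemma core_clique: "u \<in> core \<Longrightarrow> v \<in> core \<Longrightarrow> u \<noteq> v \<Longrightarrow> u \<in> neighbours G v"
  using rad by (auto simp: core_def mem_neighbours_iff X_eq intro!: small_radii_imp_hyp_dist_le)

text \<open>A blocker lies in a collar sector next to an occupied core sector. Few such pairs of
  sectors are occupied, and each collar sector holds at most \<open>l\<close> points.\<close>

lemma card_blockers_le:
  assumes M: "0 < M" "49 * exp (- R / 4) \<le> 2 * pi / M"
    and countL: "\<And>s. s < M \<Longrightarrow> real (points_in (collar_box R \<zeta> M s) (N, X)) \<le> l" and l: "0 \<le> l"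
    and pairs: "real (card {p\<in>slot_pairs M. points_in (collar_box R \<zeta> M (fst p)) (N, X) \<noteq> 0 \<and>
      points_in (core_box R M (snd p)) (N, X) \<noteq> 0}) \<le> p"
  shows "real (card (blockers \<zeta>)) \<le> l * p"
proof -
  let ?P = "{p\<in>slot_pairs M. points_in (collar_box R \<zeta> M (fst p)) (N, X) \<noteq> 0 \<and>
      points_in (core_box R M (snd p)) (N, X) \<noteq> 0}"
  let ?L = "\<lambda>s. {i. i < N \<and> X i \<in> collar_box R \<zeta> M s}"
  have "blockers \<zeta> \<subseteq> (\<Union>p\<in>?P. ?L (fst p))"
  proof
    fix x assume "x \<in> blockers \<zeta>"
    then obtain v where x: "x < N" "R / 2 < rad x" "rad x \<le> (1 + \<zeta>) * R / 2" and v: "v < N" "rad v \<le> R / 2"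
      and near: "near (49 * exp (- R / 4)) (ang x) (ang v)" by (auto simp: blockers_def core_def)
    let ?p = "(slot M (ang x), slot M (ang v))"
    have "?p \<in> slot_pairs M"
      using near_adjacent_slots[OF M(1) ang[OF x(1)] ang[OF v(1)] near M(2)] slot_less[OF M(1) ang[OF x(1)]]
      by (simp add: slot_pairs_def)
    moreover have xL: "x \<in> ?L (slot M (ang x))"
      using x mem_sector_slot[OF M(1) ang[OF x(1)]] by (simp add: collar_box_def X_eq)
    moreover have "v \<in> {i. i < N \<and> X i \<in> core_box R M (slot M (ang v))}"
      using v rad(1)[OF v(1)] mem_sector_slot[OF M(1) ang[OF v(1)]] by (simp add: core_box_def X_eq)
    moreover have "points_in B (N, X) \<noteq> 0" if "i \<in> {i. i < N \<and> X i \<in> B}" for i B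
      using that by (auto simp: points_in_def card_eq_0_iff)
    ultimately have "?p \<in> ?P" by simp
    then show "x \<in> (\<Union>p\<in>?P. ?L (fst p))" using xL by force
  qed
  then have "card (blockers \<zeta>) \<le> card (\<Union>p\<in>?P. ?L (fst p))" by (intro card_mono) auto
  also have "\<dots> \<le> (\<Sum>p\<in>?P. card (?L (fst p)))" by (intro card_UN_le) auto
  finally have "real (card (blockers \<zeta>)) \<le> (\<Sum>p\<in>?P. real (card (?L (fst p))))"
    by (simp flip: of_nat_sum)
  also have "\<dots> \<le> (\<Sum>p\<in>?P. l)"
    using countL by (intro sum_mono) (auto simp: slot_pairs_def points_in_def)
  also have "\<dots> \<le> l * p" using mult_right_mono[OF pairs l] by (simp add: mult.commute)
  finally show ?thesis .
qed

text \<open>A core vertex is adjacent to all boundary-layer points of its sector of width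
  \<open>exp (- R / 4)\<close>. Those points have small degree, so a large independent subset of
  them serves as \<open>W v\<close>.\<close>

lemma rct_never_terminates_ge:
  fixes M0 M1 k :: nat and \<zeta> l0 lB pB lK k_hi Nb :: real
  assumes rad1: "\<And>i. i < N \<Longrightarrow> 1 \<le> rad i"
    and zeta: "0 < \<zeta>" "(1 + \<zeta>) * R / 2 < R - 1"
    and M0: "0 < M0" "2 * pi / M0 \<le> exp (- R / 4)"
    and count0: "\<And>s. s < M0 \<Longrightarrow> l0 \<le> real (card {i. i < N \<and> X i \<in> hbox R M0 0 s})"
    and M1: "0 < M1" "49 * exp (- R / 4) \<le> 2 * pi / M1"
    and countL: "\<And>s. s < M1 \<Longrightarrow> real (points_in (collar_box R \<zeta> M1 s) (N, X)) \<le> lB" and lB: "0 \<le> lB"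
    and pairs: "real (card {p\<in>slot_pairs M1. points_in (collar_box R \<zeta> M1 (fst p)) (N, X) \<noteq> 0 \<and>
      points_in (core_box R M1 (snd p)) (N, X) \<noteq> 0}) \<le> pB"
    and lK: "lK \<le> real (card {i. i < N \<and> rad i \<le> R / 2})" "2 * (lB * pB) + 4 \<le> lK"
    and k: "8 * deg_factor \<le> real k" "real k \<le> k_hi" and Nb: "real N \<le> Nb"
  shows "rct_prob G {..<k} (never_terminates G) \<ge> 1
    - Nb powr (lB * pB) * exp (- lK\<^sup>2 / (8 * k_hi))
    - Nb * k_hi * exp (- (l0 / (2 * deg_factor + 1)) / (2 * max k_hi (deg_factor * exp ((1 - \<zeta>) * R / 4))))"
proof -
  let ?N = "neighbours G" and ?B = "blockers \<zeta>"
  let ?D = "deg_factor * exp ((1 - \<zeta>) * R / 4)"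
  let ?bot = "\<lambda>s. {i. i < N \<and> X i \<in> hbox R M0 0 s}"
  let ?s = "\<lambda>v. slot M0 (ang v)"
  \<comment> \<open>A vertex outside \<open>core\<close> and \<open>?B\<close> either has radius in
    the collar range and sees nothing of \<open>W v\<close>, or has degree at most
    \<open>?D\<close>. The scale must also dominate the number of colours, hence
    \<open>k_hi\<close>.\<close>
  define M where "M = max k_hi ?D"
  define w where "w = l0 / (2 * deg_factor + 1)"
  have kpos: "0 < real k" using k(1) deg_factor_ge_1 by linarith
  have bot: "u < N" "R - 1 \<le> rad u" "ang u \<in> sector M0 s" if "u \<in> ?bot s" for u s
    using that by (auto simp: hbox_def X_eq)
  have coreN: "v < N" "rad v \<le> R / 2" if "v \<in> core" for v using that by (auto simp: core_def)
  have card_B: "real (card ?B) \<le> lB * pB" by (rule card_blockers_le[OF M1 countL lB pairs])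
  have card_K: "lK \<le> real (card core)" using lK(1) by (simp add: core_def)
  have BK: "2 * real (card ?B) + 4 \<le> real (card core)" using card_B card_K lK(2) by linarith
  have half_lt: "R / 2 < R - 1"
  proof -
    have "0 < \<zeta> * R / 2" using zeta(1) R by simp
    moreover have "(1 + \<zeta>) * R / 2 = R / 2 + \<zeta> * R / 2" by (simp add: field_simps)
    ultimately show ?thesis using zeta(2) by linarith
  qed
  have bot_adj: "u \<in> ?N v" if v: "v \<in> core" and u: "u \<in> ?bot (?s v)" for u v
  proof (rule same_sector_adjacent[OF coreN(1)[OF v] bot(1)[OF u] _ M0(1)])
    show "v \<noteq> u" using coreN(2)[OF v] bot(2)[OF u] half_lt by auto
    have "(- R / 2) / 2 \<le> (R - rad v - rad u) / 2"
      using coreN[OF v] rad(2)[OF bot(1)[OF u]] by (intro divide_right_mono) auto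
    then have "exp (- R / 4) \<le> exp ((R - rad v - rad u) / 2)" by simp
    then show "2 * pi / M0 \<le> exp ((R - rad v - rad u) / 2)" using M0(2) by linarith
    show "ang v \<in> sector M0 (?s v)" using mem_sector_slot[OF M0(1) ang[OF coreN(1)[OF v]]] .
    show "ang u \<in> sector M0 (?s v)" using bot(3)[OF u] .
    show "\<bar>rad v - rad u\<bar> \<le> R - 1"
      using coreN[OF v] rad1[OF coreN(1)[OF v]] rad(2)[OF bot(1)[OF u]] bot(2)[OF u] half_lt R by (simp add: abs_if)
  qed
  have "\<exists>I. I \<subseteq> ?bot (?s v) \<and> w \<le> card I \<and> (\<forall>u\<in>I. \<forall>u'\<in>I. u' \<notin> ?N u)" if v: "v \<in> core" for v
  proof -
    define dd where "dd = nat \<lfloor>2 * deg_factor\<rfloor>"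
    have dd: "real dd \<le> 2 * deg_factor" using deg_factor_nonneg by (simp add: dd_def)
    have "card {u'\<in>?bot (?s v). u' \<in> ?N u} \<le> dd" if u: "u \<in> ?bot (?s v)" for u
    proof -
      have "card {u'\<in>?bot (?s v). u' \<in> ?N u} \<le> card (?N u)" by (intro card_mono) auto
      moreover have "card (?N u) \<le> dd"
        using outer_degree_le[OF bot(1,2)[OF u]] unfolding dd_def by (rule le_nat_floor)
      ultimately show ?thesis by linarith
    qed
    then have "\<exists>I\<subseteq>?bot (?s v). card (?bot (?s v)) \<le> card I * (dd + 1) \<and> (\<forall>u\<in>I. \<forall>u'\<in>I. \<not> u' \<in> ?N u)"
      by (intro independent_subset) (auto simp: neighbours_sym mem_neighbours_iff hyp_dist_sym)
    then obtain I where I: "I \<subseteq> ?bot (?s v)" "card (?bot (?s v)) \<le> card I * (dd + 1)" "\<forall>u\<in>I. \<forall>u'\<in>I. u' \<notin> ?N u"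
      by blast
    have "l0 \<le> real (card (?bot (?s v)))"
      using count0 slot_less[OF M0(1) ang[OF coreN(1)[OF v]]] by blast
    also have "\<dots> \<le> real (card I * (dd + 1))" using I(2) by (rule of_nat_mono)
    also have "\<dots> = real (card I) * (real dd + 1)" by (simp add: algebra_simps)
    also have "\<dots> \<le> real (card I) * (2 * deg_factor + 1)"
      using dd by (intro mult_left_mono) auto
    finally have "w \<le> card I" unfolding w_def using deg_factor_nonneg by (simp add: divide_le_eq)
    then show ?thesis using I by blast
  qed
  then have "\<forall>v\<in>core. \<exists>I. I \<subseteq> ?bot (?s v) \<and> w \<le> card I \<and> (\<forall>u\<in>I. \<forall>u'\<in>I. u' \<notin> ?N u)" by (rule ballI)
  from bchoice[OF this] obtain W
    where W_all: "\<forall>v\<in>core. W v \<subseteq> ?bot (?s v) \<and> w \<le> card (W v) \<and> (\<forall>u\<in>W v. \<forall>u'\<in>W v. u' \<notin> ?N u)"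
    by (rule exE)
  have W: "W v \<subseteq> ?bot (?s v)" "w \<le> card (W v)" if "v \<in> core" for v
    using bspec[OF W_all that] by (simp_all only:)
  have W_indep: "u' \<notin> ?N u" if "v \<in> core" "u \<in> W v" "u' \<in> W v" for v u u'
    using bspec[OF W_all that(1)] that(2,3) by blast
  have spread: "real (card (?N y \<inter> W v)) \<le> M" if v: "v \<in> core" and y: "y \<in> verts G - (core \<union> ?B)" for v y
  proof (cases "rad y \<le> (1 + \<zeta>) * R / 2")
    case True
    have "?N y \<inter> W v = {}"
    proof (rule ccontr)
      assume "?N y \<inter> W v \<noteq> {}"
      then obtain u where u: "u \<in> ?N y" "u \<in> ?bot (?s v)" using W(1)[OF v] by blast
      have yN: "y < N" "R / 2 < rad y" using y by (auto simp: core_def)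
      have "near (24 * exp ((R - rad y - rad u) / 2)) (ang y) (ang u)" by (rule adjacent_near[OF u(1)])
      moreover have "24 * exp ((R - rad y - rad u) / 2) \<le> 48 * exp (- R / 4)"
      proof -
        have "(R - rad y - rad u) / 2 \<le> (1 - R / 2) / 2"
          using yN bot(2)[OF u(2)] by (intro divide_right_mono) auto
        also have "(1 - R / 2) / 2 = 1 / 2 + - R / 4" by (simp add: field_simps)
        finally have "exp ((R - rad y - rad u) / 2) \<le> exp (1 / 2) * exp (- R / 4)"
          by (simp only: exp_le_cancel_iff flip: exp_add)
        also have "\<dots> \<le> 2 * exp (- R / 4)"
          by (intro mult_right_mono exp_half_le_2) simp
        finally show ?thesis by simp
      qed
      ultimately have n1: "near (48 * exp (- R / 4)) (ang y) (ang u)" by (rule near_mono)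
      have "\<bar>ang u - ang v\<bar> \<le> 2 * pi / M0"
        using sector_width[OF M0(1) bot(3)[OF u(2)] mem_sector_slot[OF M0(1) ang[OF coreN(1)[OF v]]]] .
      then have n2: "near (exp (- R / 4)) (ang u) (ang v)" using M0(2) by (auto simp: near_def)
      have "near (48 * exp (- R / 4) + exp (- R / 4)) (ang y) (ang v)"
        by (rule near_trans[OF n1 n2]) (use ang yN bot(1)[OF u(2)] coreN(1)[OF v] in auto)
      then have "near (49 * exp (- R / 4)) (ang y) (ang v)" by simp
      then have "y \<in> ?B" using yN True v by (auto simp: blockers_def)
      then show False using y by blast
    qed
    moreover have "0 \<le> M" using kpos k(2) by (simp add: M_def)
    ultimately show ?thesis by simp
  next
    case False
    have yN: "y < N" using y by simp
    have "card (?N y \<inter> W v) \<le> card (?N y)" by (intro card_mono) auto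
    then have "real (card (?N y \<inter> W v)) \<le> deg_factor * exp (layer y / 2)" using degree_le[OF yN] by linarith
    also have "\<dots> \<le> ?D"
    proof -
      have "real (layer y) \<le> (1 - \<zeta>) * R / 2"
      proof -
        have "(1 + \<zeta>) * R / 2 + (1 - \<zeta>) * R / 2 = R" by (simp add: field_simps)
        then show ?thesis using layer(1)[OF yN] False by linarith
      qed
      then have "exp (layer y / 2) \<le> exp ((1 - \<zeta>) * R / 4)" by simp
      then show ?thesis using deg_factor_nonneg by (intro mult_left_mono) auto
    qed
    finally show ?thesis by (simp add: M_def)
  qed
  have "rct_prob G {..<k} (never_terminates G) \<ge> 1
    - real (card core) ^ card ?B * exp (- real ((card core - card ?B) * (card core - card ?B - 1)) / (2 * real (card {..<k})))
    - real (card core) * real (card {..<k}) * exp (- w / (2 * M))"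
  proof (rule rct_never_terminates[where W = W and d = "2 * deg_factor"])
    show "{..<k} \<noteq> {}" using kpos by auto
    show "core \<subseteq> verts G" by (auto simp: core_def)
    show "core \<noteq> {}" using BK by auto
    show "?B \<subseteq> verts G" by (auto simp: blockers_def)
    show "card ?B \<le> card core" using BK by linarith
    show "u \<in> ?N v" if "u \<in> core" "v \<in> core" "u \<noteq> v" for u v using core_clique[OF that] .
    show "W v \<subseteq> ?N v" if "v \<in> core" for v using bot_adj[OF that] W(1)[OF that] by blast
    show "W v \<inter> (core \<union> ?B) = {}" if "v \<in> core" for v
    proof -
      have "u \<notin> core \<union> ?B" if "u \<in> W v" for u
      proof -
        have "R - 1 \<le> rad u" using bot(2) W(1)[OF \<open>v \<in> core\<close>] that by blast
        then show ?thesis using half_lt zeta(2) by (auto simp: core_def blockers_def)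
      qed
      then show ?thesis by blast
    qed
    show "real (card (?N u - (core \<union> ?B))) \<le> 2 * deg_factor" if "v \<in> core" "u \<in> W v" for v u
    proof -
      have "card (?N u - (core \<union> ?B)) \<le> card (?N u)" by (intro card_mono) auto
      moreover have "u \<in> ?bot (?s v)" using W(1)[OF that(1)] that(2) by blast
      ultimately show ?thesis using outer_degree_le[OF bot(1,2)] by force
    qed
    show "real (card {..<k}) \<le> M" using k(2) by (simp add: M_def)
    show "4 * (2 * deg_factor) \<le> real (card {..<k})" using k(1) by simp
    show "u' \<notin> ?N u" if "v \<in> core" "u \<in> W v" "u' \<in> W v" for v u u' using W_indep[OF that] .
    show "w \<le> real (card (W v))" if "v \<in> core" for v using W(2)[OF that] .
    show "real (card (?N y \<inter> W v)) \<le> M" if "v \<in> core" "y \<in> verts G - (core \<union> ?B)" for v y using spread[OF that] .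
  qed auto
  then have main: "rct_prob G {..<k} (never_terminates G) \<ge> 1
    - real (card core) ^ card ?B * exp (- real ((card core - card ?B) * (card core - card ?B - 1)) / (2 * real k))
    - real (card core) * real k * exp (- w / (2 * M))"
    by simp
  have core_le: "real (card core) \<le> Nb"
  proof -
    have "card core \<le> card {..<N}" by (intro card_mono) (auto simp: core_def)
    then show ?thesis using Nb by simp
  qed
  have core_ge: "1 \<le> real (card core)" using BK by linarith
  have 1: "real (card core) ^ card ?B * exp (- real ((card core - card ?B) * (card core - card ?B - 1)) / (2 * real k))
      \<le> Nb powr (lB * pB) * exp (- lK\<^sup>2 / (8 * k_hi))"
  proof (rule mult_mono)
    have "real (card core) ^ card ?B = real (card core) powr real (card ?B)"
      using core_ge by (simp add: powr_realpow)
    also have "\<dots> \<le> Nb powr real (card ?B)" using core_le core_ge by (intro powr_mono2) auto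
    also have "\<dots> \<le> Nb powr (lB * pB)" using core_le core_ge card_B by (intro powr_mono) auto
    finally show "real (card core) ^ card ?B \<le> Nb powr (lB * pB)" .
    have "lK\<^sup>2 / (8 * k_hi) \<le> lK\<^sup>2 / (8 * real k)"
      using k(2) kpos by (intro divide_left_mono) auto
    also have "\<dots> = (lK / 2)\<^sup>2 / (2 * real k)" by (simp add: power_divide)
    also have "\<dots> \<le> real ((card core - card ?B) * (card core - card ?B - 1)) / (2 * real k)"
    proof (rule divide_right_mono)
      have "0 \<le> lK" using lK(2) card_B by linarith
      \<comment> \<open>By \<open>BK\<close>, removing \<open>card ?B + 1\<close> vertices leaves
        more than half of the core.\<close>
      have "lK / 2 \<le> real (card core - card ?B)" "lK / 2 \<le> real (card core - card ?B - 1)"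
        using BK card_K by linarith+
      then have "lK / 2 * (lK / 2) \<le> real (card core - card ?B) * real (card core - card ?B - 1)"
        using \<open>0 \<le> lK\<close> by (intro mult_mono) auto
      then show "(lK / 2)\<^sup>2 \<le> real ((card core - card ?B) * (card core - card ?B - 1))"
        by (simp add: power2_eq_square)
    qed (use kpos in simp)
    finally show "exp (- real ((card core - card ?B) * (card core - card ?B - 1)) / (2 * real k)) \<le> exp (- lK\<^sup>2 / (8 * k_hi))"
      by simp
  qed auto
  have 2: "real (card core) * real k * exp (- w / (2 * M)) \<le> Nb * k_hi * exp (- w / (2 * M))"
    using core_le core_ge k(2) by (intro mult_right_mono mult_mono) auto
  show ?thesis using main 1 2 unfolding w_def M_def by linarith
qed

end

subsection \<open>Probabilities of exceptional configurations\<close>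

lemma sector_1_0: "sector 1 0 = {0..<2 * pi}"
  by (simp add: sector_def)

lemma sector_box_borel [simp]: "{a..b} \<times> sector M s \<in> sets (borel :: (real \<times> real) measure)"
  unfolding sector_def by (rule box_borel)

lemma half_open_sector_box_borel [simp]: "{a<..b} \<times> sector M s \<in> sets (borel :: (real \<times> real) measure)"
  unfolding borel_prod[symmetric] sector_def by (intro pair_measureI) auto

locale hrg_params =
  fixes \<alpha> C :: real and n :: nat
  assumes alpha: "1 / 2 < \<alpha>" "\<alpha> < 1" and R4: "4 \<le> hrg_radius C n" and n: "0 < n"
begin

abbreviation "R \<equiv> hrg_radius C n"
abbreviation "\<mu> \<equiv> hrg_intensity \<alpha> C n"
abbreviation "PP \<equiv> poisson_process \<mu>"

lemma alpha_pos: "0 < \<alpha>" and R_pos: "0 < R"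
  using alpha R4 by auto

lemmas finite_mu = finite_measure_hrg_intensity[OF alpha_pos R_pos n]
  and mu_pos = measure_hrg_intensity_pos[OF alpha_pos R_pos n]

sublocale PP: prob_space PP
  using finite_mu mu_pos by (rule prob_space_poisson_process)

lemmas events_points_in = sets_points_in[OF finite_mu mu_pos]

lemma measure_sector_box:
  assumes "0 \<le> a" "a \<le> b" "b \<le> R" "s < M"
  shows "measure \<mu> ({a..b} \<times> sector M s) = n / M * ((cosh (\<alpha> * b) - cosh (\<alpha> * a)) / (cosh (\<alpha> * R) - 1))"
proof -
  define c d where "c = 2 * pi * s / M" and "d = 2 * pi * (real s + 1) / M"
  have d: "d \<le> 2 * pi"
  proof -
    have "real s + 1 \<le> real M" using assms(4) by simp
    then have "2 * pi * (real s + 1) \<le> 2 * pi * real M" by (intro mult_left_mono) auto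
    then show ?thesis using assms(4) by (simp add: d_def divide_le_eq)
  qed
  have cd: "0 \<le> c" "c \<le> d"
    unfolding c_def d_def by (simp, intro divide_right_mono mult_left_mono) auto
  have width: "d - c = 2 * pi / M"
    using assms(4) by (simp add: c_def d_def field_simps)
  have "sector M s = {c..<d}" by (simp add: sector_def c_def d_def add.commute)
  then show ?thesis
    using measure_hrg_box[OF alpha_pos R_pos n assms(1-3) cd d] by (simp add: width)
qed

lemma exp_alpha_R_ge_4: "4 \<le> exp (\<alpha> * R)"
proof -
  have aR: "2 \<le> \<alpha> * R" using mult_mono[of "1 / 2" \<alpha> 4 R] alpha R4 by simp
  have "2 * 2 \<le> exp 1 * exp (1::real)" using exp_ge_add_one_self[of "1::real"] by (intro mult_mono) auto
  also have "\<dots> = exp 2" by (simp flip: exp_add)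
  also have "\<dots> \<le> exp (\<alpha> * R)" using aR by simp
  finally show ?thesis by simp
qed

lemma cosh_minus_1_bounds:
  "exp (\<alpha> * R) / 4 \<le> cosh (\<alpha> * R) - 1" "cosh (\<alpha> * R) - 1 \<le> exp (\<alpha> * R) / 2"
proof -
  have aR: "0 \<le> \<alpha> * R" using alpha R4 by simp
  have "4 \<le> exp (\<alpha> * R)" by (rule exp_alpha_R_ge_4)
  moreover have "exp (\<alpha> * R) / 2 \<le> cosh (\<alpha> * R)" by (simp add: cosh_field_def)
  ultimately show "exp (\<alpha> * R) / 4 \<le> cosh (\<alpha> * R) - 1" by linarith
  have "exp (- (\<alpha> * R)) \<le> 1" using aR by simp
  moreover have "cosh (\<alpha> * R) = exp (\<alpha> * R) / 2 + exp (- (\<alpha> * R)) / 2"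
    by (simp add: cosh_field_def add_divide_distrib)
  ultimately show "cosh (\<alpha> * R) - 1 \<le> exp (\<alpha> * R) / 2" by linarith
qed

lemma measure_sector_box_le:
  assumes "0 \<le> a" "a \<le> b" "b \<le> R" "s < M"
  shows "measure \<mu> ({a..b} \<times> sector M s) \<le> 4 * real n * exp (- \<alpha> * (R - b)) / M"
proof -
  have "cosh (\<alpha> * b) - cosh (\<alpha> * a) \<le> exp (\<alpha> * b)"
  proof -
    have "0 \<le> \<alpha> * b" using assms alpha_pos by simp
    then have "cosh (\<alpha> * b) \<le> exp (\<alpha> * b)" by (simp add: cosh_field_def)
    then show ?thesis using cosh_real_pos[of "\<alpha> * a"] by linarith
  qed
  moreover have "exp (\<alpha> * R) / 4 \<le> cosh (\<alpha> * R) - 1" by (rule cosh_minus_1_bounds)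
  ultimately have "(cosh (\<alpha> * b) - cosh (\<alpha> * a)) / (cosh (\<alpha> * R) - 1) \<le> exp (\<alpha> * b) / (exp (\<alpha> * R) / 4)"
    by (intro frac_le) auto
  also have "\<dots> = 4 * exp (- \<alpha> * (R - b))"
    by (simp add: exp_minus exp_diff right_diff_distrib)
  finally have "n / M * ((cosh (\<alpha> * b) - cosh (\<alpha> * a)) / (cosh (\<alpha> * R) - 1)) \<le> n / M * (4 * exp (- \<alpha> * (R - b)))"
    by (intro mult_left_mono) auto
  also have "\<dots> = 4 * real n * exp (- \<alpha> * (R - b)) / M" by simp
  finally show ?thesis unfolding measure_sector_box[OF assms] .
qed

lemma measure_sector_box_ge:
  assumes "0 \<le> a" "a \<le> b" "b \<le> R" "s < M"
  shows "n / M * ((exp (\<alpha> * b) - 2 * cosh (\<alpha> * a)) * exp (- \<alpha> * R)) \<le> measure \<mu> ({a..b} \<times> sector M s)"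
proof -
  let ?x = "cosh (\<alpha> * b) - cosh (\<alpha> * a)"
  have "exp (\<alpha> * b) - 2 * cosh (\<alpha> * a) \<le> 2 * ?x" by (simp add: cosh_field_def)
  then have "(exp (\<alpha> * b) - 2 * cosh (\<alpha> * a)) * exp (- \<alpha> * R) \<le> 2 * ?x * exp (- \<alpha> * R)"
    by (intro mult_right_mono) auto
  also have "\<dots> = ?x / (exp (\<alpha> * R) / 2)" by (simp add: exp_minus field_simps)
  also have "\<dots> \<le> ?x / (cosh (\<alpha> * R) - 1)"
  proof (rule divide_left_mono[OF cosh_minus_1_bounds(2)])
    have "cosh (\<alpha> * a) \<le> cosh (\<alpha> * b)"
      using assms alpha_pos by (intro cosh_real_nonneg_le_iff[THEN iffD2]) auto
    then show "0 \<le> ?x" by simp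
    show "0 < exp (\<alpha> * R) / 2 * (cosh (\<alpha> * R) - 1)"
      by (intro mult_pos_pos less_le_trans[OF _ cosh_minus_1_bounds(1)]) simp_all
  qed
  finally show ?thesis
    unfolding measure_sector_box[OF assms] by (intro mult_left_mono) auto
qed

section \<open>Irregular configurations\<close>

definition "off_disk = - ({0..R} \<times> {0..<2 * pi})"

definition "box_ids = (SIGMA j:{..nat \<lfloor>R\<rfloor>}. SIGMA M:{1..nat \<lfloor>exp (R / 2)\<rfloor>}. {..<M})"

definition "heavy \<beta> = (\<lambda>(j, M, s). {\<omega>\<in>space PP.
  \<beta> * (1 + 4 * real n * exp (- \<alpha> * real j) / real M) \<le> real (points_in (hbox R M j s) \<omega>)})"

definition "irregular \<beta> = {\<omega>\<in>space PP. points_in off_disk \<omega> \<noteq> 0} \<union> (\<Union>i\<in>box_ids. heavy \<beta> i)"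

lemma off_disk_borel [simp]: "off_disk \<in> sets borel"
  unfolding off_disk_def by (rule borel_comp[OF box_borel])

lemma hbox_borel [simp]: "hbox R M j s \<in> sets borel"
  by (simp add: hbox_def)

lemma finite_box_ids: "finite box_ids"
  by (auto simp: box_ids_def)

lemma card_box_ids_le: "real (card box_ids) \<le> (R + 1) * exp R"
proof -
  let ?m = "nat \<lfloor>exp (R / 2)\<rfloor>"
  have "card box_ids = (nat \<lfloor>R\<rfloor> + 1) * (\<Sum>M\<in>{1..?m}. M)"
    by (simp add: box_ids_def)
  also have "\<dots> \<le> (nat \<lfloor>R\<rfloor> + 1) * (?m * ?m)"
  proof (rule mult_left_mono)
    have "(\<Sum>M\<in>{1..?m}. M) \<le> (\<Sum>M\<in>{1..?m}. ?m)" by (intro sum_mono) auto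
    then show "(\<Sum>M\<in>{1..?m}. M) \<le> ?m * ?m" by simp
  qed simp
  finally have "card box_ids \<le> (nat \<lfloor>R\<rfloor> + 1) * (?m * ?m)" .
  then have "real (card box_ids) \<le> real ((nat \<lfloor>R\<rfloor> + 1) * (?m * ?m))" by (rule of_nat_mono)
  also have "\<dots> = (real (nat \<lfloor>R\<rfloor>) + 1) * (real ?m * real ?m)" by (simp only: of_nat_mult of_nat_add of_nat_1)
  also have "\<dots> \<le> (R + 1) * (exp (R / 2) * exp (R / 2))"
    using R_pos by (intro mult_mono add_right_mono) (auto simp: of_nat_floor)
  finally show ?thesis by (simp flip: exp_add)
qed

lemma off_disk_event: "{\<omega>\<in>space PP. points_in off_disk \<omega> \<noteq> 0} \<in> PP.events"
  using events_points_in[of off_disk "-{0}"] by simp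

lemma heavy_event: "heavy \<beta> i \<in> PP.events"
proof -
  obtain j M s where i: "i = (j, M, s)" by (cases i)
  have "heavy \<beta> i = {\<omega>\<in>space PP. points_in (hbox R M j s) \<omega> \<in>
      {c. \<beta> * (1 + 4 * real n * exp (- \<alpha> * real j) / real M) \<le> real c}}"
    unfolding i heavy_def by (simp only: prod.case mem_Collect_eq)
  moreover have "hbox R M j s \<in> sets \<mu>" by simp
  ultimately show ?thesis by (simp only: events_points_in)
qed

lemma irregular_event: "irregular \<beta> \<in> PP.events"
  unfolding irregular_def by (intro sets.Un sets.finite_UN finite_box_ids off_disk_event heavy_event)

text \<open>The number of boxes is at most of order \<open>exp R\<close>, up to a factor
  \<open>R\<close>, hence polynomial in \<open>n\<close>. With \<open>\<beta>\<close> a small power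
  of \<open>n\<close> the union bound still beats every power of \<open>n\<close>; the points off
  the disk are a null event.\<close>

lemma prob_irregular_le:
  assumes "2 \<le> \<beta>"
  shows "PP.prob (irregular \<beta>) \<le> (R + 1) * exp R * exp (- \<beta>)"
proof -
  let ?E = "{\<omega>\<in>space PP. \<exists>i\<in>box_ids. \<beta> * (1 + (case i of (j, M, s) \<Rightarrow> 4 * real n * exp (- \<alpha> * real j) / real M))
      \<le> real (points_in (case i of (j, M, s) \<Rightarrow> hbox R M j s) \<omega>)}"
  have eq: "(\<Union>i\<in>box_ids. heavy \<beta> i) = ?E"
  proof -
    have "heavy \<beta> i = {\<omega>\<in>space PP. \<beta> * (1 + (case i of (j, M, s) \<Rightarrow> 4 * real n * exp (- \<alpha> * real j) / real M))
      \<le> real (points_in (case i of (j, M, s) \<Rightarrow> hbox R M j s) \<omega>)}" for i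
    proof -
      obtain j M s where i: "i = (j, M, s)" by (cases i)
      show ?thesis unfolding i heavy_def prod.case by (rule refl)
    qed
    note heavy_eq = this
    show ?thesis unfolding heavy_eq by blast
  qed
  have "PP.prob {\<omega>\<in>space PP. points_in off_disk \<omega> \<noteq> 0} \<le> measure \<mu> off_disk"
    by (rule prob_points_in_pos_le[OF finite_mu mu_pos]) simp
  also have "measure \<mu> off_disk = 0"
    unfolding off_disk_def by (rule measure_hrg_outside[OF alpha_pos R_pos n])
  finally have 1: "PP.prob {\<omega>\<in>space PP. points_in off_disk \<omega> \<noteq> 0} = 0" by (simp add: measure_le_0_iff)
  have 2: "PP.prob ?E \<le> card box_ids * exp (- \<beta>)"
  proof (rule prob_some_count_large_le[OF finite_mu mu_pos finite_box_ids _ _ assms])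
    fix i assume "i \<in> box_ids"
    then obtain j M s where i: "i = (j, M, s)" "real j \<le> R" "s < M"
      using R_pos by (auto simp: box_ids_def le_nat_iff le_floor_iff)
    show "(case i of (j, M, s) \<Rightarrow> hbox R M j s) \<in> sets \<mu>" by (simp add: i)
    have "measure \<mu> (hbox R M j s) \<le> 4 * real n * exp (- \<alpha> * (R - (R - j))) / M"
      unfolding hbox_def using i by (intro measure_sector_box_le) auto
    then show "measure \<mu> (case i of (j, M, s) \<Rightarrow> hbox R M j s)
        \<le> (case i of (j, M, s) \<Rightarrow> 4 * real n * exp (- \<alpha> * real j) / real M)" by (simp add: i)
  qed
  have "PP.prob (irregular \<beta>) \<le> PP.prob {\<omega>\<in>space PP. points_in off_disk \<omega> \<noteq> 0} + PP.prob (\<Union>i\<in>box_ids. heavy \<beta> i)"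
    unfolding irregular_def
    by (intro measure_Un_le off_disk_event sets.finite_UN finite_box_ids heavy_event)
  also have "\<dots> \<le> card box_ids * exp (- \<beta>)" unfolding eq using 1 2 by linarith
  also have "\<dots> \<le> (R + 1) * exp R * exp (- \<beta>)"
    using card_box_ids_le by (intro mult_right_mono) auto
  finally show ?thesis .
qed

lemma hrg_config_regular:
  assumes "(N, X) \<in> space PP" "(N, X) \<notin> irregular \<beta>" "1 \<le> \<beta>"
  shows "hrg_config \<alpha> R \<beta> n N X"
proof
  fix i assume "i < N"
  have "points_in off_disk (N, X) = 0" using assms by (auto simp: irregular_def)
  then have "{i. i < N \<and> X i \<in> off_disk} = {}" by (simp add: points_in_def)
  then show "X i \<in> {0..R} \<times> {0..<2 * pi}" using \<open>i < N\<close> by (auto simp: off_disk_def)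
next
  fix j M s assume j: "real j \<le> R" and M: "0 < M" "real M \<le> exp (R / 2)" and s: "s < M"
  have "j \<le> nat \<lfloor>R\<rfloor>" using j by (simp add: le_nat_floor)
  moreover have "M \<le> nat \<lfloor>exp (R / 2)\<rfloor>" using M(2) by (simp add: le_nat_floor)
  ultimately have "(j, M, s) \<in> box_ids" using M s by (auto simp: box_ids_def)
  then have "(N, X) \<notin> heavy \<beta> (j, M, s)" using assms(2) unfolding irregular_def by blast
  then show "real (points_in (hbox R M j s) (N, X)) \<le> \<beta> * (1 + 4 * real n * exp (- \<alpha> * real j) / real M)"
    using assms(1) by (simp add: heavy_def)
qed (use alpha R4 assms in auto)

lemma hrg_prob_ge:
  assumes "B \<in> PP.events" "\<And>N X. (N, X) \<in> space PP \<Longrightarrow> (N, X) \<notin> B \<Longrightarrow> Q (geometric_graph R (N, X))"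
    and "PP.prob B \<le> e"
  shows "1 - e \<le> hrg_prob \<alpha> C n Q"
proof -
  have "1 - PP.prob B = PP.prob (space PP - B)" using assms(1) by (rule PP.prob_compl[symmetric])
  also have "\<dots> \<le> hrg_prob \<alpha> C n Q"
    unfolding hrg_prob_def
  proof (rule PP.finite_measure_mono)
    show "space PP - B \<subseteq> {\<omega>\<in>space PP. Q (geometric_graph R \<omega>)}"
      using assms(2) by auto
  qed (rule sets_poisson_process_geometric_graph, simp)
  finally show ?thesis using assms(3) by linarith
qed

section \<open>Transfer of the deterministic bounds to the random graph\<close>

definition "max_deg_factor \<beta> = 3 * \<beta> * (R + 1) * (1 + 96 * real n * exp (- R / 2))"
definition "max_inner_degree \<beta> = 3 * \<beta> * (R + 1) * (1 + 96 * real n * exp (- \<alpha> * R / 2))"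

lemma points_in_conv: "points_in B (N, X) = card {i. i < N \<and> X i \<in> B}"
  by (simp add: points_in_def)

lemma points_in_event: "B \<in> sets borel \<Longrightarrow> {\<omega>\<in>space PP. P (points_in B \<omega>)} \<in> PP.events"
  using events_points_in[of B "Collect P"] by simp

lemma near_centre_event:
  "{\<omega>\<in>space PP. points_in ({0..r0} \<times> sector 1 0) \<omega> \<noteq> 0} \<in> PP.events"
  by (intro points_in_event) simp

lemma prob_near_centre_le:
  assumes "0 \<le> r0" "r0 \<le> R"
  shows "PP.prob {\<omega>\<in>space PP. points_in ({0..r0} \<times> sector 1 0) \<omega> \<noteq> 0} \<le> 4 * real n * exp (- \<alpha> * (R - r0))"
proof -
  have "PP.prob {\<omega>\<in>space PP. points_in ({0..r0} \<times> sector 1 0) \<omega> \<noteq> 0} \<le> measure \<mu> ({0..r0} \<times> sector 1 0)"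
    by (rule prob_points_in_pos_le[OF finite_mu mu_pos]) simp
  also have "\<dots> \<le> 4 * real n * exp (- \<alpha> * (R - r0)) / real 1"
    using assms by (intro measure_sector_box_le) auto
  finally show ?thesis by simp
qed

lemma sparse_sector_event:
  "{\<omega>\<in>space PP. \<exists>s\<in>{..<M}. real (points_in ({a..b} \<times> sector M s) \<omega>) \<le> l} \<in> PP.events"
proof -
  have "{\<omega>\<in>space PP. \<exists>s\<in>{..<M}. real (points_in ({a..b} \<times> sector M s) \<omega>) \<le> l}
    = (\<Union>s\<in>{..<M}. {\<omega>\<in>space PP. real (points_in ({a..b} \<times> sector M s) \<omega>) \<le> l})" by blast
  also have "\<dots> \<in> PP.events" by (intro sets.finite_UN points_in_event) auto
  finally show ?thesis .
qed

lemma prob_sparse_sector_le: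
  assumes "0 \<le> a" "a \<le> b" "b \<le> R" "l \<le> n / M * ((exp (\<alpha> * b) - 2 * cosh (\<alpha> * a)) * exp (- \<alpha> * R))"
  shows "PP.prob {\<omega>\<in>space PP. \<exists>s\<in>{..<M}. real (points_in ({a..b} \<times> sector M s) \<omega>) \<le> l / 2} \<le> real M * exp (- l / 10)"
proof -
  have "PP.prob {\<omega>\<in>space PP. \<exists>s\<in>{..<M}. real (points_in ({a..b} \<times> sector M s) \<omega>) \<le> l / 2} \<le> real (card {..<M}) * exp (- l / 10)"
  proof (rule prob_some_count_small_le[OF finite_mu mu_pos])
    fix s assume "s \<in> {..<M}"
    then show "l \<le> measure \<mu> ({a..b} \<times> sector M s)"
      using measure_sector_box_ge[OF assms(1-3), of s M] assms(4) by simp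
  qed auto
  then show ?thesis by simp
qed

lemma sparse_disk_sector:
  assumes "(N, X) \<notin> {\<omega>\<in>space PP. \<exists>s\<in>{..<M}. real (points_in ({a..b} \<times> sector M s) \<omega>) \<le> l}"
    "(N, X) \<in> space PP" "s < M"
  shows "l < real (card {i. i < N \<and> X i \<in> {a..b} \<times> sector M s})"
proof -
  have "\<not> real (points_in ({a..b} \<times> sector M s) (N, X)) \<le> l" using assms by blast
  then show ?thesis by (simp add: points_in_conv)
qed

text \<open>Five exceptional events, one per ingredient: irregular counts; a point within
  \<open>r0\<close> of the origin (upper bound on the degree); no point of radius between 1 and
  \<open>r1\<close>, and a sparse sector among \<open>M1\<close> (lower bound on the degree); too
  few points at distance \<open>b\<close> from the boundary (conflicts in round one).\<close>

theorem hrg_prob_terminates_after_2_ge: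
  fixes M1 M2 :: nat
  assumes beta: "2 \<le> \<beta>" and eps: "0 < \<epsilon>"
    and r0: "0 \<le> r0" "r0 \<le> R"
    and r1: "1 \<le> r1" "r1 \<le> R - 1" and l1: "0 \<le> l1" "l1 \<le> n * ((exp (\<alpha> * r1) - 2 * cosh \<alpha>) * exp (- \<alpha> * R))"
    and M1: "0 < M1" "2 * pi / M1 \<le> exp (- r1 / 2)" and large: "4 \<le> \<epsilon> * (n / M1 / 4 - 1)"
    and b: "1 \<le> b" "b \<le> R" and M2: "0 < M2" "2 * pi / M2 \<le> exp ((2 * b - R) / 2)"
    and l2: "l2 \<le> n * ((exp (\<alpha> * (R - b)) - 2) * exp (- \<alpha> * R))" "M2 \<le> l2 / 2"
  shows "1 - ((R + 1) * exp R * exp (- \<beta>) + 4 * real n * exp (- \<alpha> * (R - r0)) + exp (- l1 / 10)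
      + M1 * exp (- (n / M1 / 2) / 10) + exp (- l2 / 10))
    \<le> hrg_prob \<alpha> C n (\<lambda>G. rct_prob G {..<nat \<lfloor>\<epsilon> * real (max_degree G)\<rfloor>} (terminates_after G 2) \<ge> 1
      - (exp (- (l2 / 2 - M2) / (\<epsilon> * (max_deg_factor \<beta> * exp ((R - r0) / 2))))
      + 8 * ((R + 1) * (\<beta> * max_deg_factor \<beta> * (exp (R / 2) + 4 * real n))) * (4 + max_inner_degree \<beta>)
        * exp (4 / \<epsilon>) / (\<epsilon> * (n / M1 / 4 - 1))\<^sup>2))"
proof -
  let ?c = "\<lambda>r0. {\<omega>\<in>space PP. points_in ({0..r0} \<times> sector 1 0) \<omega> \<noteq> 0}"
  let ?sp = "\<lambda>M a b l. {\<omega>\<in>space PP. \<exists>s\<in>{..<M}. real (points_in ({a..b} \<times> sector M s) \<omega>) \<le> l}"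
  let ?B = "irregular \<beta> \<union> (?c r0 \<union> (?sp 1 1 r1 (l1 / 2) \<union> (?sp M1 0 R (n / M1 / 2 / 2) \<union> ?sp 1 0 (R - b) (l2 / 2))))"
  have full: "n / M1 / 2 \<le> n / M1 * ((exp (\<alpha> * R) - 2 * cosh (\<alpha> * 0)) * exp (- \<alpha> * R))"
  proof -
    have "1 / 2 * exp (\<alpha> * R) \<le> exp (\<alpha> * R) - 2" using exp_alpha_R_ge_4 by linarith
    then have "1 / 2 * exp (\<alpha> * R) * exp (- \<alpha> * R) \<le> (exp (\<alpha> * R) - 2) * exp (- \<alpha> * R)"
      by (intro mult_right_mono) auto
    then have "1 / 2 \<le> (exp (\<alpha> * R) - 2) * exp (- \<alpha> * R)" by (simp add: exp_minus)
    then have "n / M1 * (1 / 2) \<le> n / M1 * ((exp (\<alpha> * R) - 2) * exp (- \<alpha> * R))"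
      by (intro mult_left_mono) auto
    then show ?thesis by simp
  qed
  have p1: "PP.prob (irregular \<beta>) \<le> (R + 1) * exp R * exp (- \<beta>)" by (rule prob_irregular_le[OF beta])
  have p2: "PP.prob (?c r0) \<le> 4 * real n * exp (- \<alpha> * (R - r0))" by (rule prob_near_centre_le[OF r0])
  have p3: "PP.prob (?sp 1 1 r1 (l1 / 2)) \<le> real 1 * exp (- l1 / 10)"
    using r1 l1 by (intro prob_sparse_sector_le) auto
  have p4: "PP.prob (?sp M1 0 R (n / M1 / 2 / 2)) \<le> M1 * exp (- (n / M1 / 2) / 10)"
    using R_pos full by (intro prob_sparse_sector_le) auto
  have p5: "PP.prob (?sp 1 0 (R - b) (l2 / 2)) \<le> real 1 * exp (- l2 / 10)"
    using b l2(1) by (intro prob_sparse_sector_le) auto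
  have ev: "?sp 1 0 (R - b) (l2 / 2) \<in> PP.events"
      "?sp M1 0 R (n / M1 / 2 / 2) \<in> PP.events"
      "?sp 1 1 r1 (l1 / 2) \<in> PP.events" "?c r0 \<in> PP.events" "irregular \<beta> \<in> PP.events"
    by (rule sparse_sector_event near_centre_event irregular_event)+
  have prob: "PP.prob ?B \<le> (R + 1) * exp R * exp (- \<beta>) + (4 * real n * exp (- \<alpha> * (R - r0)) + (real 1 * exp (- l1 / 10)
      + (M1 * exp (- (n / M1 / 2) / 10) + real 1 * exp (- l2 / 10))))"
    by (intro order.trans[OF measure_Un_le] add_mono p1 p2 p3 p4 p5 sets.Un ev)
  show ?thesis
  proof (rule hrg_prob_ge[where B = ?B])
    show "?B \<in> PP.events" by (intro sets.Un ev)
    show "PP.prob ?B \<le> (R + 1) * exp R * exp (- \<beta>) + 4 * real n * exp (- \<alpha> * (R - r0)) + exp (- l1 / 10)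
      + M1 * exp (- (n / M1 / 2) / 10) + exp (- l2 / 10)" using prob by simp
    fix N X assume sp: "(N, X) \<in> space PP" and nB: "(N, X) \<notin> ?B"
    interpret hrg_config \<alpha> R \<beta> n N X
      by (rule hrg_config_regular) (use sp nB beta in auto)
    have r0': "r0 \<le> rad i" if "i < N" for i
    proof -
      have "points_in ({0..r0} \<times> sector 1 0) (N, X) = 0" using nB sp by blast
      then have "X i \<notin> {0..r0} \<times> sector 1 0" using that by (auto simp: points_in_conv)
      then have "(rad i, ang i) \<notin> {0..r0} \<times> {0..<2 * pi}" unfolding X_eq[of i] sector_1_0 .
      then show ?thesis using rad(1)[OF that] ang[OF that] by auto
    qed
    have "l1 / 2 < real (card {i. i < N \<and> X i \<in> {1..r1} \<times> sector 1 0})"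
      by (rule sparse_disk_sector) (use nB sp in auto)
    then have "card {i. i < N \<and> X i \<in> {1..r1} \<times> sector 1 0} \<noteq> 0" using l1(1) by linarith
    then have "{i. i < N \<and> X i \<in> {1..r1} \<times> sector 1 0} \<noteq> {}" by (metis card.empty)
    then obtain u where u: "u < N" "1 \<le> rad u" "rad u \<le> r1" by (auto simp: X_eq)
    have c1: "n / M1 / 4 \<le> real (card {i. i < N \<and> ang i \<in> sector M1 s})" if "s < M1" for s
    proof -
      have "n / M1 / 2 / 2 < real (card {i. i < N \<and> X i \<in> {0..R} \<times> sector M1 s})"
        by (rule sparse_disk_sector[OF _ sp that]) (use nB in blast)
      also have "\<dots> \<le> real (card {i. i < N \<and> ang i \<in> sector M1 s})"
        by (intro of_nat_mono card_mono) (auto simp: X_eq)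
      finally show ?thesis by simp
    qed
    have c2: "l2 / 2 \<le> real (card {i. i < N \<and> rad i \<le> R - b})"
    proof -
      have "l2 / 2 < real (card {i. i < N \<and> X i \<in> {0..R - b} \<times> sector 1 0})"
      proof (rule sparse_disk_sector[OF _ sp])
        show "(N, X) \<notin> ?sp 1 0 (R - b) (l2 / 2)" using nB by (simp only: Un_iff de_Morgan_disj simp_thms)
      qed simp
      also have "\<dots> \<le> real (card {i. i < N \<and> rad i \<le> R - b})"
        by (intro of_nat_mono card_mono) (auto simp: X_eq)
      finally show ?thesis by simp
    qed
    have f: "deg_factor = max_deg_factor \<beta>" "inner_bound = max_inner_degree \<beta>"
      by (simp_all add: deg_factor_def inner_bound_def max_deg_factor_def max_inner_degree_def)
    show "rct_prob (geometric_graph R (N, X)) {..<nat \<lfloor>\<epsilon> * real (max_degree (geometric_graph R (N, X)))\<rfloor>}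
        (terminates_after (geometric_graph R (N, X)) 2) \<ge> 1
      - (exp (- (l2 / 2 - M2) / (\<epsilon> * (max_deg_factor \<beta> * exp ((R - r0) / 2))))
      + 8 * ((R + 1) * (\<beta> * max_deg_factor \<beta> * (exp (R / 2) + 4 * real n))) * (4 + max_inner_degree \<beta>)
        * exp (4 / \<epsilon>) / (\<epsilon> * (n / M1 / 4 - 1))\<^sup>2)"
      using rct_terminates_after_2_ge[OF eps r0' u r1(2) M1 c1 b(1) M2 c2 l2(2) large]
      unfolding f G_def by linarith
  qed
qed

lemma exp_half_le_exp_1: "3 / 2 \<le> exp (\<alpha>::real)"
  using exp_ge_add_one_self[of \<alpha>] alpha by linarith

text \<open>Since \<open>exp \<alpha> \<ge> 3 / 2\<close>, the disk of radius \<open>R - 1\<close>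
  takes at most 2/3 of the leading term; the remaining summand is at most 1, that is, a quarter of
  \<open>exp (\<alpha> * R)\<close>. What is left is
  \<open>1 - 2 / 3 - 1 / 4 = 1 / 12\<close>.\<close>

lemma outer_ring_mass: "1 / 12 \<le> (exp (\<alpha> * R) - 2 * cosh (\<alpha> * (R - 1))) * exp (- \<alpha> * R)"
proof -
  let ?E = "exp (\<alpha> * R)"
  have "exp (\<alpha> * (R - 1)) * exp \<alpha> = ?E" by (simp flip: exp_add add: algebra_simps)
  moreover have "exp (\<alpha> * (R - 1)) * (3 / 2) \<le> exp (\<alpha> * (R - 1)) * exp \<alpha>"
    using exp_half_le_exp_1 by (intro mult_left_mono) auto
  ultimately have 1: "exp (\<alpha> * (R - 1)) \<le> 2 / 3 * ?E" by linarith
  have "exp (- (\<alpha> * (R - 1))) \<le> 1" using alpha R4 by simp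
  moreover have "2 * cosh (\<alpha> * (R - 1)) = exp (\<alpha> * (R - 1)) + exp (- (\<alpha> * (R - 1)))"
    by (simp add: cosh_field_def)
  ultimately have "1 / 12 * ?E \<le> ?E - 2 * cosh (\<alpha> * (R - 1))"
    using 1 exp_alpha_R_ge_4 by linarith
  then have "1 / 12 * ?E * exp (- \<alpha> * R) \<le> (?E - 2 * cosh (\<alpha> * (R - 1))) * exp (- \<alpha> * R)"
    by (intro mult_right_mono) auto
  then show ?thesis by (simp add: exp_minus)
qed

lemma collar_box_borel [simp]: "collar_box R \<zeta> M s \<in> sets borel"
  and core_box_borel [simp]: "core_box R M s \<in> sets borel"
  by (simp_all add: collar_box_def core_box_def)

definition "collar_mass \<zeta> M = 4 * real n * exp (- \<alpha> * ((1 - \<zeta>) * R / 2)) / real M"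
definition "core_mass M = 4 * real n * exp (- \<alpha> * (R / 2)) / real M"

lemma measure_collar_box_le:
  assumes "0 < \<zeta>" "\<zeta> < 1" "s < M"
  shows "measure \<mu> (collar_box R \<zeta> M s) \<le> collar_mass \<zeta> M"
proof -
  have z: "R / 2 \<le> (1 + \<zeta>) * R / 2" "(1 + \<zeta>) * R / 2 \<le> R"
    using assms R_pos mult_right_mono[of "1 + \<zeta>" 2 R] mult_right_mono[of 1 "1 + \<zeta>" R] by linarith+
  have "measure \<mu> (collar_box R \<zeta> M s) \<le> measure \<mu> ({R / 2..(1 + \<zeta>) * R / 2} \<times> sector M s)"
    unfolding collar_box_def by (rule finite_measure.finite_measure_mono[OF finite_mu]) auto
  also have "\<dots> \<le> 4 * real n * exp (- \<alpha> * (R - (1 + \<zeta>) * R / 2)) / M"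
    using R_pos z assms(3) by (intro measure_sector_box_le) auto
  also have "R - (1 + \<zeta>) * R / 2 = (1 - \<zeta>) * R / 2" by (simp add: field_simps)
  finally show ?thesis unfolding collar_mass_def .
qed

lemma measure_core_box_le:
  assumes "s < M"
  shows "measure \<mu> (core_box R M s) \<le> core_mass M"
proof -
  have "measure \<mu> (core_box R M s) \<le> 4 * real n * exp (- \<alpha> * (R - R / 2)) / M"
    unfolding core_box_def using R_pos assms by (intro measure_sector_box_le) auto
  also have "R - R / 2 = R / 2" by simp
  finally show ?thesis unfolding core_mass_def .
qed

definition "crowded_collar \<beta> \<zeta> M = {\<omega>\<in>space PP. \<exists>s\<in>{..<M}.
  \<beta> * (1 + collar_mass \<zeta> M) \<le> real (points_in (collar_box R \<zeta> M s) \<omega>)}"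

definition "many_pairs \<zeta> M t = {\<omega>\<in>space PP. t \<le> real (card {p\<in>slot_pairs M.
  points_in (collar_box R \<zeta> M (fst p)) \<omega> \<noteq> 0 \<and> points_in (core_box R M (snd p)) \<omega> \<noteq> 0})}"

lemma crowded_collar_event: "crowded_collar \<beta> \<zeta> M \<in> PP.events"
proof -
  have "crowded_collar \<beta> \<zeta> M = (\<Union>s\<in>{..<M}. {\<omega>\<in>space PP.
      \<beta> * (1 + collar_mass \<zeta> M) \<le> real (points_in (collar_box R \<zeta> M s) \<omega>)})"
    unfolding crowded_collar_def by blast
  also have "\<dots> \<in> PP.events" by (intro sets.finite_UN points_in_event) auto
  finally show ?thesis .
qed

lemma many_pairs_event: "many_pairs \<zeta> M t \<in> PP.events"
proof -
  let ?Q = "\<lambda>\<omega> p. points_in (collar_box R \<zeta> M (fst p)) \<omega> \<noteq> 0 \<and> points_in (core_box R M (snd p)) \<omega> \<noteq> 0"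
  have "{\<omega>\<in>space PP. ?Q \<omega> p} = {\<omega>\<in>space PP. points_in (collar_box R \<zeta> M (fst p)) \<omega> \<noteq> 0} \<inter>
      {\<omega>\<in>space PP. points_in (core_box R M (snd p)) \<omega> \<noteq> 0}" for p by blast
  then have ev: "{\<omega>\<in>space PP. ?Q \<omega> p} \<in> PP.events" for p
    using points_in_event[of _ "\<lambda>c. c \<noteq> 0"] by (simp only: sets.Int collar_box_borel core_box_borel)
  have "(\<lambda>\<omega>. \<Sum>p\<in>slot_pairs M. indicator {\<omega>\<in>space PP. ?Q \<omega> p} \<omega> :: real) \<in> borel_measurable PP"
    using ev by measurable
  then have "{\<omega>\<in>space PP. t \<le> (\<Sum>p\<in>slot_pairs M. indicator {\<omega>\<in>space PP. ?Q \<omega> p} \<omega>)} \<in> PP.events"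
    by measurable
  also have "{\<omega>\<in>space PP. t \<le> (\<Sum>p\<in>slot_pairs M. indicator {\<omega>\<in>space PP. ?Q \<omega> p} \<omega>)} = many_pairs \<zeta> M t"
    unfolding many_pairs_def
    by (intro Collect_cong conj_cong refl) (simp add: indicator_def sum.If_cases Int_def conj_commute)
  finally show ?thesis .
qed

lemma prob_crowded_collar_le:
  assumes "2 \<le> \<beta>" "0 < \<zeta>" "\<zeta> < 1"
  shows "PP.prob (crowded_collar \<beta> \<zeta> M) \<le> M * exp (- \<beta>)"
proof -
  have "PP.prob (crowded_collar \<beta> \<zeta> M) \<le> card {..<M} * exp (- \<beta>)"
    unfolding crowded_collar_def
    by (rule prob_some_count_large_le[OF finite_mu mu_pos]) (use measure_collar_box_le assms in auto)
  then show ?thesis by simp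
qed

lemma prob_many_pairs_le:
  assumes "0 < \<zeta>" "\<zeta> < 1" "0 < t"
  shows "PP.prob (many_pairs \<zeta> M t) \<le> 3 * real M * (collar_mass \<zeta> M * core_mass M) / t"
proof -
  have slots: "fst p < M" "snd p < M" if "p \<in> slot_pairs M" for p
    using that adjacent_slots_less[of "fst p" M] by (auto simp: slot_pairs_def)
  have "PP.prob (many_pairs \<zeta> M t) \<le> card (slot_pairs M) * (collar_mass \<zeta> M * core_mass M) / t"
    unfolding many_pairs_def
  proof (rule prob_many_pairs_occupied_le[OF finite_mu mu_pos finite_slot_pairs _ _ _ assms(3)])
    fix p assume p: "p \<in> slot_pairs M"
    show "measure \<mu> (collar_box R \<zeta> M (fst p)) \<le> collar_mass \<zeta> M"
      using assms slots[OF p] by (intro measure_collar_box_le) auto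
    show "measure \<mu> (core_box R M (snd p)) \<le> core_mass M"
      using slots[OF p] by (intro measure_core_box_le) auto
    show "collar_box R \<zeta> M (fst p) \<inter> core_box R M (snd p) = {}"
      by (auto simp: collar_box_def core_box_def)
  qed simp_all
  also have "\<dots> \<le> 3 * real M * (collar_mass \<zeta> M * core_mass M) / t"
  proof (intro divide_right_mono mult_right_mono)
    show "real (card (slot_pairs M)) \<le> 3 * real M" using card_slot_pairs[of M] by linarith
  qed (use assms in \<open>simp_all add: collar_mass_def core_mass_def\<close>)
  finally show ?thesis by simp
qed

text \<open>The exceptional events guarantee in turn the degree bounds, radii above 1, populated
  boundary boxes (for the sets \<open>W v\<close>), small collar counts together with few occupied
  pairs (for the blockers), and a large core. The pair event is controlled only by a first moment,
  so its probability is small but not negligible.\<close>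

theorem hrg_prob_never_terminates_ge:
  fixes M0 M1 :: nat and \<beta> \<zeta> t \<delta> lK :: real
  assumes beta: "2 \<le> \<beta>" and zeta: "0 < \<zeta>" "\<zeta> < 1" "(1 + \<zeta>) * R / 2 < R - 1"
    and M0: "0 < M0" "2 * pi / M0 \<le> exp (- R / 4)"
    and M1: "0 < M1" "49 * exp (- R / 4) \<le> 2 * pi / M1" and t: "0 < t"
    and lK: "lK \<le> n * ((exp (\<alpha> * (R / 2)) - 2) * exp (- \<alpha> * R))"
      "2 * (\<beta> * (1 + collar_mass \<zeta> M1) * t) + 4 \<le> lK / 2"
    and delta: "8 * max_deg_factor \<beta> + 1 \<le> real n powr \<delta>"
  defines "k_hi \<equiv> real n powr \<delta> * (max_inner_degree \<beta> + 1)"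
    and "Nb \<equiv> (R + 1) * (\<beta> * (1 + 4 * real n))"
  shows "1 - ((R + 1) * exp R * exp (- \<beta>) + 4 * real n * exp (- \<alpha> * (R - 1)) + M0 * exp (- (n / M0 / 12) / 10)
      + M1 * exp (- \<beta>) + 3 * real M1 * (collar_mass \<zeta> M1 * core_mass M1) / t + exp (- lK / 10))
    \<le> hrg_prob \<alpha> C n (\<lambda>G. rct_prob G {..<nat \<lfloor>real n powr \<delta> * real (chromatic_number G)\<rfloor>} (never_terminates G) \<ge> 1
      - (Nb powr (\<beta> * (1 + collar_mass \<zeta> M1) * t) * exp (- (lK / 2)\<^sup>2 / (8 * k_hi))
       + Nb * k_hi * exp (- ((n / M0 / 24) / (2 * max_deg_factor \<beta> + 1))
          / (2 * max k_hi (max_deg_factor \<beta> * exp ((1 - \<zeta>) * R / 4))))))"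
proof -
  let ?c = "{\<omega>\<in>space PP. points_in ({0..1} \<times> sector 1 0) \<omega> \<noteq> 0}"
  let ?sp = "\<lambda>M a b l. {\<omega>\<in>space PP. \<exists>s\<in>{..<M}. real (points_in ({a..b} \<times> sector M s) \<omega>) \<le> l}"
  let ?B = "irregular \<beta> \<union> (?c \<union> (?sp M0 (R - 1) R (n / M0 / 12 / 2) \<union> (crowded_collar \<beta> \<zeta> M1 \<union>
    (many_pairs \<zeta> M1 t \<union> ?sp 1 0 (R / 2) (lK / 2)))))"
  have p1: "PP.prob (irregular \<beta>) \<le> (R + 1) * exp R * exp (- \<beta>)" by (rule prob_irregular_le[OF beta])
  have p2: "PP.prob ?c \<le> 4 * real n * exp (- \<alpha> * (R - 1))" using R4 by (intro prob_near_centre_le) auto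
  have p3: "PP.prob (?sp M0 (R - 1) R (n / M0 / 12 / 2)) \<le> M0 * exp (- (n / M0 / 12) / 10)"
  proof (rule prob_sparse_sector_le)
    have "n / M0 * (1 / 12) \<le> n / M0 * ((exp (\<alpha> * R) - 2 * cosh (\<alpha> * (R - 1))) * exp (- \<alpha> * R))"
      by (intro mult_left_mono outer_ring_mass) auto
    then show "n / M0 / 12 \<le> n / M0 * ((exp (\<alpha> * R) - 2 * cosh (\<alpha> * (R - 1))) * exp (- \<alpha> * R))" by simp
  qed (use R4 in auto)
  have p4: "PP.prob (crowded_collar \<beta> \<zeta> M1) \<le> M1 * exp (- \<beta>)" by (rule prob_crowded_collar_le[OF beta zeta(1,2)])
  have p5: "PP.prob (many_pairs \<zeta> M1 t) \<le> 3 * real M1 * (collar_mass \<zeta> M1 * core_mass M1) / t"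
    by (rule prob_many_pairs_le[OF zeta(1,2) t])
  have p6: "PP.prob (?sp 1 0 (R / 2) (lK / 2)) \<le> real 1 * exp (- lK / 10)"
    using R_pos lK(1) by (intro prob_sparse_sector_le) auto
  have ev: "?sp 1 0 (R / 2) (lK / 2) \<in> PP.events" "many_pairs \<zeta> M1 t \<in> PP.events"
      "crowded_collar \<beta> \<zeta> M1 \<in> PP.events"
      "?sp M0 (R - 1) R (n / M0 / 12 / 2) \<in> PP.events" "?c \<in> PP.events" "irregular \<beta> \<in> PP.events"
    by (rule sparse_sector_event near_centre_event irregular_event crowded_collar_event many_pairs_event)+
  have prob: "PP.prob ?B \<le> (R + 1) * exp R * exp (- \<beta>) + (4 * real n * exp (- \<alpha> * (R - 1)) + (M0 * exp (- (n / M0 / 12) / 10)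
      + (M1 * exp (- \<beta>) + (3 * real M1 * (collar_mass \<zeta> M1 * core_mass M1) / t + real 1 * exp (- lK / 10)))))"
    by (intro order.trans[OF measure_Un_le] add_mono p1 p2 p3 p4 p5 p6 sets.Un ev)
  show ?thesis
  proof (rule hrg_prob_ge[where B = ?B])
    show "?B \<in> PP.events" by (intro sets.Un ev)
    show "PP.prob ?B \<le> (R + 1) * exp R * exp (- \<beta>) + 4 * real n * exp (- \<alpha> * (R - 1)) + M0 * exp (- (n / M0 / 12) / 10)
      + M1 * exp (- \<beta>) + 3 * real M1 * (collar_mass \<zeta> M1 * core_mass M1) / t + exp (- lK / 10)" using prob by simp
    fix N X assume sp: "(N, X) \<in> space PP" and nB: "(N, X) \<notin> ?B"
    have nb: "(N, X) \<notin> irregular \<beta>" "(N, X) \<notin> ?c" "(N, X) \<notin> ?sp M0 (R - 1) R (n / M0 / 12 / 2)"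
      "(N, X) \<notin> crowded_collar \<beta> \<zeta> M1" "(N, X) \<notin> many_pairs \<zeta> M1 t" "(N, X) \<notin> ?sp 1 0 (R / 2) (lK / 2)"
      using nB by (simp_all only: Un_iff de_Morgan_disj simp_thms)
    interpret hrg_config \<alpha> R \<beta> n N X
      by (rule hrg_config_regular[OF sp nb(1)]) (use beta in simp)
    have rad1: "1 \<le> rad i" if "i < N" for i
    proof -
      have "points_in ({0..1} \<times> sector 1 0) (N, X) = 0" using nb(2) sp by blast
      then have "X i \<notin> {0..1} \<times> sector 1 0" using that by (auto simp: points_in_conv)
      then have "(rad i, ang i) \<notin> {0..1} \<times> {0..<2 * pi}" unfolding X_eq[of i] sector_1_0 .
      then show ?thesis using rad(1)[OF that] ang[OF that] by auto
    qed
    have c0: "n / M0 / 24 \<le> real (card {i. i < N \<and> X i \<in> hbox R M0 0 s})" if "s < M0" for s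
    proof -
      have "n / M0 / 12 / 2 < real (card {i. i < N \<and> X i \<in> {R - 1..R} \<times> sector M0 s})"
        by (rule sparse_disk_sector[OF nb(3) sp that])
      also have "{R - 1..R} \<times> sector M0 s = hbox R M0 0 s" using R4 by (simp add: hbox_def)
      finally show ?thesis by simp
    qed
    have cL: "real (points_in (collar_box R \<zeta> M1 s) (N, X)) \<le> \<beta> * (1 + collar_mass \<zeta> M1)" if "s < M1" for s
    proof -
      have "\<not> \<beta> * (1 + collar_mass \<zeta> M1) \<le> real (points_in (collar_box R \<zeta> M1 s) (N, X))"
        using nb(4) sp that unfolding crowded_collar_def by blast
      then show ?thesis by linarith
    qed
    have mass0: "0 \<le> collar_mass \<zeta> M1" by (simp add: collar_mass_def)
    have lB0: "0 \<le> \<beta> * (1 + collar_mass \<zeta> M1)" using beta mass0 by simp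
    have pr: "real (card {p\<in>slot_pairs M1. points_in (collar_box R \<zeta> M1 (fst p)) (N, X) \<noteq> 0 \<and>
      points_in (core_box R M1 (snd p)) (N, X) \<noteq> 0}) \<le> t"
    proof -
      have "\<not> t \<le> real (card {p\<in>slot_pairs M1. points_in (collar_box R \<zeta> M1 (fst p)) (N, X) \<noteq> 0 \<and>
        points_in (core_box R M1 (snd p)) (N, X) \<noteq> 0})"
        using nb(5) sp unfolding many_pairs_def by blast
      then show ?thesis by linarith
    qed
    have cK: "lK / 2 \<le> real (card {i. i < N \<and> rad i \<le> R / 2})"
    proof -
      have "lK / 2 < real (card {i. i < N \<and> X i \<in> {0..R / 2} \<times> sector 1 0})"
        by (rule sparse_disk_sector[OF nb(6) sp]) simp
      also have "\<dots> \<le> real (card {i. i < N \<and> rad i \<le> R / 2})"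
        by (intro of_nat_mono card_mono) (auto simp: X_eq)
      finally show ?thesis by simp
    qed
    have f: "deg_factor = max_deg_factor \<beta>" "inner_bound = max_inner_degree \<beta>"
      by (simp_all add: deg_factor_def inner_bound_def max_deg_factor_def max_inner_degree_def)
    have "0 < lK / 2" using lK(2) lB0 t by (intro less_le_trans[OF _ lK(2)]) (simp add: add_nonneg_pos)
    then have "0 < real (card {i. i < N \<and> rad i \<le> R / 2})" using cK by linarith
    then have "N \<noteq> 0" by (intro notI) simp
    then have "verts G \<noteq> {}" by auto
    then have chi: "1 \<le> chromatic_number G"
      using chromatic_number_pos[of G] no_loop_edge by simp
    let ?x = "real n powr \<delta> * real (chromatic_number G)"
    have "real n powr \<delta> * 1 \<le> ?x" using chi by (intro mult_left_mono) auto
    then have k_lo: "8 * deg_factor \<le> real (nat \<lfloor>?x\<rfloor>)" using delta unfolding f by linarith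
    have "?x \<le> k_hi"
      unfolding k_hi_def using chromatic_number_le unfolding f by (intro mult_left_mono) auto
    moreover have "real (nat \<lfloor>?x\<rfloor>) \<le> ?x" by (simp add: of_nat_floor)
    ultimately have k_hi: "real (nat \<lfloor>?x\<rfloor>) \<le> k_hi" by linarith
    have Nb: "real N \<le> Nb" unfolding Nb_def by (rule N_le)
    have "1 - Nb powr (\<beta> * (1 + collar_mass \<zeta> M1) * t) * exp (- (lK / 2)\<^sup>2 / (8 * k_hi))
       - Nb * k_hi * exp (- ((n / M0 / 24) / (2 * deg_factor + 1))
          / (2 * max k_hi (deg_factor * exp ((1 - \<zeta>) * R / 4))))
      \<le> rct_prob G {..<nat \<lfloor>?x\<rfloor>} (never_terminates G)"
      by (rule rct_never_terminates_ge[OF rad1 zeta(1,3) M0 c0 M1 cL lB0 pr cK lK(2) k_lo k_hi Nb])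
    then show "rct_prob (geometric_graph R (N, X)) {..<nat \<lfloor>real n powr \<delta> * real (chromatic_number (geometric_graph R (N, X)))\<rfloor>}
        (never_terminates (geometric_graph R (N, X))) \<ge> 1
      - (Nb powr (\<beta> * (1 + collar_mass \<zeta> M1) * t) * exp (- (lK / 2)\<^sup>2 / (8 * k_hi))
       + Nb * k_hi * exp (- ((n / M0 / 24) / (2 * max_deg_factor \<beta> + 1))
          / (2 * max k_hi (max_deg_factor \<beta> * exp ((1 - \<zeta>) * R / 4)))))"
      unfolding f G_def by linarith
  qed
qed

end

subsection \<open>Asymptotics\<close>

lemma exp_mult_hrg_radius:
  assumes "0 < n"
  shows "exp (x * hrg_radius C n) = exp (x * C) * real n powr (2 * x)"
proof -
  have "x * hrg_radius C n = x * C + 2 * x * ln (real n)"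
    by (simp add: hrg_radius_def algebra_simps)
  then show ?thesis using assms by (simp add: exp_add powr_def)
qed

lemma exp_mult_ln: "0 < n \<Longrightarrow> exp (x * ln (real n)) = real n powr x"
  by (simp add: powr_def)

lemma typical_hrgI:
  assumes "\<forall>\<^sub>F n in sequentially. 1 - e n \<le> hrg_prob \<alpha> C n (Q n)" "e \<longlonglongrightarrow> 0" "0 < \<alpha>"
  shows "typical_hrg \<alpha> C Q"
  unfolding typical_hrg_def
proof (rule tendsto_sandwich)
  show "(\<lambda>n. 1 - e n) \<longlonglongrightarrow> 1" using tendsto_diff[OF tendsto_const assms(2), of 1] by simp
  have "\<forall>\<^sub>F n in sequentially. 0 < hrg_radius C n" unfolding hrg_radius_def by real_asymp
  then show "\<forall>\<^sub>F n in sequentially. hrg_prob \<alpha> C n (Q n) \<le> 1"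
    using eventually_gt_at_top[of 0]
  proof eventually_elim
    case (elim n)
    then interpret P: prob_space "poisson_process (hrg_intensity \<alpha> C n)"
      using finite_measure_hrg_intensity measure_hrg_intensity_pos assms(3)
      by (intro prob_space_poisson_process) auto
    show ?case unfolding hrg_prob_def by (rule P.prob_le_1)
  qed
qed (use assms in auto)

lemma (in hrg_params) hrg_prob_mono:
  assumes "\<And>G. Q G \<Longrightarrow> Q' G"
  shows "hrg_prob \<alpha> C n Q \<le> hrg_prob \<alpha> C n Q'"
  unfolding hrg_prob_def
proof (rule PP.finite_measure_mono)
  show "{\<omega>\<in>space PP. Q (geometric_graph R \<omega>)} \<subseteq> {\<omega>\<in>space PP. Q' (geometric_graph R \<omega>)}"
    using assms by blast
qed (rule sets_poisson_process_geometric_graph, simp)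

lemma hrg_params_eventually:
  assumes "1 / 2 < \<alpha>" "\<alpha> < 1"
  shows "\<forall>\<^sub>F n in sequentially. hrg_params \<alpha> C n"
proof -
  have "\<forall>\<^sub>F n in sequentially. 4 \<le> hrg_radius C n" unfolding hrg_radius_def by real_asymp
  with eventually_gt_at_top[of 0] show ?thesis
    by eventually_elim (use assms in \<open>simp add: hrg_params_def\<close>)
qed

context hrg_params
begin

lemma R_eq: "R = 2 * ln (real n) + C"
  by (simp add: hrg_radius_def)

lemmas exp_R = exp_mult_hrg_radius[OF n, of _ C]

lemma max_deg_factor_eq: "max_deg_factor \<beta> = 3 * \<beta> * (2 * ln (real n) + C + 1) * (1 + 96 * exp (- C / 2))"
proof -
  have "real n * exp (- R / 2) = exp (- C / 2)"
    using exp_R[of "- 1 / 2"] n by (simp add: powr_minus_divide)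
  then show ?thesis by (simp add: max_deg_factor_def R_eq)
qed

lemma max_inner_degree_eq: "max_inner_degree \<beta> =
  3 * \<beta> * (2 * ln (real n) + C + 1) * (1 + 96 * exp (- \<alpha> * C / 2) * real n powr (1 - \<alpha>))"
proof -
  have "exp (- \<alpha> * R / 2) = exp (- \<alpha> * C / 2) * real n powr (- \<alpha>)"
    using exp_R[of "- \<alpha> / 2"] by simp
  moreover have "real n powr (1 - \<alpha>) = real n * real n powr (- \<alpha>)"
    using n by (simp add: powr_diff powr_minus_divide)
  ultimately show ?thesis by (simp add: max_inner_degree_def R_eq mult_ac)
qed

lemma max_deg_factor_pos: "0 < \<beta> \<Longrightarrow> 0 < max_deg_factor \<beta>"
  using R4 by (simp add: max_deg_factor_def add_pos_nonneg)

lemma max_inner_degree_nonneg: "0 < \<beta> \<Longrightarrow> 0 \<le> max_inner_degree \<beta>"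
  using R4 by (simp add: max_inner_degree_def)

lemma ceiling_slots:
  assumes "0 < w"
  shows "0 < nat \<lceil>2 * pi * w\<rceil>" "2 * pi / nat \<lceil>2 * pi * w\<rceil> \<le> inverse w" "real (nat \<lceil>2 * pi * w\<rceil>) \<le> 2 * pi * w + 1"
proof -
  have "0 < 2 * pi * w" using assms by simp
  then have M: "0 < nat \<lceil>2 * pi * w\<rceil>" "2 * pi * w \<le> real (nat \<lceil>2 * pi * w\<rceil>)" "real (nat \<lceil>2 * pi * w\<rceil>) \<le> 2 * pi * w + 1"
    by linarith+
  then show "0 < nat \<lceil>2 * pi * w\<rceil>" "real (nat \<lceil>2 * pi * w\<rceil>) \<le> 2 * pi * w + 1" by auto
  have "2 * pi / nat \<lceil>2 * pi * w\<rceil> \<le> 2 * pi / (2 * pi * w)"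
    using M assms by (intro divide_left_mono) auto
  then show "2 * pi / nat \<lceil>2 * pi * w\<rceil> \<le> inverse w" by (simp add: inverse_eq_divide)
qed

end

text \<open>The exponents are abstract and constrained by linear inequalities, so
  \<open>real_asymp\<close> can decide their order. The condition \<open>p4 + e < p1\<close> says
  that there are more forced pairs than colours.\<close>

lemma terminates_after_2_error_tendsto:
  fixes e p1 p2 p3 p4 :: real
  assumes "0 < e" "p4 + e < p1" "0 < p3" "p3 < p1" "p2 < 0" "0 < \<epsilon>" "0 < k" "0 < c1" "0 < c2" "0 < c3"
  shows "(\<lambda>n::nat. exp (- ((real n powr p1 - c1 * real n powr p2) / 2 - (c2 * real n powr p3 + 1)) /
     (\<epsilon> * (3 * real n powr e * (2 * ln (real n) + C + 1) * k * (c3 * real n powr p4))))) \<longlonglongrightarrow> 0"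
  using assms by real_asymp

text \<open>Exponent count: edges give \<open>1 + 2 * e\<close>, inner degrees \<open>e + r\<close>,
  and the squared number of colours at least \<open>2 * (1 - t)\<close>, up to logarithms.\<close>

lemma terminates_after_2_error_tendsto':
  fixes e t r :: real
  assumes "0 < e" "0 < t" "t < 1" "0 < r" "1 + 3 * e + r < 2 * (1 - t)" "0 < \<epsilon>" "0 < c1" "0 < c2" "0 < c3"
  shows "(\<lambda>n::nat. 8 * ((2 * ln (real n) + C + 1) * (real n powr e * (3 * real n powr e * (2 * ln (real n) + C + 1) * c1) * (c2 * real n + 4 * real n)))
     * (4 + 3 * real n powr e * (2 * ln (real n) + C + 1) * (1 + c3 * real n powr r)) * exp (4 / \<epsilon>) / (\<epsilon> * (real n / (2 * pi * real n powr t + 1) / 4 - 1))\<^sup>2) \<longlonglongrightarrow> 0"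
  using assms by real_asymp

lemma typical_hrg_terminates_after_2:
  fixes \<alpha> C \<epsilon> :: real
  assumes alpha: "1 / 2 < \<alpha>" "\<alpha> < 1" and eps: "0 < \<epsilon>"
  shows "\<exists>f :: nat \<Rightarrow> real. f \<longlonglongrightarrow> 0 \<and> typical_hrg \<alpha> C (\<lambda>n G.
    rct_prob G {..<nat \<lfloor>\<epsilon> * real (max_degree G)\<rfloor>} (terminates_after G 2) \<ge> 1 - f n)"
proof -
  \<comment> \<open>The first bound makes a disk of radius \<open>8 * \<eta> * ln n\<close> empty
    a.a.s.; the second leaves room in the exponent gap
    \<open>(1 - \<alpha>)\<^sup>2 / \<alpha>\<close>.\<close>
  define \<eta> where "\<eta> = min ((2 * \<alpha> - 1) / 16) ((1 - \<alpha>)\<^sup>2 / 16)"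
  have \<eta>: "0 < \<eta>" "\<eta> < 1 / 16" "16 * \<eta> \<le> 2 * \<alpha> - 1" "16 * \<eta> \<le> (1 - \<alpha>)\<^sup>2"
    using alpha by (auto simp: \<eta>_def min_def)
  have \<alpha>\<eta>: "0 < \<alpha> * \<eta>" "\<alpha> * \<eta> < \<eta>" using alpha \<eta>(1) by auto
  \<comment> \<open>A vertex of radius \<open>2 * \<theta> * ln n\<close> reaches a sector of width
    about \<open>n powr (- \<theta>)\<close>. The excess \<open>\<eta> / 2\<close> makes about
    \<open>n powr (\<alpha> * \<eta>)\<close> such vertices expected, so the degree is at least of
    order \<open>n powr (1 / (2 * \<alpha>) - \<eta> / 2)\<close>.\<close>
  define \<theta> where "\<theta> = 1 - 1 / (2 * \<alpha>) + \<eta> / 2"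
  define q where "q = 2 - 1 / \<alpha> + \<eta>"
  have inv: "1 < 1 / \<alpha>" "1 / \<alpha> < 2" using alpha by (auto simp: field_simps)
  have q_eq: "q = 2 * \<theta>" by (simp add: q_def \<theta>_def)
  have q: "0 < q" "q < 2" using inv \<eta>(1,2) by (simp_all add: q_def)
  have \<theta>: "0 < \<theta>" "\<theta> < 1" using q by (simp_all add: q_eq)
  have "(1 - \<alpha>)\<^sup>2 \<le> (1 - \<alpha>)\<^sup>2 / \<alpha>" using alpha by (simp add: pos_le_divide_eq mult_left_le)
  also have "(1 - \<alpha>)\<^sup>2 / \<alpha> = 1 / \<alpha> - 2 + \<alpha>" using alpha by (simp add: power2_eq_square field_simps)
  finally have "16 * \<eta> \<le> 1 / \<alpha> - 2 + \<alpha>" using \<eta>(4) by (rule order_trans[rotated])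
  moreover have "2 * (1 - \<theta>) = 1 / \<alpha> - \<eta>" using q_def by (simp add: q_eq)
  ultimately have gap: "1 + 3 * \<eta> + (1 - \<alpha>) < 2 * (1 - \<theta>)" using \<eta>(1) by simp
  define c1 where "c1 = 2 * exp (- \<alpha> * C)"
  have c1: "0 < c1" by (simp add: c1_def)
  define W1 W2 where "W1 n = 2 * pi * real n powr \<theta> + 1"
    and "W2 n = 2 * pi * exp (C / 2) * real n powr (1 - \<eta>) + 1" for n :: nat
  define l1 l2 where "l1 n = exp (- \<alpha> * C) * (real n powr (\<alpha> * \<eta>) - 2 * cosh \<alpha> * real n powr (1 - 2 * \<alpha>))"
    and "l2 n = real n powr (1 - \<alpha> * \<eta>) - c1 * real n powr (1 - 2 * \<alpha>)" for n :: nat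
  define f1 where "f1 n = exp (- ((real n powr (1 - \<alpha> * \<eta>) - c1 * real n powr (1 - 2 * \<alpha>)) / 2
      - (2 * pi * exp (C / 2) * real n powr (1 - \<eta>) + 1)) /
     (\<epsilon> * (3 * real n powr \<eta> * (2 * ln (real n) + C + 1) * (1 + 96 * exp (- C / 2)) * (exp (C / 2) * real n powr (1 - 4 * \<eta>)))))" for n :: nat
  define f2 where "f2 n = 8 * ((2 * ln (real n) + C + 1) * (real n powr \<eta> * (3 * real n powr \<eta> * (2 * ln (real n) + C + 1) * (1 + 96 * exp (- C / 2)))
       * (exp (C / 2) * real n + 4 * real n)))
     * (4 + 3 * real n powr \<eta> * (2 * ln (real n) + C + 1) * (1 + 96 * exp (- \<alpha> * C / 2) * real n powr (1 - \<alpha>)))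
     * exp (4 / \<epsilon>) / (\<epsilon> * (real n / (2 * pi * real n powr \<theta> + 1) / 4 - 1))\<^sup>2" for n :: nat
  define err where "err n = (2 * ln (real n) + C + 1) * (exp C * real n powr 2) * exp (- (real n powr \<eta>))
      + 4 * (exp (- \<alpha> * C) * real n powr (1 - 2 * \<alpha> + 8 * \<alpha> * \<eta>))
      + exp (- l1 n / 10) + W1 n * exp (- (real n / W1 n / 2) / 10) + exp (- l2 n / 10)" for n :: nat
  have "f1 \<longlonglongrightarrow> 0"
    unfolding f1_def using alpha \<eta> \<alpha>\<eta> eps
    by (intro terminates_after_2_error_tendsto) (auto simp: c1_def add_pos_pos)
  moreover have "f2 \<longlonglongrightarrow> 0"
    unfolding f2_def using alpha \<eta> \<theta> gap eps
    by (intro terminates_after_2_error_tendsto') (auto simp: add_pos_pos)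
  ultimately have f: "(\<lambda>n. f1 n + f2 n) \<longlonglongrightarrow> 0" by (rule tendsto_add_zero)
  have err: "err \<longlonglongrightarrow> 0"
    unfolding err_def
  proof (intro tendsto_add_zero)
    show "(\<lambda>n::nat. (2 * ln (real n) + C + 1) * (exp C * real n powr 2) * exp (- (real n powr \<eta>))) \<longlonglongrightarrow> 0"
      using \<eta>(1) by real_asymp
    have "8 * \<alpha> * \<eta> < 2 * \<alpha> - 1" using \<alpha>\<eta> \<eta> by linarith
    then have "1 - 2 * \<alpha> + 8 * \<alpha> * \<eta> < 0" by simp
    then show "(\<lambda>n. 4 * (exp (- \<alpha> * C) * real n powr (1 - 2 * \<alpha> + 8 * \<alpha> * \<eta>))) \<longlonglongrightarrow> 0"
      by real_asymp
    show "(\<lambda>n. exp (- l1 n / 10)) \<longlonglongrightarrow> 0"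
    proof -
      have "(\<lambda>n::nat. exp (- (c * (real n powr a - d * real n powr b)) / 10)) \<longlonglongrightarrow> 0"
        if "0 < c" "0 < a" "b < 0" "0 < d" for a b c d :: real
        using that by real_asymp
      from this[of "exp (- \<alpha> * C)" "\<alpha> * \<eta>" "1 - 2 * \<alpha>" "2 * cosh \<alpha>"]
      show ?thesis unfolding l1_def using alpha \<alpha>\<eta>(1) by simp
    qed
    show "(\<lambda>n. W1 n * exp (- (real n / W1 n / 2) / 10)) \<longlonglongrightarrow> 0"
      unfolding W1_def using \<theta> by real_asymp
    show "(\<lambda>n. exp (- l2 n / 10)) \<longlonglongrightarrow> 0"
    proof -
      have "(\<lambda>n::nat. exp (- (real n powr a - d * real n powr b) / 10)) \<longlonglongrightarrow> 0"
        if "0 < a" "b < 0" "0 < d" for a b d :: real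
        using that by real_asymp
      from this[of "1 - \<alpha> * \<eta>" "1 - 2 * \<alpha>" c1]
      show ?thesis unfolding l2_def using alpha \<alpha>\<eta>(2) \<eta>(2) c1 by simp
    qed
  qed
  have "\<forall>\<^sub>F n in sequentially. hrg_params \<alpha> C n" by (rule hrg_params_eventually[OF alpha])
  moreover have "\<forall>\<^sub>F n in sequentially. 2 \<le> real n powr \<eta>" using \<eta>(1) by real_asymp
  moreover have "\<forall>\<^sub>F n in sequentially. 0 \<le> 8 * \<eta> * ln (real n) \<and> 8 * \<eta> * ln (real n) \<le> 2 * ln (real n) + C"
    using \<eta>(1,2) by (intro eventually_conj; real_asymp)
  moreover have "\<forall>\<^sub>F n in sequentially. 1 \<le> q * ln (real n) \<and> q * ln (real n) \<le> 2 * ln (real n) + C - 1"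
    using q(1,2) by (intro eventually_conj; real_asymp)
  moreover have "\<forall>\<^sub>F n in sequentially. 0 \<le> l1 n"
  proof -
    have "\<forall>\<^sub>F n in sequentially. 0 \<le> c * (real n powr a - d * real n powr b)"
      if "0 < c" "0 < a" "b < 0" "0 < d" for a b c d :: real
      using that by real_asymp
    from this[of "exp (- \<alpha> * C)" "\<alpha> * \<eta>" "1 - 2 * \<alpha>" "2 * cosh \<alpha>"]
    show ?thesis unfolding l1_def using alpha \<alpha>\<eta>(1) by simp
  qed
  moreover have "\<forall>\<^sub>F n in sequentially. 4 \<le> \<epsilon> * (real n / W1 n / 4 - 1)"
    unfolding W1_def using \<theta> eps by real_asymp
  moreover have "\<forall>\<^sub>F n in sequentially. 1 \<le> \<eta> * ln (real n) \<and> \<eta> * ln (real n) \<le> 2 * ln (real n) + C"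
    using \<eta>(1,2) by (intro eventually_conj; real_asymp)
  moreover have "\<forall>\<^sub>F n in sequentially. W2 n \<le> l2 n / 2"
  proof -
    have "\<forall>\<^sub>F n in sequentially. 2 * pi * c * real n powr e + 1 \<le> (real n powr a - d * real n powr b) / 2"
      if "0 < c" "0 < e" "e < a" "b < 0" "0 < d" for a b c d e :: real
      using that by real_asymp
    from this[of "exp (C / 2)" "1 - \<eta>" "1 - \<alpha> * \<eta>" "1 - 2 * \<alpha>" c1]
    show ?thesis unfolding W2_def l2_def using alpha \<alpha>\<eta>(2) \<eta>(2) c1 by simp
  qed
  ultimately have "\<forall>\<^sub>F n in sequentially. 1 - err n \<le> hrg_prob \<alpha> C n (\<lambda>G.
    rct_prob G {..<nat \<lfloor>\<epsilon> * real (max_degree G)\<rfloor>} (terminates_after G 2) \<ge> 1 - (f1 n + f2 n))"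
  proof eventually_elim
    case (elim n)
    interpret hrg_params \<alpha> C n by (rule elim(1))
    let ?\<beta> = "real n powr \<eta>"
    \<comment> \<open>\<open>?r0\<close> only bounds the degree by about
      \<open>n powr (1 - 4 * \<eta>)\<close>, times \<open>max_deg_factor\<close>. This is enough:
      about \<open>n powr (1 - \<alpha> * \<eta>)\<close> points lie at distance \<open>?b\<close>
      or more from the boundary, far more than the \<open>n powr (1 - \<eta>)\<close>
      representatives and than the colours.\<close>
    let ?r0 = "8 * \<eta> * ln (real n)" and ?r1 = "q * ln (real n)" and ?b = "\<eta> * ln (real n)"
    let ?w1 = "real n powr \<theta>" and ?w2 = "exp (C / 2) * real n powr (1 - \<eta>)"
    define m1 m2 where "m1 = nat \<lceil>2 * pi * ?w1\<rceil>" and "m2 = nat \<lceil>2 * pi * ?w2\<rceil>"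
    have w: "0 < ?w1" "0 < ?w2" using n by auto
    note M1 = ceiling_slots[OF w(1), folded m1_def] and M2 = ceiling_slots[OF w(2), folded m2_def]
    have W1: "real m1 \<le> W1 n" using M1(3) by (simp add: W1_def)
    have W2: "real m2 \<le> W2 n" using M2(3) by (simp add: W2_def mult.assoc)
    have m1: "0 < real m1" using M1(1) by simp
    have W1_pos: "0 < W1 n" using m1 W1 by linarith
    have nM: "real n / W1 n \<le> real n / m1"
      using W1 m1 W1_pos by (intro divide_left_mono mult_pos_pos) auto
    have beta: "0 < ?\<beta>" using n by simp
    have inv_w1: "inverse ?w1 = exp (- ?r1 / 2)"
    proof -
      have a: "- ?r1 / 2 = - (\<theta> * ln (real n))" by (simp add: q_eq)
      have b: "?w1 = exp (\<theta> * ln (real n))" using n by (simp add: powr_def)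
      show ?thesis unfolding a b by (simp only: exp_minus)
    qed
    have inv_w2: "inverse ?w2 = exp ((2 * ?b - R) / 2)"
    proof -
      have a: "(2 * ?b - R) / 2 = - (C / 2 + (1 - \<eta>) * ln (real n))" by (simp add: R_eq field_simps)
      have b: "?w2 = exp (C / 2 + (1 - \<eta>) * ln (real n))" using n by (simp add: exp_add powr_def)
      show ?thesis unfolding a b by (simp only: exp_minus)
    qed
    have er1: "exp (\<alpha> * ?r1) = real n powr (2 * \<alpha> - 1 + \<alpha> * \<eta>)"
    proof -
      have "\<alpha> * q = 2 * \<alpha> - 1 + \<alpha> * \<eta>" using alpha by (simp add: q_def field_simps)
      then have a: "\<alpha> * ?r1 = (2 * \<alpha> - 1 + \<alpha> * \<eta>) * ln (real n)" by (simp only: mult.assoc[symmetric])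
      show ?thesis unfolding a by (rule exp_mult_ln[OF n])
    qed
    have eaR: "exp (- \<alpha> * R) = exp (- \<alpha> * C) * real n powr (- 2 * \<alpha>)" using exp_R[of "- \<alpha>"] by simp
    have l1: "l1 n = n * ((exp (\<alpha> * ?r1) - 2 * cosh \<alpha>) * exp (- \<alpha> * R))"
    proof -
      have a: "real n powr (\<alpha> * \<eta>) = real n * real n powr (2 * \<alpha> - 1 + \<alpha> * \<eta>) * real n powr (- 2 * \<alpha>)"
        using n by (simp add: powr_mult_base powr_add[symmetric])
      have b: "real n powr (1 - 2 * \<alpha>) = real n * real n powr (- 2 * \<alpha>)"
        using n by (simp add: powr_mult_base)
      show ?thesis unfolding l1_def er1 eaR a b by (simp only: ring_distribs mult_ac)
    qed
    have l2: "l2 n = n * ((exp (\<alpha> * (R - ?b)) - 2) * exp (- \<alpha> * R))"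
    proof -
      have "exp (\<alpha> * (R - ?b)) * exp (- \<alpha> * R) = exp (- \<alpha> * \<eta> * ln (real n))"
        by (simp add: exp_add[symmetric] algebra_simps)
      also have "\<dots> = real n powr (- \<alpha> * \<eta>)" by (rule exp_mult_ln[OF n])
      finally have "real n * (exp (\<alpha> * (R - ?b)) * exp (- \<alpha> * R)) = real n powr (1 - \<alpha> * \<eta>)"
        using n by (simp add: powr_mult_base)
      moreover have "real n powr (1 - 2 * \<alpha>) = real n * real n powr (- 2 * \<alpha>)"
        using n by (simp add: powr_mult_base)
      moreover have "n * ((exp (\<alpha> * (R - ?b)) - 2) * exp (- \<alpha> * R)) =
          real n * (exp (\<alpha> * (R - ?b)) * exp (- \<alpha> * R)) - 2 * (real n * exp (- \<alpha> * R))"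
        by (simp add: algebra_simps)
      ultimately show ?thesis unfolding l2_def c1_def eaR by (simp only: mult_ac)
    qed
    have large: "4 \<le> \<epsilon> * (n / W1 n / 4 - 1)" using elim(6) .
    have nM': "\<epsilon> * (n / W1 n / 4 - 1) \<le> \<epsilon> * (n / m1 / 4 - 1)"
      using nM eps by (intro mult_left_mono) auto
    let ?F1 = "exp (- (l2 n / 2 - m2) / (\<epsilon> * (max_deg_factor ?\<beta> * exp ((R - ?r0) / 2))))"
    let ?F2 = "8 * ((R + 1) * (?\<beta> * max_deg_factor ?\<beta> * (exp (R / 2) + 4 * real n))) * (4 + max_inner_degree ?\<beta>)
        * exp (4 / \<epsilon>) / (\<epsilon> * (n / m1 / 4 - 1))\<^sup>2"
    have main: "1 - ((R + 1) * exp R * exp (- ?\<beta>) + 4 * real n * exp (- \<alpha> * (R - ?r0)) + exp (- l1 n / 10)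
      + m1 * exp (- (n / m1 / 2) / 10) + exp (- l2 n / 10))
      \<le> hrg_prob \<alpha> C n (\<lambda>G. rct_prob G {..<nat \<lfloor>\<epsilon> * real (max_degree G)\<rfloor>} (terminates_after G 2) \<ge> 1 - (?F1 + ?F2))"
    proof (rule hrg_prob_terminates_after_2_ge)
      show "4 \<le> \<epsilon> * (n / m1 / 4 - 1)" using large nM' by linarith
      show "real m2 \<le> l2 n / 2" using W2 elim(8) by linarith
      show "2 * pi / real m1 \<le> exp (- ?r1 / 2)" using M1(2) unfolding inv_w1 .
      show "2 * pi / real m2 \<le> exp ((2 * ?b - R) / 2)" using M2(2) unfolding inv_w2 .
    qed (use elim eps M1(1) M2(1) l1 l2 in \<open>auto simp: R_eq\<close>)
    have F1: "?F1 \<le> f1 n"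
    proof -
      have a: "(R - ?r0) / 2 = C / 2 + (1 - 4 * \<eta>) * ln (real n)" by (simp add: R_eq field_simps)
      have e: "exp ((R - ?r0) / 2) = exp (C / 2) * real n powr (1 - 4 * \<eta>)"
        unfolding a using n by (simp add: exp_add powr_def)
      have f1_eq: "f1 n = exp (- (l2 n / 2 - W2 n) / (\<epsilon> * (max_deg_factor ?\<beta> * exp ((R - ?r0) / 2))))"
        unfolding f1_def l2_def W2_def e max_deg_factor_eq by simp
      have "0 < \<epsilon> * (max_deg_factor ?\<beta> * exp ((R - ?r0) / 2))"
        using eps max_deg_factor_pos[OF beta] by simp
      then show ?thesis unfolding f1_eq using W2 by (simp add: divide_right_mono)
    qed
    have F2: "?F2 \<le> f2 n"
    proof -
      have e: "exp (R / 2) = exp (C / 2) * real n" using exp_R[of "1 / 2"] n by simp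
      have f2_eq: "f2 n = 8 * ((R + 1) * (?\<beta> * max_deg_factor ?\<beta> * (exp (R / 2) + 4 * real n))) * (4 + max_inner_degree ?\<beta>)
        * exp (4 / \<epsilon>) / (\<epsilon> * (n / W1 n / 4 - 1))\<^sup>2"
        unfolding f2_def W1_def e max_deg_factor_eq max_inner_degree_eq unfolding R_eq by simp
      show ?thesis unfolding f2_eq
      proof (rule divide_left_mono)
        show "(\<epsilon> * (n / W1 n / 4 - 1))\<^sup>2 \<le> (\<epsilon> * (n / m1 / 4 - 1))\<^sup>2"
          using large nM' by (intro power_mono) auto
        show "0 \<le> 8 * ((R + 1) * (?\<beta> * max_deg_factor ?\<beta> * (exp (R / 2) + 4 * real n))) * (4 + max_inner_degree ?\<beta>) * exp (4 / \<epsilon>)"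
          using R4 max_deg_factor_pos[OF beta] max_inner_degree_nonneg[OF beta]
          by (intro mult_nonneg_nonneg add_nonneg_nonneg) auto
        have "0 < \<epsilon> * (n / m1 / 4 - 1)" "0 < \<epsilon> * (n / W1 n / 4 - 1)" using large nM' by linarith+
        then show "0 < (\<epsilon> * (n / m1 / 4 - 1))\<^sup>2 * (\<epsilon> * (n / W1 n / 4 - 1))\<^sup>2"
          using mult_pos_pos[OF zero_less_power zero_less_power] by blast
      qed
    qed
    have E2: "4 * real n * exp (- \<alpha> * (R - ?r0)) = 4 * (exp (- \<alpha> * C) * real n powr (1 - 2 * \<alpha> + 8 * \<alpha> * \<eta>))"
    proof -
      have "- \<alpha> * (R - ?r0) = - \<alpha> * R + 8 * \<alpha> * \<eta> * ln (real n)" by (simp add: algebra_simps)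
      then have "exp (- \<alpha> * (R - ?r0)) = exp (- \<alpha> * C) * real n powr (- 2 * \<alpha>) * real n powr (8 * \<alpha> * \<eta>)"
        using exp_mult_ln[OF n, of "8 * \<alpha> * \<eta>"] by (simp only: exp_add eaR)
      also have "\<dots> = exp (- \<alpha> * C) * real n powr (- 2 * \<alpha> + 8 * \<alpha> * \<eta>)" by (simp only: powr_add mult.assoc)
      finally have e: "exp (- \<alpha> * (R - ?r0)) = exp (- \<alpha> * C) * real n powr (- 2 * \<alpha> + 8 * \<alpha> * \<eta>)" .
      have a: "real n powr (1 - 2 * \<alpha> + 8 * \<alpha> * \<eta>) = real n * real n powr (- 2 * \<alpha> + 8 * \<alpha> * \<eta>)"
        using n by (subst powr_mult_base) (auto simp: algebra_simps)
      show ?thesis unfolding e a by (simp only: mult_ac)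
    qed
    have E4: "m1 * exp (- (n / m1 / 2) / 10) \<le> W1 n * exp (- (n / W1 n / 2) / 10)"
      using W1 nM by (intro mult_mono) auto
    have E1: "exp R = exp C * real n powr 2" using exp_R[of 1] by simp
    have "1 - err n \<le> 1 - ((R + 1) * exp R * exp (- ?\<beta>) + 4 * real n * exp (- \<alpha> * (R - ?r0)) + exp (- l1 n / 10)
      + m1 * exp (- (n / m1 / 2) / 10) + exp (- l2 n / 10))"
      unfolding err_def E2 E1 unfolding R_eq using E4 by linarith
    also note main
    also have "hrg_prob \<alpha> C n (\<lambda>G. rct_prob G {..<nat \<lfloor>\<epsilon> * real (max_degree G)\<rfloor>} (terminates_after G 2) \<ge> 1 - (?F1 + ?F2))
      \<le> hrg_prob \<alpha> C n (\<lambda>G. rct_prob G {..<nat \<lfloor>\<epsilon> * real (max_degree G)\<rfloor>} (terminates_after G 2) \<ge> 1 - (f1 n + f2 n))"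
      using F1 F2 by (intro hrg_prob_mono) linarith
    finally show ?case .
  qed
  then have "typical_hrg \<alpha> C (\<lambda>n G.
    rct_prob G {..<nat \<lfloor>\<epsilon> * real (max_degree G)\<rfloor>} (terminates_after G 2) \<ge> 1 - (f1 n + f2 n))"
    by (rule typical_hrgI) (use err alpha in auto)
  with f show ?thesis by blast
qed

text \<open>Giving up about \<open>n powr (e + s)\<close> blockers costs that exponent, while the
  birthday bound gains \<open>n powr (2 * p - (d + e + p))\<close>, up to logarithms. The target is
  a quarter of \<open>n powr (- ln n)\<close>.\<close>

lemma clique_colours_error_eventually:
  fixes e s p d q :: real
  assumes "0 < e" "0 < s" "0 < p" "0 < d" "e + s < p - d - e" "q < 0" "0 < c1" "0 < c2" "0 < c3"
  shows "\<forall>\<^sub>F n :: nat in sequentially. exp ((2 * real n powr e * real n powr s) * (2 * ln (real n)))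
      * exp (- ((c1 * real n powr p - c2 * real n powr q) / 2)\<^sup>2 / (8 * (real n powr d * (3 * real n powr e * (2 * ln (real n) + C + 1) * (1 + c3 * real n powr p) + 1))))
     \<le> exp (- ln (real n) * ln (real n)) / 4"
  using assms by real_asymp

text \<open>A set \<open>W v\<close> has about \<open>n powr (1 / 2 - e)\<close> vertices; the
  hypothesis says that this exceeds the scale \<open>k_hi\<close> by a power of \<open>n\<close>.
  The companion lemma treats the other candidate for the maximum, the degree beyond the
  collar.\<close>

lemma adoption_error_eventually:
  fixes e p d :: real
  assumes "0 < e" "0 < p" "0 < d" "d + p + 2 * e < 1 / 2" "0 < c1" "0 < c2" "0 < c3"
  shows "\<forall>\<^sub>F n :: nat in sequentially. ((2 * ln (real n) + C + 1) * (real n powr e * (1 + 4 * real n)))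
      * (real n powr d * (3 * real n powr e * (2 * ln (real n) + C + 1) * (1 + c3 * real n powr p) + 1))
      * exp (- ((real n / (c1 * real n powr (1 / 2) + 1) / 24) / (2 * (3 * real n powr e * (2 * ln (real n) + C + 1) * c2) + 1))
        / (2 * (real n powr d * (3 * real n powr e * (2 * ln (real n) + C + 1) * (1 + c3 * real n powr p) + 1))))
     \<le> exp (- ln (real n) * ln (real n)) / 4"
  using assms by real_asymp

lemma adoption_error_eventually':
  fixes e p d z :: real
  assumes "0 < e" "0 < p" "0 < d" "2 * e + z < 1 / 2" "0 < z" "0 < c1" "0 < c2" "0 < c3" "0 < c4"
  shows "\<forall>\<^sub>F n :: nat in sequentially. ((2 * ln (real n) + C + 1) * (real n powr e * (1 + 4 * real n)))
      * (real n powr d * (3 * real n powr e * (2 * ln (real n) + C + 1) * (1 + c3 * real n powr p) + 1))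
      * exp (- ((real n / (c1 * real n powr (1 / 2) + 1) / 24) / (2 * (3 * real n powr e * (2 * ln (real n) + C + 1) * c2) + 1))
        / (2 * (3 * real n powr e * (2 * ln (real n) + C + 1) * c2 * (c4 * real n powr z))))
     \<le> exp (- ln (real n) * ln (real n)) / 4"
  using assms by real_asymp

text \<open>Splits the maximum so that each alternative can be compared asymptotically on its
  own.\<close>

lemma exp_div_max_le:
  fixes x a b :: real
  assumes "0 \<le> x" "0 < a" "0 < b"
  shows "exp (- x / (2 * max a b)) \<le> exp (- x / (2 * a)) + exp (- x / (2 * b))"
  by (cases "a \<le> b") (simp_all add: max_def)

lemma typical_hrg_never_terminates:
  fixes \<alpha> C :: real
  assumes alpha: "1 / 2 < \<alpha>" "\<alpha> < 1"
  shows "\<exists>\<delta>>0. \<exists>g :: nat \<Rightarrow> real. filterlim g at_top sequentially \<and> typical_hrg \<alpha> C (\<lambda>n G.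
    rct_prob G {..<nat \<lfloor>real n powr \<delta> * real (chromatic_number G)\<rfloor>} (never_terminates G) \<ge> 1 - real n powr (- g n))"
proof -
  \<comment> \<open>The core has about \<open>n powr \<rho>\<close> vertices in about
    \<open>n powr (1 / 2)\<close> sectors; \<open>\<sigma> = 1 / 2 - \<rho>\<close> measures how
    sparse it is there.\<close>
  define \<sigma> \<rho> where "\<sigma> = \<alpha> - 1 / 2" and "\<rho> = 1 - \<alpha>"
  define m where "m = min \<sigma> \<rho>"
  \<comment> \<open>\<open>\<delta>\<close> is the surplus of colours, \<open>\<eta>\<close> the
    tolerated deviation of counts, \<open>\<zeta>\<close> the collar width, and
    \<open>n powr \<tau>\<close> the tolerated number of occupied pairs. The choice of
    \<open>\<zeta>\<close> adds only \<open>\<sigma> / 4\<close> to the exponent of the collar mass,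
    and \<open>\<tau> + \<delta> + 2 * \<eta> < \<rho>\<close> lets the repetitions win.\<close>
  define \<delta> \<eta> \<zeta> \<tau> where "\<delta> = m / 8" and "\<eta> = m / 100" and "\<zeta> = \<sigma> / (4 * \<alpha>)" and "\<tau> = \<rho> - m / 2"
  define q where "q = \<rho> + \<sigma> / 4"
  have \<sigma>\<rho>: "0 < \<sigma>" "0 < \<rho>" "\<sigma> + \<rho> = 1 / 2" using alpha by (simp_all add: \<sigma>_def \<rho>_def)
  have m: "0 < m" "m \<le> \<sigma>" "m \<le> \<rho>" using \<sigma>\<rho> by (simp_all add: m_def)
  have \<zeta>: "\<sigma> / 4 < \<zeta>" "\<zeta> < 1 / 2" "\<alpha> * \<zeta> = \<sigma> / 4"
  proof -
    show "\<sigma> / 4 < \<zeta>" unfolding \<zeta>_def using alpha \<sigma>\<rho> by (intro divide_strict_left_mono) auto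
    show "\<zeta> < 1 / 2" unfolding \<zeta>_def using alpha \<sigma>\<rho> by (simp add: divide_less_eq)
    show "\<alpha> * \<zeta> = \<sigma> / 4" unfolding \<zeta>_def using alpha by simp
  qed
  have \<zeta>0: "0 < \<zeta>" using \<zeta>(1) \<sigma>\<rho>(1) by linarith
  define c1 c2 c3 where "c1 = 2 * pi * exp (C / 4)" and "c2 = 1 + 96 * exp (- C / 2)" and "c3 = 96 * exp (- \<alpha> * C / 2)"
  define c4 c5 c6 where "c4 = exp ((1 - \<zeta>) * C / 4)" and "c5 = exp (- \<alpha> * C / 2)" and "c6 = 2 * exp (- \<alpha> * C)"
  define cL where "cL = 4 * exp (- \<alpha> * (1 - \<zeta>) * C / 2)"
  have c: "0 < c1" "0 < c2" "0 < c3" "0 < c4" "0 < c5" "0 < c6" "0 < cL"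
    by (auto simp: c1_def c2_def c3_def c4_def c5_def c6_def cL_def add_pos_pos)
  define W V where "W n = c1 * real n powr (1 / 2) + 1" and "V n = c1 / 49 * real n powr (1 / 2) - 1" for n :: nat
  define lK where "lK n = c5 * real n powr \<rho> - c6 * real n powr (1 - 2 * \<alpha>)" for n :: nat
  define DF IB where "DF n = 3 * real n powr \<eta> * (2 * ln (real n) + C + 1) * c2"
    and "IB n = 3 * real n powr \<eta> * (2 * ln (real n) + C + 1) * (1 + c3 * real n powr \<rho>)" for n :: nat
  define k_hi where "k_hi n = real n powr \<delta> * (IB n + 1)" for n :: nat
  define Nb where "Nb n = (2 * ln (real n) + C + 1) * (real n powr \<eta> * (1 + 4 * real n))" for n :: nat
  define err where "err n = (2 * ln (real n) + C + 1) * (exp C * real n powr 2) * exp (- (real n powr \<eta>))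
      + 4 * (exp (\<alpha> - \<alpha> * C) * real n powr (1 - 2 * \<alpha>))
      + W n * exp (- (real n / W n / 12) / 10) + W n * exp (- (real n powr \<eta>))
      + 3 * (cL * real n powr q * (4 * c5 * real n powr \<rho>) / (V n * real n powr \<tau>))
      + exp (- lK n / 10)" for n :: nat
  have err: "err \<longlonglongrightarrow> 0"
    unfolding err_def
  proof (intro tendsto_add_zero)
    show "(\<lambda>n::nat. (2 * ln (real n) + C + 1) * (exp C * real n powr 2) * exp (- (real n powr \<eta>))) \<longlonglongrightarrow> 0"
      using m(1) unfolding \<eta>_def by real_asymp
    have "1 - 2 * \<alpha> < 0" using alpha by simp
    then show "(\<lambda>n. 4 * (exp (\<alpha> - \<alpha> * C) * real n powr (1 - 2 * \<alpha>))) \<longlonglongrightarrow> 0"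
      by real_asymp
    show "(\<lambda>n. W n * exp (- (real n / W n / 12) / 10)) \<longlonglongrightarrow> 0"
      unfolding W_def using c(1) by real_asymp
    show "(\<lambda>n. W n * exp (- (real n powr \<eta>))) \<longlonglongrightarrow> 0"
      unfolding W_def \<eta>_def using c(1) m(1) by real_asymp
    \<comment> \<open>About \<open>n powr (q + \<rho> - 1 / 2)\<close> occupied pairs are expected,
      so Markov's inequality at level \<open>n powr \<tau>\<close> succeeds.\<close>
    have "q + \<rho> < \<tau> + 1 / 2" using m \<sigma>\<rho> unfolding q_def \<tau>_def by linarith
    then show "(\<lambda>n. 3 * (cL * real n powr q * (4 * c5 * real n powr \<rho>) / (V n * real n powr \<tau>))) \<longlonglongrightarrow> 0"
      unfolding V_def using c(1) by real_asymp
    have "(\<lambda>n::nat. exp (- (c5 * real n powr \<rho> - c6 * real n powr b) / 10)) \<longlonglongrightarrow> 0" if "b < 0" for b :: real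
      using that \<sigma>\<rho>(2) c(5,6) by real_asymp
    then show "(\<lambda>n. exp (- lK n / 10)) \<longlonglongrightarrow> 0" unfolding lK_def using alpha by simp
  qed
  have "\<forall>\<^sub>F n in sequentially. hrg_params \<alpha> C n" by (rule hrg_params_eventually[OF alpha])
  moreover have "\<forall>\<^sub>F n in sequentially. 2 \<le> real n powr \<eta>" using m(1) unfolding \<eta>_def by real_asymp
  moreover have "\<forall>\<^sub>F n in sequentially. 1 < (1 - \<zeta>) * (2 * ln (real n) + C) / 2"
    using \<zeta>(2) by real_asymp
  moreover have "\<forall>\<^sub>F n in sequentially. 0 < V n" unfolding V_def using c(1) by real_asymp
  moreover have "\<forall>\<^sub>F n in sequentially. cL * real n powr q \<le> V n"
  proof -
    have "q < 1 / 2" using \<sigma>\<rho> unfolding q_def by linarith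
    then show ?thesis unfolding V_def using c(1) by real_asymp
  qed
  moreover have "\<forall>\<^sub>F n in sequentially. 2 * (real n powr \<eta> * 2 * real n powr \<tau>) + 4 \<le> lK n / 2"
  proof -
    have "\<forall>\<^sub>F n in sequentially. 2 * (real n powr \<eta> * 2 * real n powr \<tau>) + 4 \<le> (c5 * real n powr \<rho> - c6 * real n powr b) / 2"
      if "b < 0" "\<eta> + \<tau> < \<rho>" "0 < \<eta>" "0 < \<tau>" for b :: real
      using that \<sigma>\<rho>(2) c(5,6) by real_asymp
    then show ?thesis unfolding lK_def using alpha m by (simp add: \<eta>_def \<tau>_def)
  qed
  moreover have "\<forall>\<^sub>F n in sequentially. 8 * DF n + 1 \<le> real n powr \<delta>"
  proof -
    have "0 < \<eta>" "\<eta> < \<delta>" using m(1) by (simp_all add: \<eta>_def \<delta>_def)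
    then show ?thesis unfolding DF_def using c(2) by real_asymp
  qed
  moreover have "\<forall>\<^sub>F n in sequentially. Nb n \<le> real n powr 2"
  proof -
    have "0 < \<eta>" "\<eta> < 1" using m \<sigma>\<rho> by (simp_all add: \<eta>_def)
    then show ?thesis unfolding Nb_def by real_asymp
  qed
  moreover have "\<forall>\<^sub>F n in sequentially. exp ((2 * real n powr \<eta> * real n powr \<tau>) * (2 * ln (real n)))
      * exp (- (lK n / 2)\<^sup>2 / (8 * k_hi n)) \<le> exp (- ln (real n) * ln (real n)) / 4"
    unfolding lK_def k_hi_def IB_def
    by (rule clique_colours_error_eventually) (use alpha m c in \<open>auto simp: \<eta>_def \<tau>_def \<delta>_def\<close>)
  moreover have "\<forall>\<^sub>F n in sequentially. Nb n * k_hi n * exp (- ((real n / W n / 24) / (2 * DF n + 1)) / (2 * k_hi n))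
      \<le> exp (- ln (real n) * ln (real n)) / 4"
    unfolding Nb_def k_hi_def IB_def DF_def W_def
    by (rule adoption_error_eventually) (use \<sigma>\<rho> m c in \<open>auto simp: \<eta>_def \<delta>_def\<close>)
  moreover have "\<forall>\<^sub>F n in sequentially. Nb n * k_hi n * exp (- ((real n / W n / 24) / (2 * DF n + 1))
        / (2 * (DF n * (c4 * real n powr ((1 - \<zeta>) / 2)))))
      \<le> exp (- ln (real n) * ln (real n)) / 4"
  proof -
    have "(1 - \<zeta>) / 2 = 1 / 2 - \<zeta> / 2" by (simp add: diff_divide_distrib)
    then have "2 * \<eta> + (1 - \<zeta>) / 2 < 1 / 2" "0 < (1 - \<zeta>) / 2" "0 < \<eta>" "0 < \<delta>"
      using m \<zeta>(1,2) unfolding \<eta>_def \<delta>_def by linarith+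
    then show ?thesis
      unfolding Nb_def k_hi_def IB_def DF_def W_def
      using \<sigma>\<rho>(2) c by (intro adoption_error_eventually')
  qed
  ultimately have "\<forall>\<^sub>F n in sequentially. 1 - err n \<le> hrg_prob \<alpha> C n (\<lambda>G.
    rct_prob G {..<nat \<lfloor>real n powr \<delta> * real (chromatic_number G)\<rfloor>} (never_terminates G) \<ge> 1 - real n powr (- ln (real n)))"
  proof eventually_elim
    case (elim n)
    interpret hrg_params \<alpha> C n by (rule elim(1))
    let ?\<beta> = "real n powr \<eta>" and ?t = "real n powr \<tau>"
    let ?w = "exp (C / 4) * real n powr (1 / 2)"
    \<comment> \<open>\<open>m0\<close> is rounded up to make its sectors narrow enough for
      adjacency, \<open>m1\<close> is rounded down to make its sectors wide enough to contain the
      angle in \<open>blockers\<close>.\<close>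
    define m0 m1 where "m0 = nat \<lceil>2 * pi * ?w\<rceil>" and "m1 = nat \<lfloor>2 * pi * ?w / 49\<rfloor>"
    have w: "0 < ?w" using n by simp
    have beta: "0 < ?\<beta>" using n by simp
    have w_eq: "?w = exp (R / 4)" using exp_R[of "1 / 4"] by simp
    note M0 = ceiling_slots[OF w, folded m0_def]
    have m0: "0 < real m0" "real m0 \<le> W n" using M0(1,3) by (simp_all add: W_def c1_def mult.assoc)
    have V: "V n \<le> real m1" "real m1 \<le> 2 * pi * ?w / 49"
    proof -
      have "0 \<le> 2 * pi * ?w / 49" using w by simp
      then have "2 * pi * ?w / 49 - 1 \<le> real m1" "real m1 \<le> 2 * pi * ?w / 49" unfolding m1_def by linarith+
      then show "V n \<le> real m1" "real m1 \<le> 2 * pi * ?w / 49" by (simp_all add: V_def c1_def mult_ac)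
    qed
    have m1: "0 < real m1" using V(1) elim(4) by linarith
    have m1W: "real m1 \<le> W n"
    proof -
      have "2 * pi * ?w / 49 \<le> 2 * pi * ?w" using w by simp
      then show ?thesis using V(2) by (simp add: W_def c1_def mult_ac)
    qed
    have nM: "real n / W n \<le> real n / m0" using m0 by (intro divide_left_mono mult_pos_pos) auto
    have DF: "max_deg_factor ?\<beta> = DF n" unfolding DF_def c2_def by (rule max_deg_factor_eq)
    have IB: "max_inner_degree ?\<beta> = IB n" unfolding IB_def c3_def \<rho>_def by (rule max_inner_degree_eq)
    have DF_pos: "0 < DF n" using max_deg_factor_pos[OF beta] by (simp add: DF)
    have IB0: "0 \<le> IB n" using max_inner_degree_nonneg[OF beta] by (simp add: IB)
    have k_hi_pos: "0 < k_hi n" unfolding k_hi_def using n IB0 by simp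
    have eaR: "exp (- \<alpha> * R) = exp (- \<alpha> * C) * real n powr (- 2 * \<alpha>)" using exp_R[of "- \<alpha>"] by simp
    have eaR2: "exp (- \<alpha> * (R / 2)) = c5 * real n powr (- \<alpha>)" using exp_R[of "- \<alpha> / 2"] by (simp add: c5_def)
    have n_rho: "real n powr \<rho> = real n * real n powr (- \<alpha>)" unfolding \<rho>_def using n by (simp add: powr_mult_base)
    have n_2a: "real n powr (1 - 2 * \<alpha>) = real n * real n powr (- 2 * \<alpha>)" using n by (simp add: powr_mult_base)
    have lK: "lK n = n * ((exp (\<alpha> * (R / 2)) - 2) * exp (- \<alpha> * R))"
    proof -
      have a: "exp (\<alpha> * (R / 2)) * exp (- \<alpha> * R) = exp (- \<alpha> * (R / 2))" by (simp add: exp_add[symmetric])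
      have "n * ((exp (\<alpha> * (R / 2)) - 2) * exp (- \<alpha> * R)) =
          real n * (exp (\<alpha> * (R / 2)) * exp (- \<alpha> * R)) - 2 * (real n * exp (- \<alpha> * R))"
        by (simp add: algebra_simps)
      then show ?thesis unfolding a unfolding lK_def c6_def eaR2 eaR n_rho n_2a by (simp only: mult_ac)
    qed
    have collar: "collar_mass \<zeta> m1 = cL * real n powr q / m1"
    proof -
      have qe: "- \<alpha> * (1 - \<zeta>) = q - 1" using \<zeta>(3) by (simp add: q_def \<rho>_def algebra_simps)
      have "- \<alpha> * ((1 - \<zeta>) * R / 2) = - \<alpha> * (1 - \<zeta>) / 2 * R" by simp
      then have "exp (- \<alpha> * ((1 - \<zeta>) * R / 2)) = exp (- \<alpha> * (1 - \<zeta>) / 2 * C) * real n powr (2 * (- \<alpha> * (1 - \<zeta>) / 2))"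
        by (simp only: exp_R)
      also have "2 * (- \<alpha> * (1 - \<zeta>) / 2) = q - 1" using qe by simp
      finally have e: "exp (- \<alpha> * ((1 - \<zeta>) * R / 2)) = exp (- \<alpha> * (1 - \<zeta>) / 2 * C) * real n powr (q - 1)" .
      have "real n powr q = real n * real n powr (q - 1)" using n by (simp add: powr_mult_base)
      then show ?thesis unfolding collar_mass_def e cL_def by (simp add: mult_ac)
    qed
    have core: "core_mass m1 = 4 * c5 * real n powr \<rho> / m1"
      unfolding core_mass_def eaR2 n_rho by (simp add: mult_ac)
    have collar0: "0 \<le> collar_mass \<zeta> m1" unfolding collar_mass_def by simp
    have collar1: "collar_mass \<zeta> m1 \<le> 1"
      unfolding collar using elim(5) V(1) m1 by simp
    let ?lB = "?\<beta> * (1 + collar_mass \<zeta> m1)"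
    have lB: "?lB * ?t \<le> ?\<beta> * 2 * ?t"
      using collar1 by (intro mult_right_mono mult_left_mono) auto
    let ?F = "Nb n powr (?lB * ?t) * exp (- (lK n / 2)\<^sup>2 / (8 * k_hi n))
       + Nb n * k_hi n * exp (- ((n / m0 / 24) / (2 * DF n + 1)) / (2 * max (k_hi n) (DF n * exp ((1 - \<zeta>) * R / 4))))"
    have Nb_eq: "Nb n = (R + 1) * (?\<beta> * (1 + 4 * real n))" unfolding Nb_def R_eq by simp
    have k_eq: "k_hi n = real n powr \<delta> * (max_inner_degree ?\<beta> + 1)" unfolding k_hi_def IB by simp
    have main: "1 - ((R + 1) * exp R * exp (- ?\<beta>) + 4 * real n * exp (- \<alpha> * (R - 1)) + m0 * exp (- (n / m0 / 12) / 10)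
      + m1 * exp (- ?\<beta>) + 3 * real m1 * (collar_mass \<zeta> m1 * core_mass m1) / ?t + exp (- lK n / 10))
      \<le> hrg_prob \<alpha> C n (\<lambda>G. rct_prob G {..<nat \<lfloor>real n powr \<delta> * real (chromatic_number G)\<rfloor>} (never_terminates G) \<ge> 1 - ?F)"
      unfolding Nb_eq k_eq DF[symmetric]
    proof (rule hrg_prob_never_terminates_ge)
      show "2 \<le> ?\<beta>" using elim(2) .
      show "0 < \<zeta>" "\<zeta> < 1" using \<zeta>0 \<zeta>(2) by simp_all
      show "(1 + \<zeta>) * R / 2 < R - 1"
      proof -
        have "(1 + \<zeta>) * R / 2 = R - (1 - \<zeta>) * R / 2" by (simp add: field_simps)
        then show ?thesis using elim(3) by (simp add: R_eq)
      qed
      have "inverse ?w = exp (- R / 4)" unfolding w_eq by (simp add: exp_minus)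
      then show "2 * pi / real m0 \<le> exp (- R / 4)" using M0(2) by simp
      show "49 * exp (- R / 4) \<le> 2 * pi / real m1"
      proof -
        have "49 * exp (- R / 4) * real m1 \<le> 49 * exp (- R / 4) * (2 * pi * ?w / 49)"
          using V(2) by (intro mult_left_mono) auto
        also have "\<dots> = 2 * pi" unfolding w_eq by (simp add: exp_minus)
        finally show ?thesis using m1 by (simp add: le_divide_eq)
      qed
      show "0 < ?t" using n by simp
      show "lK n \<le> n * ((exp (\<alpha> * (R / 2)) - 2) * exp (- \<alpha> * R))" using lK by simp
      show "2 * (?lB * ?t) + 4 \<le> lK n / 2" using lB elim(6) by linarith
      show "8 * max_deg_factor ?\<beta> + 1 \<le> real n powr \<delta>" using elim(7) DF by simp
    qed (use M0(1) m1 in auto)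
    have "?F \<le> real n powr (- ln (real n))"
    proof -
      have L: "real n powr (- ln (real n)) = exp (- ln (real n) * ln (real n))" using n by (simp add: powr_def)
      have Nb1: "1 \<le> Nb n"
      proof -
        have "1 * (1 * 1) \<le> (R + 1) * (?\<beta> * (1 + 4 * real n))"
          using R4 elim(2) by (intro mult_mono) auto
        then show ?thesis by (simp add: Nb_eq)
      qed
      have "Nb n powr (?lB * ?t) \<le> Nb n powr (?\<beta> * 2 * ?t)" using Nb1 lB by (intro powr_mono) auto
      also have "\<dots> \<le> (real n powr 2) powr (?\<beta> * 2 * ?t)"
        using Nb1 elim(8) by (intro powr_mono2) auto
      also have "\<dots> = exp ((2 * ?\<beta> * ?t) * (2 * ln (real n)))"
        using n by (simp add: powr_powr powr_def mult_ac)
      finally have "Nb n powr (?lB * ?t) * exp (- (lK n / 2)\<^sup>2 / (8 * k_hi n)) \<le>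
          exp ((2 * ?\<beta> * ?t) * (2 * ln (real n))) * exp (- (lK n / 2)\<^sup>2 / (8 * k_hi n))"
        by (intro mult_right_mono) auto
      then have 1: "Nb n powr (?lB * ?t) * exp (- (lK n / 2)\<^sup>2 / (8 * k_hi n)) \<le> exp (- ln (real n) * ln (real n)) / 4"
        using elim(9) by linarith
      let ?x = "(real n / W n / 24) / (2 * DF n + 1)" and ?D = "DF n * (c4 * real n powr ((1 - \<zeta>) / 2))"
      have D: "DF n * exp ((1 - \<zeta>) * R / 4) = ?D"
      proof -
        have a: "(1 - \<zeta>) * R / 4 = (1 - \<zeta>) / 4 * R" by simp
        have "exp ((1 - \<zeta>) * R / 4) = exp ((1 - \<zeta>) / 4 * C) * real n powr (2 * ((1 - \<zeta>) / 4))"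
          unfolding a by (rule exp_R)
        also have "2 * ((1 - \<zeta>) / 4) = (1 - \<zeta>) / 2" by simp
        finally show ?thesis by (simp only: c4_def times_divide_eq_left)
      qed
      have D_pos: "0 < ?D" using DF_pos c(4) n by simp
      have x0: "0 \<le> ?x" using m0 DF_pos by simp
      have "?x \<le> (n / m0 / 24) / (2 * DF n + 1)"
        using nM DF_pos by (intro divide_right_mono) auto
      then have "?x / (2 * max (k_hi n) ?D) \<le> (n / m0 / 24) / (2 * DF n + 1) / (2 * max (k_hi n) ?D)"
        by (rule divide_right_mono) (use k_hi_pos in simp)
      then have "exp (- ((n / m0 / 24) / (2 * DF n + 1)) / (2 * max (k_hi n) ?D)) \<le> exp (- ?x / (2 * max (k_hi n) ?D))"
        by (simp only: exp_le_cancel_iff minus_divide_left[symmetric] neg_le_iff_le)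
      also have "\<dots> \<le> exp (- ?x / (2 * k_hi n)) + exp (- ?x / (2 * ?D))"
        by (rule exp_div_max_le[OF x0 k_hi_pos D_pos])
      finally have "Nb n * k_hi n * exp (- ((n / m0 / 24) / (2 * DF n + 1)) / (2 * max (k_hi n) ?D)) \<le>
          Nb n * k_hi n * (exp (- ?x / (2 * k_hi n)) + exp (- ?x / (2 * ?D)))"
        using Nb1 k_hi_pos by (intro mult_left_mono) auto
      also have "\<dots> \<le> exp (- ln (real n) * ln (real n)) / 4 + exp (- ln (real n) * ln (real n)) / 4"
        unfolding distrib_left using elim(10,11) by (rule add_mono)
      finally have 2: "Nb n * k_hi n * exp (- ((n / m0 / 24) / (2 * DF n + 1)) / (2 * max (k_hi n) ?D))
        \<le> exp (- ln (real n) * ln (real n)) / 4 + exp (- ln (real n) * ln (real n)) / 4" .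
      have "0 \<le> exp (- ln (real n) * ln (real n))" by simp
      then show ?thesis unfolding D L using 1 2 by linarith
    qed
    then have mono: "hrg_prob \<alpha> C n (\<lambda>G. rct_prob G {..<nat \<lfloor>real n powr \<delta> * real (chromatic_number G)\<rfloor>} (never_terminates G) \<ge> 1 - ?F)
      \<le> hrg_prob \<alpha> C n (\<lambda>G. rct_prob G {..<nat \<lfloor>real n powr \<delta> * real (chromatic_number G)\<rfloor>} (never_terminates G) \<ge> 1 - real n powr (- ln (real n)))"
      by (intro hrg_prob_mono) linarith
    have E1: "exp R = exp C * real n powr 2" using exp_R[of 1] by simp
    have E2: "4 * real n * exp (- \<alpha> * (R - 1)) = 4 * (exp (\<alpha> - \<alpha> * C) * real n powr (1 - 2 * \<alpha>))"
    proof -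
      have "- \<alpha> * (R - 1) = \<alpha> + - \<alpha> * R" by (simp add: algebra_simps)
      then have e: "exp (- \<alpha> * (R - 1)) = exp \<alpha> * (exp (- \<alpha> * C) * real n powr (- 2 * \<alpha>))" by (simp only: exp_add eaR)
      have a: "exp (\<alpha> - \<alpha> * C) = exp \<alpha> * exp (- \<alpha> * C)" by (simp add: exp_add[symmetric])
      show ?thesis unfolding e a n_2a by (simp only: mult_ac)
    qed
    have E3: "m0 * exp (- (n / m0 / 12) / 10) \<le> W n * exp (- (real n / W n / 12) / 10)"
      using m0 nM by (intro mult_mono) auto
    have E4: "m1 * exp (- ?\<beta>) \<le> W n * exp (- ?\<beta>)" using m1W by (intro mult_right_mono) auto
    have E5: "3 * real m1 * (collar_mass \<zeta> m1 * core_mass m1) / ?t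
        \<le> 3 * (cL * real n powr q * (4 * c5 * real n powr \<rho>) / (V n * real n powr \<tau>))"
    proof -
      have "3 * real m1 * (collar_mass \<zeta> m1 * core_mass m1) / ?t
          = 3 * (cL * real n powr q * (4 * c5 * real n powr \<rho>) / (m1 * real n powr \<tau>))"
        unfolding collar core using m1 by simp
      also have "\<dots> \<le> 3 * (cL * real n powr q * (4 * c5 * real n powr \<rho>) / (V n * real n powr \<tau>))"
        using V(1) elim(4) m1 c n by (intro mult_left_mono divide_left_mono mult_right_mono mult_pos_pos mult_nonneg_nonneg) auto
      finally show ?thesis .
    qed
    have "1 - err n \<le> 1 - ((R + 1) * exp R * exp (- ?\<beta>) + 4 * real n * exp (- \<alpha> * (R - 1)) + m0 * exp (- (n / m0 / 12) / 10)
      + m1 * exp (- ?\<beta>) + 3 * real m1 * (collar_mass \<zeta> m1 * core_mass m1) / ?t + exp (- lK n / 10))"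
      unfolding err_def E2 E1 unfolding R_eq using E3 E4 E5 by linarith
    then show ?case using main mono by linarith
  qed
  then have "typical_hrg \<alpha> C (\<lambda>n G.
    rct_prob G {..<nat \<lfloor>real n powr \<delta> * real (chromatic_number G)\<rfloor>} (never_terminates G) \<ge> 1 - real n powr (- ln (real n)))"
    by (rule typical_hrgI) (use err alpha in auto)
  moreover have "filterlim (\<lambda>n. ln (real n)) at_top sequentially" by real_asymp
  moreover have "0 < \<delta>" using m(1) by (simp add: \<delta>_def)
  ultimately show ?thesis by blast
qed

theorem theorem1p1:
  fixes \<alpha> C :: real
  assumes "1 / 2 < \<alpha>" and "\<alpha> < 1"
  shows
    "(\<forall>\<epsilon>::real. \<epsilon> > 0 \<longrightarrow>
        (\<exists>f :: nat \<Rightarrow> real. f \<longlonglongrightarrow> 0 \<and>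
          typical_hrg \<alpha> C (\<lambda>n G.
            rct_prob G {..<nat \<lfloor>\<epsilon> * real (max_degree G)\<rfloor>} (terminates_after G 2)
              \<ge> 1 - f n))) \<and>
     (\<exists>\<delta>::real. \<delta> > 0 \<and>
        (\<exists>g :: nat \<Rightarrow> real. filterlim g at_top sequentially \<and>
          typical_hrg \<alpha> C (\<lambda>n G.
            rct_prob G {..<nat \<lfloor>real n powr \<delta> * real (chromatic_number G)\<rfloor>} (never_terminates G)
              \<ge> 1 - real n powr (- g n))))"
  using typical_hrg_terminates_after_2[OF assms] typical_hrg_never_terminates[OF assms] by blast

end
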